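(* Let $\Bbbk$ be a field. Suppose $\mathcal A\subset\mathbb N^{n+1}$ is a finite homogeneous set with $N+1$ elements, spanning $\mathbb R^{n+1}$ as a vector space and satisfying the conditions (1)–(4) listed in the context. Let $\mathbf t=\sum_{\mathbf a\in\mathcal A}\mathbf a$ and, for $\mathbf c\in\mathbb Z^{n+1}$, let $\check{\mathbf c}=\mathbf t-\mathbf c-(1,\ldots,1)$. Then for any $\mathbf c\in\mathbb Z\mathcal A$ and every $i$, the multigraded Betti numbers of $R_{\mathcal A}$ are given by $$\beta_{i,\mathbf c}(R_{\mathcal A})=\dim_{\Bbbk}\tilde H_{N-n-i-1}(\Gamma_{\check{\mathbf c}}(\mathcal A);\Bbbk).$$ In particular, this formula holds when $R_{\mathcal A}$ is a Veronese module of a weighted projective space, i.e. when $\mathcal A=dP_{\mathbf q}\cap\mathbb Z^{n+1}$ for some integer $d\ge1$ and some weights vector $\mathbf q$.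
   Context: Convention: $0\in\mathbb N$. The partial order on $\mathbb Z^{n+1}$ is $\mathbf a\ge\mathbf b$ iff $\mathbf a-\mathbf b\in\mathbb N^{n+1}$. $\mathbb Z\mathcal A$ is the subgroup of $\mathbb Z^{n+1}$ generated by $\mathcal A$, $\mathbb N\mathcal A$ the semigroup of $\mathbb N$-linear combinations of elements of $\mathcal A$, and $\mathrm{Cone}(\mathcal A)$ the convex cone of nonnegative real linear combinations of elements of $\mathcal A$. $\mathcal A$ is homogeneous if there is $\omega\in\mathbb Q^{n+1}$ with $\omega\cdot\mathbf a=1$ for all $\mathbf a\in\mathcal A$. Pile complex: for $\mathbf c\in\mathbb Z^{n+1}$, $\Gamma_{\mathbf c}(\mathcal A)=\{\mathcal S\subseteq\mathcal A\mid\sum_{\mathbf a\in\mathcal S}\mathbf a\le\mathbf c\}$. Squarefree divisor complex: for $\mathbf c\in\mathbb Z\mathcal A$, $\Delta_{\mathbf c}(\mathcal A)=\{\mathcal S\subseteq\mathcal A\mid\mathbf c-\sum_{\mathbf a\in\mathcal S}\mathbf a\in\mathbb N\mathcal A\}$. Both are abstract simplicial complexes on $\mathcal A$. Reduced homology conventions: the void complex (no faces) has zero reduced homology in all degrees; the complex $\{\varnothing\}$ has $\tilde H_{-1}=\Bbbk$ and $\tilde H_i=0$ for $i\neq-1$. Weights vector: $\mathbf q=(q_0,\dots,q_n)$ with positive integer entries and $\gcd(q_0,\dots,q_n)=1$. Put $r=\mathrm{lcm}(q_0,\dots,q_n)$ and $P_{\mathbf q}=\{\mathbf x\in\mathbb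 R^{n+1}\mid\mathbf q\cdot\mathbf x=r,\ x_i\ge0\ \forall i\}$, so $dP_{\mathbf q}=\{\mathbf x\mid \mathbf q\cdot\mathbf x=dr,\ x_i\ge0\ \forall i\}$. Conditions on $\mathcal A$ (presented in the paper as equivalent to each other): (1) $\mathbb N\mathcal A=\mathbb Z\mathcal A\cap\mathbb N^{n+1}$. (2) $\mathbb N\mathcal A$ is saturated in $\mathbb Z\mathcal A$ (if $\mathbf b\in\mathbb Z\mathcal A$ and $k\mathbf b\in\mathbb N\mathcal A$ for some integer $k\ge1$, then $\mathbf b\in\mathbb N\mathcal A$), and $\mathrm{Cone}(\mathcal A)=\mathrm{Cone}(\mathbb N^{n+1})$. (3) For some $d\ge1$ and weights vector $\mathbf q$, $\mathcal A$ is the intersection of $dP_{\mathbf q}$ with a sublattice $L\le\mathbb Z^{n+1}$ containing the vertices of $dP_{\mathbf q}$. (4) $\Delta_{\mathbf c}(\mathcal A)=\Gamma_{\mathbf c}(\mathcal A)$ for all $\mathbf c\in\mathbb Z\mathcal A$. Write $\mathcal A=\{\mathbf a_0,\dots,\mathbf a_N\}$ and $S=\Bbbk[X_0,\dots,X_N]$. The toric ideal $I_{\mathcal A}$ is the kernel of the $\Bbbk$-algebra map $S\to\Bbbk[Y_0,\dots,Y_n]$, $X_i\mapsto Y^{\mathbf a_i}$, and $R_{\mathcal A}=S/I_{\mathcal A}$. $S$ and $R_{\mathcal A}$ are $\mathbb Z^{n+1}$-graded by $\mathrm{mdeg}(X_i)=\mathbf a_i$. The multigraded Betti number $\beta_{i,\mathbf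 c}(R_{\mathcal A})$ is the number of copies of $S(-\mathbf c)$ in the $i$-th module $F_i\cong\bigoplus_{\mathbf c}S(-\mathbf c)^{\beta_{i,\mathbf c}}$ of the minimal multigraded free resolution of $R_{\mathcal A}$ over $S$.
   Formalization: In the "in particular" clause, condition (1) is assumed in addition to A = dP_q ∩ Z^{n+1}; without it the formula fails, e.g. for q = (1,6,10,15), d = 1, c = (1,4,2,1), i = 0. *)

theory Defs
  imports
    "HOL-Analysis.Analysis"
    "HOL-Library.Poly_Mapping"
    "HOL-Computational_Algebra.Group_Closure"
begin

section \<open>Lattice point configurations\<close>

text \<open>
  The ambient lattice is \<open>int ^ 'n\<close>, so \<open>CARD('n)\<close> is the number of coordinates.  Its library
  order is componentwise, and \<open>1 :: int ^ 'n\<close> is the all-ones vector.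
\<close>

definition rvec :: "int ^ 'n \<Rightarrow> real ^ 'n" where
  "rvec x = (\<chi> i. real_of_int (x $ i))"

definition nat_span :: "(int ^ 'n) set \<Rightarrow> (int ^ 'n) set" where
  "nat_span A = {\<Sum>a\<in>A. of_nat (k a) *s a | k :: int ^ 'n \<Rightarrow> nat. True}"

abbreviation int_span :: "(int ^ 'n) set \<Rightarrow> (int ^ 'n) set" where
  "int_span A \<equiv> group_closure A"

definition real_cone :: "(int ^ 'n) set \<Rightarrow> (real ^ 'n) set" where
  "real_cone A = convex_cone hull (rvec ` A)"

definition homogeneous :: "(int ^ 'n) set \<Rightarrow> bool" where
  "homogeneous A \<longleftrightarrow> (\<exists>\<omega> :: rat ^ 'n. \<forall>a\<in>A. (\<Sum>i\<in>UNIV. \<omega> $ i * of_int (a $ i)) = 1)"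

definition pile_complex :: "(int ^ 'n) set \<Rightarrow> int ^ 'n \<Rightarrow> (int ^ 'n) set set" where
  "pile_complex A c = {S. S \<subseteq> A \<and> \<Sum>S \<le> c}"

definition divisor_complex :: "(int ^ 'n) set \<Rightarrow> int ^ 'n \<Rightarrow> (int ^ 'n) set set" where
  "divisor_complex A c = {S. S \<subseteq> A \<and> c - \<Sum>S \<in> nat_span A}"

definition weights_vector :: "nat ^ 'n \<Rightarrow> bool" where
  "weights_vector q \<longleftrightarrow> (\<forall>i. 0 < q $ i) \<and> Gcd (range (($) q)) = 1"

text \<open>The dilate \<open>dP\<^sub>q\<close>, with \<open>r\<close> the least common multiple of the weights.\<close>

definition weighted_simplex :: "nat \<Rightarrow> nat ^ 'n \<Rightarrow> (real ^ 'n) set" where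
  "weighted_simplex d q =
     {x. (\<Sum>i\<in>UNIV. real (q $ i) * x $ i) = real (d * Lcm (range (($) q))) \<and> (\<forall>i. 0 \<le> x $ i)}"

definition condition1 :: "(int ^ 'n) set \<Rightarrow> bool" where
  "condition1 A \<longleftrightarrow> nat_span A = int_span A \<inter> {x. 0 \<le> x}"

definition condition2 :: "(int ^ 'n) set \<Rightarrow> bool" where
  "condition2 A \<longleftrightarrow>
     (\<forall>b\<in>int_span A. \<forall>k::nat. 1 \<le> k \<longrightarrow> of_nat k *s b \<in> nat_span A \<longrightarrow> b \<in> nat_span A) \<and>
     real_cone A = real_cone {x. 0 \<le> x}"

definition condition3 :: "(int ^ 'n) set \<Rightarrow> bool" where
  "condition3 A \<longleftrightarrow>
     (\<exists>d q L. 1 \<le> d \<and> weights_vector q \<and>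
        0 \<in> L \<and> (\<forall>x\<in>L. \<forall>y\<in>L. x - y \<in> L) \<and>
        {v. v extreme_point_of weighted_simplex d q} \<subseteq> rvec ` L \<and>
        A = {x \<in> L. rvec x \<in> weighted_simplex d q})"

definition condition4 :: "(int ^ 'n) set \<Rightarrow> bool" where
  "condition4 A \<longleftrightarrow> (\<forall>c\<in>int_span A. divisor_complex A c = pile_complex A c)"


section \<open>Reduced simplicial homology\<close>

definition pm_scale :: "'r::comm_ring_1 \<Rightarrow> ('x \<Rightarrow>\<^sub>0 'r) \<Rightarrow> ('x \<Rightarrow>\<^sub>0 'r)" where
  "pm_scale r u = Poly_Mapping.map ((*) r) u"

lemma lookup_pm_scale [simp]: "Poly_Mapping.lookup (pm_scale r u) x = r * Poly_Mapping.lookup u x"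
  by (simp add: pm_scale_def Poly_Mapping.map.rep_eq when_def split: if_splits)

lemma module_pm_scale: "module (pm_scale :: 'r::comm_ring_1 \<Rightarrow> ('x \<Rightarrow>\<^sub>0 'r) \<Rightarrow> _)"
  by unfold_locales (auto intro!: poly_mapping_eqI simp: lookup_add algebra_simps)

lemma vector_space_pm_scale: "vector_space (pm_scale :: 'k::field \<Rightarrow> ('x \<Rightarrow>\<^sub>0 'k) \<Rightarrow> _)"
  by unfold_locales (auto intro!: poly_mapping_eqI simp: lookup_add algebra_simps)

text \<open>
  Chains are formal linear combinations of faces; a \<open>p\<close>-face has \<open>p + 1\<close> vertices, and the empty
  set is the only \<open>(-1)\<close>-face.  Faces are oriented by the linear order that \<open>to_nat\<close> induces on the
  vertices; another order gives an isomorphic chain complex.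
\<close>

definition chains :: "'x set set \<Rightarrow> int \<Rightarrow> ('x set \<Rightarrow>\<^sub>0 'k::field) set" where
  "chains K p = {f. \<forall>F\<in>Poly_Mapping.keys f. F \<in> K \<and> finite F \<and> int (card F) = p + 1}"

definition boundary :: "('x::countable set \<Rightarrow>\<^sub>0 'k::field) \<Rightarrow> ('x set \<Rightarrow>\<^sub>0 'k)" where
  "boundary f = (\<Sum>F\<in>Poly_Mapping.keys f. \<Sum>x\<in>F.
     Poly_Mapping.single (F - {x}) ((-1) ^ card {y\<in>F. to_nat y < to_nat x} * Poly_Mapping.lookup f F))"

definition cycles :: "'x::countable set set \<Rightarrow> int \<Rightarrow> ('x set \<Rightarrow>\<^sub>0 'k::field) set" where
  "cycles K p = {f \<in> chains K p. boundary f = 0}"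

definition boundaries :: "'x::countable set set \<Rightarrow> int \<Rightarrow> ('x set \<Rightarrow>\<^sub>0 'k::field) set" where
  "boundaries K p = boundary ` chains K (p + 1)"

text \<open>
  The dimension of cycles modulo boundaries, for complexes with finitely many faces, where both
  spaces are finite-dimensional.
\<close>

definition reduced_homology_dim :: "'k::field itself \<Rightarrow> 'x::countable set set \<Rightarrow> int \<Rightarrow> nat" where
  "reduced_homology_dim _ K p =
     vector_space.dim pm_scale (cycles K p :: ('x set \<Rightarrow>\<^sub>0 'k) set) -
     vector_space.dim pm_scale (boundaries K p :: ('x set \<Rightarrow>\<^sub>0 'k) set)"


section \<open>Toric ideals\<close>

type_synonym ('v, 'k) mpoly = "('v \<Rightarrow>\<^sub>0 nat) \<Rightarrow>\<^sub>0 'k"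

definition monomial :: "int ^ 'n \<Rightarrow> ('n, 'k::field) mpoly" where
  "monomial b = Poly_Mapping.single (Abs_poly_mapping (\<lambda>j. nat (b $ j))) 1"

definition toric_map :: "('v::finite \<Rightarrow> int ^ 'n) \<Rightarrow> ('v, 'k::field) mpoly \<Rightarrow> ('n, 'k) mpoly" where
  "toric_map a f =
     (\<Sum>e\<in>Poly_Mapping.keys f. Poly_Mapping.single 0 (Poly_Mapping.lookup f e) *
        (\<Prod>v\<in>UNIV. monomial (a v) ^ Poly_Mapping.lookup e v))"

definition toric_ideal :: "('v::finite \<Rightarrow> int ^ 'n) \<Rightarrow> ('v, 'k::field) mpoly set" where
  "toric_ideal a = {f. toric_map a f = 0}"


section \<open>Multigraded free resolutions\<close>

definition mdeg :: "('v::finite \<Rightarrow> int ^ 'n) \<Rightarrow> ('v \<Rightarrow>\<^sub>0 nat) \<Rightarrow> int ^ 'n" where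
  "mdeg a e = (\<Sum>v\<in>UNIV. of_nat (Poly_Mapping.lookup e v) *s a v)"

definition mhomogeneous :: "('v::finite \<Rightarrow> int ^ 'n) \<Rightarrow> int ^ 'n \<Rightarrow> ('v, 'k::field) mpoly \<Rightarrow> bool" where
  "mhomogeneous a c f \<longleftrightarrow> (\<forall>e\<in>Poly_Mapping.keys f. mdeg a e = c)"

text \<open>
  A basis element of a multigraded free module is a pair \<open>(b, j)\<close>: the \<open>j\<close>-th generator of
  degree \<open>b\<close>.  With multiplicities \<open>m\<close>, the module is the direct sum over all \<open>b\<close> of \<open>m b\<close> copies of
  \<open>S(-b)\<close>.
\<close>

type_synonym ('n, 'v, 'k) free_elem = "((int ^ 'n) \<times> nat) \<Rightarrow>\<^sub>0 ('v, 'k) mpoly"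

definition free_module :: "(int ^ 'n \<Rightarrow> nat) \<Rightarrow> ('n, 'v, 'k::field) free_elem set" where
  "free_module m = {u. \<forall>(b, j)\<in>Poly_Mapping.keys u. j < m b}"

definition free_homogeneous ::
    "('v::finite \<Rightarrow> int ^ 'n) \<Rightarrow> int ^ 'n \<Rightarrow> ('n, 'v, 'k::field) free_elem \<Rightarrow> bool" where
  "free_homogeneous a c u \<longleftrightarrow>
     (\<forall>(b, j)\<in>Poly_Mapping.keys u. mhomogeneous a (c - b) (Poly_Mapping.lookup u (b, j)))"

definition ideal_rel :: "('v, 'k::field) mpoly set \<Rightarrow> (('v, 'k) mpoly \<times> ('v, 'k) mpoly) set" where
  "ideal_rel I = {(f, g). f - g \<in> I}"

text \<open>
  A multigraded free resolution of \<open>S / I\<close>, where \<open>F\<^sub>i = free_module (\<beta> i)\<close> and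
  \<open>d i : F\<^sub>i\<^sub>+\<^sub>1 \<rightarrow> F\<^sub>i\<close>.  Linearity is required on the whole type; this costs nothing, as a linear
  map on \<open>F\<^sub>i\<^sub>+\<^sub>1\<close> extends by zero on the remaining basis elements, and every other clause only
  concerns \<open>F\<^sub>i\<^sub>+\<^sub>1\<close>.  The augmentation \<open>F\<^sub>0 \<rightarrow> S / I\<close> is given by a degree-preserving
  lift \<open>\<epsilon> : F\<^sub>0 \<rightarrow> S\<close>, which exists because \<open>F\<^sub>0\<close> is free.
\<close>

definition free_resolution ::
    "('v::finite \<Rightarrow> int ^ 'n) \<Rightarrow> ('v, 'k::field) mpoly set \<Rightarrow> (nat \<Rightarrow> int ^ 'n \<Rightarrow> nat) \<Rightarrow>
     (('n, 'v, 'k) free_elem \<Rightarrow> ('v, 'k) mpoly) \<Rightarrow>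
     (nat \<Rightarrow> ('n, 'v, 'k) free_elem \<Rightarrow> ('n, 'v, 'k) free_elem) \<Rightarrow> bool" where
  "free_resolution a I \<beta> \<epsilon> d \<longleftrightarrow>
     module_hom pm_scale (*) \<epsilon> \<and>
     (\<forall>i. module_hom pm_scale pm_scale (d i)) \<and>
     (\<forall>c. \<forall>u\<in>free_module (\<beta> 0). free_homogeneous a c u \<longrightarrow> mhomogeneous a c (\<epsilon> u)) \<and>
     (\<forall>i c. \<forall>u\<in>free_module (\<beta> (Suc i)). free_homogeneous a c u \<longrightarrow> free_homogeneous a c (d i u)) \<and>
     (\<lambda>u. ideal_rel I `` {\<epsilon> u}) ` free_module (\<beta> 0) = UNIV // ideal_rel I \<and>
     d 0 ` free_module (\<beta> 1) = {u \<in> free_module (\<beta> 0). \<epsilon> u \<in> I} \<and>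
     (\<forall>i. d (Suc i) ` free_module (\<beta> (Suc (Suc i))) = {u \<in> free_module (\<beta> (Suc i)). d i u = 0})"

text \<open>Minimality: each differential maps into the irrelevant maximal ideal times its target.\<close>

definition minimal_free_resolution ::
    "('v::finite \<Rightarrow> int ^ 'n) \<Rightarrow> ('v, 'k::field) mpoly set \<Rightarrow> (nat \<Rightarrow> int ^ 'n \<Rightarrow> nat) \<Rightarrow>
     (('n, 'v, 'k) free_elem \<Rightarrow> ('v, 'k) mpoly) \<Rightarrow>
     (nat \<Rightarrow> ('n, 'v, 'k) free_elem \<Rightarrow> ('n, 'v, 'k) free_elem) \<Rightarrow> bool" where
  "minimal_free_resolution a I \<beta> \<epsilon> d \<longleftrightarrow>
     free_resolution a I \<beta> \<epsilon> d \<and>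
     (\<forall>i. \<forall>u\<in>free_module (\<beta> (Suc i)). \<forall>x.
        Poly_Mapping.lookup (Poly_Mapping.lookup (d i u) x) 0 = 0)"

text \<open>
  The number of copies of \<open>S(-c)\<close> in the \<open>i\<close>-th module of the minimal multigraded free resolution of
  \<open>S / I\<close>.
\<close>

definition betti ::
    "('v::finite \<Rightarrow> int ^ 'n) \<Rightarrow> ('v, 'k::field) mpoly set \<Rightarrow> nat \<Rightarrow> int ^ 'n \<Rightarrow> nat" where
  "betti a I i c = (THE b. \<exists>\<beta> \<epsilon> d. minimal_free_resolution a I \<beta> \<epsilon> d \<and> \<beta> i c = b)"

end

theory Submission
  imports Defs "HOL-Library.Function_Algebras"
begin

text \<open>
  Let \<open>\<Delta>\<close> and \<open>\<Gamma>\<close> denote the squarefree divisor complex and the pile complex in degree \<open>c\<close>.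
  Since the Koszul complex of a free module is exact in positive degrees, breaking a minimal
  resolution into short exact sequences shifts Koszul homology one step at a time, so the Betti
  number in homological degree \<open>i\<close> is the dimension of the \<open>i\<close>-th Koszul homology of \<open>R\<close> in degree \<open>c\<close>.
  Each graded piece of \<open>R\<close> is the field or zero, so this Koszul complex is the chain complex of
  \<open>\<Delta>\<close>, shifted by one.  Condition (1) turns \<open>\<Delta>\<close> into \<open>\<Gamma>\<close>.  The Alexander dual of \<open>\<Gamma>\<close> is
  the union of the \<open>n + 1\<close> complexes obtained by imposing a single coordinate of the inequality
  that defines the pile complex at \<open>t - c - 1\<close>.  Any intersection of fewer than \<open>n + 1\<close> of them is
  a cone, whose apex is an element of \<open>A\<close> on a coordinate axis that is not involved; hence
  Mayer-Vietoris shifts the homology of the total intersection by \<open>n\<close> to that of the union.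
\<close>

text \<open>\<open>betti\<close> is a definite description, so both the existence of a minimal
  resolution and the independence of its multiplicities are owed. Independence costs nothing extra:
  every minimal resolution computes the same Koszul homology. For existence, finitely many
  generators in each degree suffice, and their number is itself read off from Koszul homology. This
  is finite-dimensional for R because the simplicial complexes are finite, and dimension shifting
  passes the finiteness from each syzygy module to the next. Generator degrees are nonnegative and
  the variables have nonzero degree, so generation follows by induction on the coordinate sum.
  Quotients are never formed: M / N is kept as a pair of subgroups, and isomorphisms of homology are
  linear relations between cycles, so that connecting homomorphisms need no chosen preimages. The
  all-ones vector in t - c - 1 comes from integrality: in one coordinate, the negation of t - s
  \<le> c is s \<le> t - c - 1. The elements on the axes are vertices of the weighted simplex,
  integral because each weight divides the least common multiple.\<close>

section \<open>Bases modulo a subspace\<close>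

text \<open>
  \<open>n\<close> is the dimension of \<open>Z / B\<close>.  Working with bases modulo \<open>B\<close> makes sense without any
  finiteness assumption, and lets diagram chases be phrased with linear relations.
\<close>

definition quot_dim :: "('k::field \<Rightarrow> 'a::ab_group_add \<Rightarrow> 'a) \<Rightarrow> 'a set \<Rightarrow> 'a set \<Rightarrow> nat \<Rightarrow> bool" where
  "quot_dim s Z B n \<longleftrightarrow> (\<exists>g::nat \<Rightarrow> 'a. (\<forall>j<n. g j \<in> Z) \<and>
     (\<forall>z\<in>Z. \<exists>l. z - (\<Sum>j<n. s (l j) (g j)) \<in> B) \<and>
     (\<forall>l. (\<Sum>j<n. s (l j) (g j)) \<in> B \<longrightarrow> (\<forall>j<n. l j = 0)))"

text \<open>R induces an isomorphism from Z / B to Z' / B': it is linear, total on both sides, and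
  matches B with B' on related pairs. Hence any elements related to a basis modulo B form a basis
  modulo B'.\<close>

lemma quot_dim_transfer_imp:
  fixes s :: "'k::field \<Rightarrow> 'a::ab_group_add \<Rightarrow> 'a" and t :: "'k \<Rightarrow> 'b::ab_group_add \<Rightarrow> 'b"
  assumes zero: "R 0 0"
    and diff: "\<And>x y x' y'. R x y \<Longrightarrow> R x' y' \<Longrightarrow> R (x - x') (y - y')"
    and scale: "\<And>r x y. R x y \<Longrightarrow> R (s r x) (t r y)"
    and left: "\<And>z. z \<in> Z \<Longrightarrow> \<exists>z'. R z z'"
    and right: "\<And>z'. z' \<in> Z' \<Longrightarrow> \<exists>z. R z z'"
    and mem: "\<And>z z'. R z z' \<Longrightarrow> z \<in> Z \<and> z' \<in> Z' \<and> (z \<in> B \<longleftrightarrow> z' \<in> B')"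
    and q: "quot_dim s Z B n"
  shows "quot_dim t Z' B' n"
proof -
  obtain g where g: "\<And>j. j < n \<Longrightarrow> g j \<in> Z"
      "\<And>z. z \<in> Z \<Longrightarrow> \<exists>l. z - (\<Sum>j<n. s (l j) (g j)) \<in> B"
      "\<And>l j. (\<Sum>j<n. s (l j) (g j)) \<in> B \<Longrightarrow> j < n \<Longrightarrow> l j = 0"
    using q unfolding quot_dim_def by blast
  have "\<exists>g'. \<forall>j<n. R (g j) (g' j)"
    using left[OF g(1)] by metis
  then obtain g' where g': "\<And>j. j < n \<Longrightarrow> R (g j) (g' j)" by blast
  have plus: "R (x + x') (y + y')" if "R x y" "R x' y'" for x y x' y'
    using diff[OF that(1) diff[OF zero that(2)]] by simp
  have "R (\<Sum>j<m. s (l j) (g j)) (\<Sum>j<m. t (l j) (g' j))" if "m \<le> n" for m l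
    using that by (induction m) (auto intro!: plus scale g' zero)
  then have sums: "R (\<Sum>j<n. s (l j) (g j)) (\<Sum>j<n. t (l j) (g' j))" for l by blast
  show ?thesis unfolding quot_dim_def
  proof (intro exI[of _ g'] conjI allI impI ballI)
    fix j assume "j < n" then show "g' j \<in> Z'" using g' mem by blast
  next
    fix z' assume "z' \<in> Z'"
    then obtain z where z: "R z z'" using right by blast
    then obtain l where "z - (\<Sum>j<n. s (l j) (g j)) \<in> B" using g(2) mem by blast
    then show "\<exists>l. z' - (\<Sum>j<n. t (l j) (g' j)) \<in> B'"
      using mem diff[OF z sums] by blast
  next
    fix l j assume "(\<Sum>j<n. t (l j) (g' j)) \<in> B'" "j < n"
    then show "l j = 0" using mem[OF sums] g(3) by blast
  qed
qed

lemma quot_dim_transfer: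
  fixes s :: "'k::field \<Rightarrow> 'a::ab_group_add \<Rightarrow> 'a" and t :: "'k \<Rightarrow> 'b::ab_group_add \<Rightarrow> 'b"
  assumes "R 0 0"
    and "\<And>x y x' y'. R x y \<Longrightarrow> R x' y' \<Longrightarrow> R (x - x') (y - y')"
    and "\<And>r x y. R x y \<Longrightarrow> R (s r x) (t r y)"
    and "\<And>z. z \<in> Z \<Longrightarrow> \<exists>z'. R z z'"
    and "\<And>z'. z' \<in> Z' \<Longrightarrow> \<exists>z. R z z'"
    and "\<And>z z'. R z z' \<Longrightarrow> z \<in> Z \<and> z' \<in> Z' \<and> (z \<in> B \<longleftrightarrow> z' \<in> B')"
  shows "quot_dim s Z B n \<longleftrightarrow> quot_dim t Z' B' n"
proof
  assume "quot_dim s Z B n"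
  then show "quot_dim t Z' B' n"
    by (rule quot_dim_transfer_imp[of R, rotated -1]) (use assms in blast)+
next
  assume "quot_dim t Z' B' n"
  then show "quot_dim s Z B n"
    by (rule quot_dim_transfer_imp[of "\<lambda>x y. R y x", rotated -1]) (use assms in blast)+
qed

lemma quot_dim_0_iff: "quot_dim s Z B 0 \<longleftrightarrow> Z \<subseteq> B"
  by (auto simp: quot_dim_def)

text \<open>A basis modulo B together with a basis of B is a basis of Z (\<open>un\<close>), and the
  vectors that extend a basis of B to one of Z form a basis modulo B (\<open>ex\<close>). Applying
  \<open>un\<close> to the basis from \<open>ex\<close> gives the direction from dimensions back to
  \<open>quot_dim\<close>.\<close>

lemma (in vector_space) quot_dim_iff_dim:
  assumes Z: "subspace Z" and B: "subspace B" and BZ: "B \<subseteq> Z"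
    and fin: "finite C" "Z \<subseteq> span C"
  shows "quot_dim scale Z B n \<longleftrightarrow> dim Z = dim B + n"
proof -
  obtain BB where BB: "BB \<subseteq> B" "independent BB" "B \<subseteq> span BB" "card BB = dim B"
    using basis_exists by blast
  have finI: "finite I" if "independent I" "I \<subseteq> Z" for I
    using independent_span_bound[OF fin(1) that(1)] that(2) fin(2) by blast
  have spB: "span BB = B" using BB B span_minimal by blast
  have finBB: "finite BB" using finI BB BZ by blast
  obtain BZ' where E: "BB \<subseteq> BZ'" "BZ' \<subseteq> Z" "independent BZ'" "Z \<subseteq> span BZ'"
    using maximal_independent_subset_extend[of BB Z] BB BZ by blast
  have finZ: "finite BZ'" using finI E by blast
  have cZ: "card BZ' = dim Z" by (metis E(2,3,4) basis_card_eq_dim)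
  have un: "dim Z = dim B + m" if q: "quot_dim scale Z B m" for m
  proof -
    obtain g where g: "\<And>j. j < m \<Longrightarrow> g j \<in> Z"
      "\<And>z. z \<in> Z \<Longrightarrow> \<exists>l. z - (\<Sum>j<m. scale (l j) (g j)) \<in> B"
      "\<And>l j. (\<Sum>j<m. scale (l j) (g j)) \<in> B \<Longrightarrow> j < m \<Longrightarrow> l j = 0"
      using q unfolding quot_dim_def by blast
    \<comment> \<open>Injectivity and disjointness are carried through the induction because
      independence of a set does not notice repeated vectors, and the cardinality is needed in the
      end.\<close>
    have "g ` {..<k} \<inter> BB = {} \<and> inj_on g {..<k} \<and> independent (BB \<union> g ` {..<k})" if "k \<le> m" for k
      using that
    proof (induction k)
      case 0 then show ?case using BB by simp
    next
      case (Suc k)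
      then have IH: "g ` {..<k} \<inter> BB = {}" "inj_on g {..<k}" "independent (BB \<union> g ` {..<k})" by auto
      have "g k \<notin> span (BB \<union> g ` {..<k})"
      proof
        assume "g k \<in> span (BB \<union> g ` {..<k})"
        then obtain b y where b: "b \<in> B" "y \<in> span (g ` {..<k})" "g k = b + y"
          unfolding span_Un spB by auto
        have "\<exists>l. y = (\<Sum>j<k. scale (l j) (g j))"
        proof -
          obtain u where "y = (\<Sum>v\<in>g ` {..<k}. scale (u v) v)"
            using b(2) by (auto simp: span_finite)
          then have "y = (\<Sum>j<k. scale (u (g j)) (g j))"
            by (simp add: sum.reindex[OF IH(2)])
          then show ?thesis by (intro exI[of _ "\<lambda>j. u (g j)"])
        qed
        then obtain l where l: "y = (\<Sum>j<k. scale (l j) (g j))" by blast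
        \<comment> \<open>These are the coefficients of g k - y = b, so the combination lies in B
          although its coefficient at k is 1.\<close>
        define l' where "l' j = (if j < k then - l j else if j = k then 1 else 0)" for j
        have "(\<Sum>j<m. scale (l' j) (g j)) = (\<Sum>j<Suc k. scale (l' j) (g j))"
          using Suc.prems by (intro sum.mono_neutral_right) (auto simp: l'_def)
        also have "\<dots> = b"
          using b(3) by (simp add: l'_def l sum_negf)
        finally have "(\<Sum>j<m. scale (l' j) (g j)) \<in> B" using b by simp
        then have "l' k = 0" using g(3) Suc.prems by (metis Suc_le_lessD)
        then show False by (simp add: l'_def)
      qed
      then have nin: "g k \<notin> BB \<union> g ` {..<k}" by (meson span_superset subsetD)
      have "independent (insert (g k) (BB \<union> g ` {..<k}))"
        using \<open>g k \<notin> span _\<close> IH(3) by (simp add: independent_insert)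
      then show ?case using IH nin by (auto simp: lessThan_Suc)
    qed
    from this[of m] have I: "g ` {..<m} \<inter> BB = {}" "inj_on g {..<m}" "independent (BB \<union> g ` {..<m})" by auto
    have sub: "BB \<union> g ` {..<m} \<subseteq> Z" using g BB BZ by auto
    have "Z \<subseteq> span (BB \<union> g ` {..<m})"
    proof
      fix z assume "z \<in> Z"
      then obtain l where l: "z - (\<Sum>j<m. scale (l j) (g j)) \<in> B" using g(2) by blast
      have "(\<Sum>j<m. scale (l j) (g j)) \<in> span (g ` {..<m})"
        by (intro span_sum span_scale span_base) auto
      then have "(z - (\<Sum>j<m. scale (l j) (g j))) + (\<Sum>j<m. scale (l j) (g j)) \<in> span (BB \<union> g ` {..<m})"
        using l spB by (intro span_add) (auto intro: span_mono[THEN subsetD, rotated])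
      then show "z \<in> span (BB \<union> g ` {..<m})" by simp
    qed
    then have "dim Z = card (BB \<union> g ` {..<m})"
      using basis_card_eq_dim[OF sub _ I(3)] by simp
    also have "\<dots> = card BB + card (g ` {..<m})"
      using I finBB by (intro card_Un_disjoint) auto
    finally show ?thesis using BB I by (simp add: card_image)
  qed
  have ex: "quot_dim scale Z B (card (BZ' - BB))"
  proof -
    let ?m = "card (BZ' - BB)"
    obtain g where g: "bij_betw g {..<?m} (BZ' - BB)"
      using finZ by (metis finite_Diff ex_bij_betw_nat_finite lessThan_atLeast0)
    have gi: "inj_on g {..<?m}" "g ` {..<?m} = BZ' - BB" using g by (auto simp: bij_betw_def)
    define gi where "gi = the_inv_into {..<?m} g"
    have S: "(\<Sum>j<?m. scale (l j) (g j)) = (\<Sum>v\<in>BZ' - BB. scale (l (gi v)) v)" for l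
      unfolding sum.reindex_bij_betw[OF g, symmetric]
      by (intro sum.cong) (auto simp: gi_def the_inv_into_f_f[OF gi(1)])
    show ?thesis unfolding quot_dim_def
    proof (intro exI[of _ g] conjI allI impI ballI)
      fix j assume "j < ?m" then show "g j \<in> Z" using gi E by blast
    next
      fix z assume "z \<in> Z"
      then have "z \<in> span BZ'" using E by blast
      then obtain u where u: "z = (\<Sum>v\<in>BZ'. scale (u v) v)"
        using finZ by (auto simp: span_finite)
      have "z = (\<Sum>v\<in>BZ' - BB. scale (u v) v) + (\<Sum>v\<in>BB. scale (u v) v)"
        using u sum.subset_diff[OF E(1) finZ] by metis
      moreover have "(\<Sum>v\<in>BB. scale (u v) v) \<in> B"
        unfolding spB[symmetric] by (intro span_sum span_scale span_base)
      moreover have "(\<Sum>j<?m. scale (u (g j)) (g j)) = (\<Sum>v\<in>BZ' - BB. scale (u v) v)"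
        by (rule sum.reindex_bij_betw[OF g])
      ultimately show "\<exists>l. z - (\<Sum>j<?m. scale (l j) (g j)) \<in> B"
        by (intro exI[of _ "\<lambda>j. u (g j)"]) auto
    next
      fix l j assume lB: "(\<Sum>j<?m. scale (l j) (g j)) \<in> B" and j: "j < ?m"
      then obtain u where u: "(\<Sum>j<?m. scale (l j) (g j)) = (\<Sum>v\<in>BB. scale (u v) v)"
        unfolding spB[symmetric] using finBB by (auto simp: span_finite)
      \<comment> \<open>Moving the expansion over \<open>BB\<close> to the other side yields a
        vanishing combination of the basis \<open>BZ'\<close>.\<close>
      define w where "w v = (if v \<in> BB then - u v else l (gi v))" for v
      have "(\<Sum>v\<in>BZ'. scale (w v) v) = (\<Sum>v\<in>BZ' - BB. scale (w v) v) + (\<Sum>v\<in>BB. scale (w v) v)"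
        using sum.subset_diff[OF E(1) finZ] by metis
      also have "\<dots> = 0" using u unfolding S by (simp add: w_def sum_negf)
      finally have w0: "(\<Sum>v\<in>BZ'. scale (w v) v) = 0" .
      have gj: "g j \<in> BZ' - BB" using j gi(2) by blast
      have "w (g j) = 0"
        by (rule independentD[OF E(3) finZ subset_refl w0]) (use gj in blast)
      then show "l j = 0" using j gj by (simp add: w_def gi_def the_inv_into_f_f[OF gi(1)])
    qed
  qed
  show ?thesis
  proof
    assume "dim Z = dim B + n"
    then have "n = card (BZ' - BB)" using un[OF ex] by simp
    then show "quot_dim scale Z B n" using ex by simp
  qed (rule un)
qed

section \<open>Koszul complexes of graded modules\<close>

text \<open>The sign (-1)^n acting on a bare abelian group, so that the coefficients of a Koszul
  complex need no ring of scalars.\<close>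

definition signed :: "nat \<Rightarrow> 'm::ab_group_add \<Rightarrow> 'm" where
  "signed n m = (if even n then m else - m)"

lemma signed_simps [simp]:
  "signed 0 m = m" "signed n 0 = 0" "signed (Suc n) m = - signed n m" "signed n (- m) = - signed n m"
  "signed n (signed n m) = m" "signed n m = 0 \<longleftrightarrow> m = 0"
  by (auto simp: signed_def)

lemma signed_signed: "signed n (signed k m) = signed (n + k) m"
  by (auto simp: signed_def)

lemma signed_diff: "signed n (x - y) = signed n x - signed n y"
  by (auto simp: signed_def)

lemma signed_sum: "signed n (sum f A) = (\<Sum>x\<in>A. signed n (f x))"
  by (auto simp: signed_def sum_negf)

lemma additive_signed: "Modules.additive f \<Longrightarrow> f (signed n x) = signed n (f x)"
  by (auto simp: signed_def additive.minus)

lemma sum_in: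
  assumes "0 \<in> M" "\<And>x y. x \<in> M \<Longrightarrow> y \<in> M \<Longrightarrow> x - y \<in> (M :: 'm::ab_group_add set)"
    "\<And>i. i \<in> I \<Longrightarrow> f i \<in> M"
  shows "sum f I \<in> M"
  using assms(3)
proof (induction I rule: infinite_finite_induct)
  case (insert i I)
  then have "f i - (0 - sum f I) \<in> M" using assms(1,2) by blast
  then show ?case using insert by simp
qed (use assms(1) in auto)

definition num_before :: "('v \<Rightarrow> nat) \<Rightarrow> 'v set \<Rightarrow> 'v \<Rightarrow> nat" where
  "num_before key G x = card {y \<in> G. key y < key x}"

lemma num_before_insert:
  fixes key :: "'v::finite \<Rightarrow> nat"
  assumes "x \<notin> G" shows "num_before key (insert x G) y = num_before key G y + (if key x < key y then 1 else 0)"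
proof -
  have "{z \<in> insert x G. key z < key y} =
      (if key x < key y then insert x {z \<in> G. key z < key y} else {z \<in> G. key z < key y})"
    by auto
  then show ?thesis using assms by (auto simp: num_before_def)
qed

text \<open>The Koszul differential, with a chain stored as the family of its coefficients. The
  component at G collects what arrives from \<open>insert x G\<close> when x is removed; counting
  the predecessors of x in G or in \<open>insert x G\<close> gives the same sign.\<close>

definition kdiff ::
    "('v::finite \<Rightarrow> nat) \<Rightarrow> ('v \<Rightarrow> 'm \<Rightarrow> 'm::ab_group_add) \<Rightarrow> ('v set \<Rightarrow> 'm) \<Rightarrow> 'v set \<Rightarrow> 'm" where
  "kdiff key X u G = (\<Sum>x\<in>-G. signed (num_before key G x) (X x (u (insert x G))))"

lemma kdiff_minus:
  assumes "\<And>v. Modules.additive (X v)"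
  shows "kdiff key X (u - w) = kdiff key X u - kdiff key X w"
  by (auto simp: kdiff_def additive.diff[OF assms] signed_diff sum_subtractf fun_eq_iff)

lemma kdiff_zero: assumes "\<And>v. Modules.additive (X v)" shows "kdiff key X 0 = 0"
  using kdiff_minus[OF assms, where u=0 and w=0 and key=key] by simp

lemma kdiff_add:
  assumes "\<And>v. Modules.additive (X v)"
  shows "kdiff key X (u + w) = kdiff key X u + kdiff key X w"
  using kdiff_minus[OF assms, where u="u + w" and w=w and key=key] by (simp add: algebra_simps)

lemma kdiff_comp:
  assumes "Modules.additive f" "\<And>v m. f (X v m) = Y v (f m)"
  shows "kdiff key Y (\<lambda>T. f (u T)) G = f (kdiff key X u G)"
  by (simp add: kdiff_def additive.sum[OF assms(1)] additive_signed[OF assms(1)] assms(2))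

text \<open>Two distinct elements can be removed in either order. The terms agree up to sign, and
  the signs differ because inserting the smaller element raises the position of the larger by
  one.\<close>

lemma kdiff_kdiff:
  fixes key :: "'v::finite \<Rightarrow> nat"
  assumes inj: "inj key" and add: "\<And>v. Modules.additive (X v)" and com: "\<And>v w m. X v (X w m) = X w (X v m)"
  shows "kdiff key X (kdiff key X u) G = 0"
proof -
  define F where "F x y = signed (num_before key G x + num_before key (insert x G) y) (X x (X y (u (insert y (insert x G)))))" for x y
  have swap: "F y x = - F x y" if "x \<notin> G" "y \<notin> G" "key x < key y" for x y
    unfolding F_def using that com[of y x] by (simp add: num_before_insert insert_commute[of x y] add.commute)
  have "kdiff key X (kdiff key X u) G = (\<Sum>x\<in>-G. \<Sum>y\<in>-insert x G. F x y)"
    by (simp add: kdiff_def F_def additive.sum[OF add] additive_signed[OF add] signed_sum signed_signed)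
  also have "\<dots> = (\<Sum>(x,y)\<in>(SIGMA x:-G. -insert x G). F x y)"
    by (simp add: sum.Sigma)
  also have "(SIGMA x:-G. -insert x G) = {(x,y). x \<notin> G \<and> y \<notin> G \<and> key x < key y} \<union> {(x,y). x \<notin> G \<and> y \<notin> G \<and> key y < key x}"
    using inj by (auto dest: injD) (metis linorder_neqE_nat injD)
  also have "(\<Sum>(x,y)\<in>\<dots>. F x y) = (\<Sum>(x,y)\<in>{(x,y). x \<notin> G \<and> y \<notin> G \<and> key x < key y}. F x y)
      + (\<Sum>(x,y)\<in>{(x,y). x \<notin> G \<and> y \<notin> G \<and> key y < key x}. F x y)"
    by (intro sum.union_disjoint) auto
  also have "(\<Sum>(x,y)\<in>{(x,y). x \<notin> G \<and> y \<notin> G \<and> key y < key x}. F x y)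
      = (\<Sum>(x,y)\<in>{(x,y). x \<notin> G \<and> y \<notin> G \<and> key x < key y}. - F x y)"
    by (intro sum.reindex_bij_witness[of _ prod.swap prod.swap])
       (auto simp: swap)
  also have "\<dots> = - (\<Sum>(x,y)\<in>{(x,y). x \<notin> G \<and> y \<notin> G \<and> key x < key y}. F x y)"
    unfolding sum_negf[symmetric] by (rule sum.cong) auto
  finally show ?thesis by simp
qed

section \<open>Graded modules and the Koszul homology of their quotients\<close>

definition fun_scale :: "('k \<Rightarrow> 'm \<Rightarrow> 'm) \<Rightarrow> 'k \<Rightarrow> ('t \<Rightarrow> 'm) \<Rightarrow> 't \<Rightarrow> 'm" where
  "fun_scale s r u = (\<lambda>T. s r (u T))"

lemma fun_scale_apply [simp]: "fun_scale s r u T = s r (u T)"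
  by (simp add: fun_scale_def)

definition graded_ops :: "('k \<Rightarrow> 'm \<Rightarrow> 'm::ab_group_add) \<Rightarrow> ('v \<Rightarrow> 'm \<Rightarrow> 'm) \<Rightarrow> bool" where
  "graded_ops s X \<longleftrightarrow> (\<forall>r. Modules.additive (s r)) \<and> (\<forall>v. Modules.additive (X v)) \<and> (\<forall>v r m. X v (s r m) = s r (X v m)) \<and>
     (\<forall>v w m. X v (X w m) = X w (X v m))"

text \<open>
  The graded pieces may be unrelated subsets of one ambient type, so a complex of vector
  spaces, with \<open>X v\<close> the identity, is also an instance.
\<close>

definition graded_mod :: "('v \<Rightarrow> 'g::ab_group_add) \<Rightarrow> ('k \<Rightarrow> 'm \<Rightarrow> 'm::ab_group_add) \<Rightarrow> ('v \<Rightarrow> 'm \<Rightarrow> 'm) \<Rightarrow> ('g \<Rightarrow> 'm set) \<Rightarrow> bool" where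
  "graded_mod deg s X M \<longleftrightarrow> (\<forall>c. 0 \<in> M c) \<and> (\<forall>c. \<forall>x\<in>M c. \<forall>y\<in>M c. x - y \<in> M c) \<and>
     (\<forall>c r. \<forall>x\<in>M c. s r x \<in> M c) \<and> (\<forall>c v. \<forall>x\<in>M c. X v x \<in> M (c + deg v))"

lemma graded_modD:
  assumes "graded_mod deg s X M"
  shows "0 \<in> M c" "x \<in> M c \<Longrightarrow> y \<in> M c \<Longrightarrow> x - y \<in> M c" "x \<in> M c \<Longrightarrow> s r x \<in> M c"
    "x \<in> M c \<Longrightarrow> X v x \<in> M (c + deg v)" "x \<in> M c \<Longrightarrow> - x \<in> M c" "x \<in> M c \<Longrightarrow> y \<in> M c \<Longrightarrow> x + y \<in> M c"
    "x \<in> M c \<Longrightarrow> signed n x \<in> M c" "(\<And>i. i \<in> I \<Longrightarrow> f i \<in> M c) \<Longrightarrow> sum f I \<in> M c"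
proof -
  show *: "0 \<in> M c" "x \<in> M c \<Longrightarrow> y \<in> M c \<Longrightarrow> x - y \<in> M c" for x y
    using assms by (auto simp: graded_mod_def)
  show **: "- x \<in> M c" if "x \<in> M c" for x using *(2)[OF *(1) that] by simp
  show "x + y \<in> M c" if "x \<in> M c" "y \<in> M c" using *(2)[OF that(1) **[OF that(2)]] by simp
  show "signed n x \<in> M c" if "x \<in> M c" using that ** by (auto simp: signed_def)
  show "sum f I \<in> M c" if "\<And>i. i \<in> I \<Longrightarrow> f i \<in> M c" using that * by (intro sum_in)
qed (use assms in \<open>auto simp: graded_mod_def\<close>)

text \<open>The basis element e_T has degree \<open>sum deg T\<close>, so in total degree c its
  coefficient has degree \<open>c - sum deg T\<close>. Chains are total functions that vanish off
  the sets of size p, so all p share one type.\<close>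

definition kchains :: "('v::finite \<Rightarrow> 'g::ab_group_add) \<Rightarrow> ('g \<Rightarrow> 'm::zero set) \<Rightarrow> nat \<Rightarrow> 'g \<Rightarrow> ('v set \<Rightarrow> 'm) set" where
  "kchains deg M p c = {u. \<forall>T. u T \<in> M (c - sum deg T) \<and> (u T \<noteq> 0 \<longrightarrow> card T = p)}"

text \<open>
  Cycles and boundaries of the Koszul complex of the quotient \<open>M / N\<close> in degree \<open>c\<close>.
\<close>

definition kcycles where
  "kcycles key deg X M N p c = {u \<in> kchains deg M p c. \<forall>T. kdiff key X u T \<in> N (c - sum deg T)}"

definition kbounds where
  "kbounds key deg X M N p c =
     {u \<in> kchains deg M p c. \<exists>y\<in>kchains deg M (Suc p) c. \<forall>T. u T - kdiff key X y T \<in> N (c - sum deg T)}"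

abbreviation "khomology s key deg X M N p c n \<equiv> quot_dim (fun_scale s) (kcycles key deg X M N p c) (kbounds key deg X M N p c) n"

lemma kdiff_mem:
  assumes "graded_mod deg s X N" "\<And>T. w T \<in> N (c - sum deg T)"
  shows "kdiff key X w T \<in> N (c - sum deg T)"
  unfolding kdiff_def
proof (intro graded_modD[OF assms(1)])
  fix x assume "x \<in> - T"
  then have eq: "c - sum deg (insert x T) + deg x = c - sum deg T" by (simp add: algebra_simps)
  then show "X x (w (insert x T)) \<in> N (c - sum deg T)"
    using graded_modD(4)[OF assms(1) assms(2)[of "insert x T"], of x] by (simp only: eq)
qed

lemma kdiff_kchains:
  assumes "graded_mod deg s X N" "graded_ops s X" "w \<in> kchains deg N (Suc p) c"
  shows "kdiff key X w \<in> kchains deg N p c"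
proof -
  have "card T = p" if "kdiff key X w T \<noteq> 0" for T
  proof -
    obtain x where x: "x \<notin> T" "X x (w (insert x T)) \<noteq> 0"
      using \<open>kdiff key X w T \<noteq> 0\<close> unfolding kdiff_def
      by (metis (mono_tags, lifting) ComplD signed_simps(2) sum.neutral)
    then have "w (insert x T) \<noteq> 0"
      using assms(2) by (metis graded_ops_def additive.zero)
    then have "card (insert x T) = Suc p" using assms(3) by (auto simp: kchains_def)
    then show ?thesis using x(1) by simp
  qed
  moreover have "kdiff key X w T \<in> N (c - sum deg T)" for T
    by (rule kdiff_mem[OF assms(1)]) (use assms(3) in \<open>auto simp: kchains_def\<close>)
  ultimately show ?thesis by (auto simp: kchains_def)
qed

lemma kchains_graded_mod:
  assumes "graded_mod deg s X M" "graded_ops s X"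
  shows "0 \<in> kchains deg M p c" "u \<in> kchains deg M p c \<Longrightarrow> w \<in> kchains deg M p c \<Longrightarrow> u - w \<in> kchains deg M p c"
    "u \<in> kchains deg M p c \<Longrightarrow> fun_scale s r u \<in> kchains deg M p c"
proof -
  show "0 \<in> kchains deg M p c" using graded_modD(1)[OF assms(1)] by (auto simp: kchains_def)
  show "u - w \<in> kchains deg M p c" if "u \<in> kchains deg M p c" "w \<in> kchains deg M p c"
  proof -
    have "u T \<noteq> 0 \<or> w T \<noteq> 0" if "(u - w) T \<noteq> 0" for T using that by auto
    then show ?thesis using graded_modD(2)[OF assms(1)] that unfolding kchains_def mem_Collect_eq by fastforce
  qed
  have "s r 0 = 0" using assms(2) by (auto simp: graded_ops_def additive.zero)
  then have "u T \<noteq> 0" if "s r (u T) \<noteq> 0" for T using that by auto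
  then show "fun_scale s r u \<in> kchains deg M p c" if "u \<in> kchains deg M p c"
    using graded_modD(3)[OF assms(1)] that unfolding kchains_def fun_scale_def mem_Collect_eq by blast
qed

lemma graded_opsD:
  assumes "graded_ops s X" shows "Modules.additive (s r)" "Modules.additive (X v)" "X v (s r m) = s r (X v m)"
    "X v (X w m) = X w (X v m)"
  using assms by (auto simp: graded_ops_def)

lemma kdiff_fun_scale:
  assumes "graded_ops s X" shows "kdiff key X (fun_scale s r u) = fun_scale s r (kdiff key X u)"
  using kdiff_comp[OF graded_opsD(1)[OF assms], where X=X and Y=X and key=key and u=u] graded_opsD(3)[OF assms]
  by (auto simp: fun_scale_def fun_eq_iff)

text \<open>The map f is onto modulo N2 and pulls N2 back to N1, so it induces an isomorphism M1 /
  N1 to M2 / N2 that commutes with the variables; the two quotient complexes are therefore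
  isomorphic.\<close>

lemma khomology_cover:
  assumes o1: "graded_ops s1 X1" and o2: "graded_ops s2 X2"
    and M1: "graded_mod deg s1 X1 M1" and N1: "graded_mod deg s1 X1 N1"
    and M2: "graded_mod deg s2 X2 M2" and N2: "graded_mod deg s2 X2 N2" and sub: "\<And>c. N2 c \<subseteq> M2 c"
    and f: "Modules.additive f" "\<And>r m. f (s1 r m) = s2 r (f m)" "\<And>v m. f (X1 v m) = X2 v (f m)"
    and into: "\<And>c m. m \<in> M1 c \<Longrightarrow> f m \<in> M2 c"
    and onto: "\<And>c m. m \<in> M2 c \<Longrightarrow> \<exists>m'\<in>M1 c. m - f m' \<in> N2 c"
    and ker: "\<And>c m. m \<in> M1 c \<Longrightarrow> m \<in> N1 c \<longleftrightarrow> f m \<in> N2 c"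
  shows "khomology s1 key deg X1 M1 N1 p c n
     \<longleftrightarrow> khomology s2 key deg X2 M2 N2 p c n"
proof -
  have fscale: "kdiff key X2 (\<lambda>T. f (u T)) = (\<lambda>T. f (kdiff key X1 u T))" for u
    by (rule ext) (simp add: kdiff_def additive.sum[OF f(1)] additive_signed[OF f(1)] f(3))
  have X2a: "\<And>v. Modules.additive (X2 v)" using graded_opsD(2)[OF o2] .
  have f0: "f 0 = 0" by (rule additive.zero[OF f(1)])
  have fch: "(\<lambda>T. f (u T)) \<in> kchains deg M2 q c" if "u \<in> kchains deg M1 q c" for u q
  proof -
    have "u T \<noteq> 0" if "f (u T) \<noteq> 0" for T using that f0 by auto
    then show ?thesis using that into unfolding kchains_def by blast
  qed
  have lift: "\<exists>u\<in>kchains deg M1 q c. \<forall>T. w T - f (u T) \<in> N2 (c - sum deg T)"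
    if "w \<in> kchains deg M2 q c" for w q
  proof -
    have "\<forall>T. \<exists>m'\<in>M1 (c - sum deg T). w T - f m' \<in> N2 (c - sum deg T)"
      using that onto by (auto simp: kchains_def)
    then obtain u where u: "\<And>T. u T \<in> M1 (c - sum deg T)" "\<And>T. w T - f (u T) \<in> N2 (c - sum deg T)"
      by metis
    have "w T = 0" if "card T \<noteq> q" for T using \<open>w \<in> _\<close> that by (auto simp: kchains_def)
    then have "0 \<in> N2 c'" "card T \<noteq> q \<Longrightarrow> w T \<in> N2 c'" for T c'
      using graded_modD(1)[OF N2] by auto
    \<comment> \<open>The preimage chosen for a zero coefficient may be nonzero; cutting it off
      outside the sets of size q makes the family a chain.\<close>
    then show ?thesis
      by (intro bexI[of _ "\<lambda>T. if card T = q then u T else 0"])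
        (use u graded_modD(1)[OF M1] f0 in \<open>auto simp: kchains_def\<close>)
  qed
  \<comment> \<open>Congruence modulo N2 instead of equality, because f hits an element of M2 only
    up to N2.\<close>
  define R where "R u w \<longleftrightarrow> u \<in> kcycles key deg X1 M1 N1 p c \<and> w \<in> kcycles key deg X2 M2 N2 p c \<and>
      (\<forall>T. w T - f (u T) \<in> N2 (c - sum deg T))" for u w
  have congr: "kdiff key X2 w T - f (kdiff key X1 u T) \<in> N2 (c - sum deg T)"
    if "\<And>T. w T - f (u T) \<in> N2 (c - sum deg T)" for w u T
  proof -
    have "kdiff key X2 (w - (\<lambda>T. f (u T))) T \<in> N2 (c - sum deg T)"
      by (rule kdiff_mem[OF N2]) (use that in auto)
    then show ?thesis by (simp add: kdiff_minus[OF X2a] fscale)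
  qed
  show ?thesis
  proof (rule quot_dim_transfer[where R = R])
    show "R 0 0"
      by (auto simp: R_def kcycles_def kchains_graded_mod[OF M1 o1] kchains_graded_mod[OF M2 o2] f0 kdiff_zero graded_opsD(2)[OF o1] graded_opsD(2)[OF o2]
          graded_modD(1)[OF N1] graded_modD(1)[OF N2])
  next
    fix u w u' w' assume R: "R u w" "R u' w'"
    have "w T - w' T - f (u T - u' T) \<in> N2 (c - sum deg T)" for T
    proof -
      have "(w T - f (u T)) - (w' T - f (u' T)) \<in> N2 (c - sum deg T)"
        using R by (intro graded_modD(2)[OF N2, of "w T - f (u T)"]) (auto simp: R_def)
      then show ?thesis by (simp add: additive.diff[OF f(1)] algebra_simps)
    qed
    then show "R (u - u') (w - w')" using R
      by (auto simp: R_def kcycles_def kdiff_minus graded_opsD(2)[OF o1] graded_opsD(2)[OF o2]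
          intro!: kchains_graded_mod[OF M1 o1] kchains_graded_mod[OF M2 o2] graded_modD(2)[OF N1] graded_modD(2)[OF N2])
  next
    fix r u w assume R: "R u w"
    have "s2 r (w T) - f (s1 r (u T)) \<in> N2 (c - sum deg T)" for T
      using graded_modD(3)[OF N2, of "w T - f (u T)" _ r] R
      by (auto simp: R_def f additive.diff[OF graded_opsD(1)[OF o2]])
    then show "R (fun_scale s1 r u) (fun_scale s2 r w)" using R
      by (auto simp: R_def kcycles_def kdiff_fun_scale[OF o1] kdiff_fun_scale[OF o2]
          intro!: kchains_graded_mod(3)[OF M1 o1] kchains_graded_mod(3)[OF M2 o2] graded_modD(3)[OF N1] graded_modD(3)[OF N2])
  next
    fix u assume u: "u \<in> kcycles key deg X1 M1 N1 p c"
    have "f (kdiff key X1 u T) \<in> N2 (c - sum deg T)" for T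
    proof -
      have "kdiff key X1 u T \<in> M1 (c - sum deg T)"
        by (rule kdiff_mem[OF M1]) (use u in \<open>auto simp: kcycles_def kchains_def\<close>)
      then show ?thesis using u ker by (auto simp: kcycles_def)
    qed
    then have "R u (\<lambda>T. f (u T))"
      using u fch by (auto simp: R_def kcycles_def fscale graded_modD(1)[OF N2])
    then show "\<exists>w. R u w" by blast
  next
    fix w assume w: "w \<in> kcycles key deg X2 M2 N2 p c"
    then obtain u where u: "u \<in> kchains deg M1 p c" "\<And>T. w T - f (u T) \<in> N2 (c - sum deg T)"
      using lift[of w p] unfolding kcycles_def by blast
    have "kdiff key X1 u T \<in> N1 (c - sum deg T)" for T
    proof -
      have "kdiff key X1 u T \<in> M1 (c - sum deg T)"
        by (rule kdiff_mem[OF M1]) (use u in \<open>auto simp: kchains_def\<close>)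
      moreover have "f (kdiff key X1 u T) \<in> N2 (c - sum deg T)"
      proof -
        have "kdiff key X2 w T \<in> N2 (c - sum deg T)" using w by (simp add: kcycles_def)
        from graded_modD(2)[OF N2 this congr[OF u(2)]] show ?thesis by simp
      qed
      ultimately show ?thesis using ker by blast
    qed
    then have "R u w" using u w by (auto simp: R_def kcycles_def)
    then show "\<exists>u. R u w" by blast
  next
    fix u w assume R: "R u w"
    have d: "w T - f (u T) \<in> N2 (c - sum deg T)" for T using R by (auto simp: R_def)
    have uch: "u \<in> kchains deg M1 p c" and wch: "w \<in> kchains deg M2 p c" using R by (auto simp: R_def kcycles_def)
    have "u \<in> kbounds key deg X1 M1 N1 p c \<longleftrightarrow> w \<in> kbounds key deg X2 M2 N2 p c"
    proof
      assume "u \<in> kbounds key deg X1 M1 N1 p c"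
      then obtain y where y: "y \<in> kchains deg M1 (Suc p) c" "\<And>T. u T - kdiff key X1 y T \<in> N1 (c - sum deg T)"
        by (auto simp: kbounds_def)
      have "w T - f (kdiff key X1 y T) \<in> N2 (c - sum deg T)" for T
      proof -
        have "u T - kdiff key X1 y T \<in> M1 (c - sum deg T)"
          using uch kdiff_kchains[OF M1 o1 y(1)] by (intro graded_modD(2)[OF M1]) (auto simp: kchains_def)
        then have "f (u T - kdiff key X1 y T) \<in> N2 (c - sum deg T)" using y(2) ker by blast
        then have "(w T - f (u T)) + (f (u T) - f (kdiff key X1 y T)) \<in> N2 (c - sum deg T)"
          by (intro graded_modD(6)[OF N2 d]) (simp add: additive.diff[OF f(1)])
        then show ?thesis by simp
      qed
      then show "w \<in> kbounds key deg X2 M2 N2 p c"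
        using wch fch[OF y(1)] by (auto simp: kbounds_def fscale intro!: bexI[of _ "\<lambda>T. f (y T)"])
    next
      assume "w \<in> kbounds key deg X2 M2 N2 p c"
      then obtain y where y: "y \<in> kchains deg M2 (Suc p) c" "\<And>T. w T - kdiff key X2 y T \<in> N2 (c - sum deg T)"
        by (auto simp: kbounds_def)
      obtain y1 where y1: "y1 \<in> kchains deg M1 (Suc p) c" "\<And>T. y T - f (y1 T) \<in> N2 (c - sum deg T)"
        using lift[OF y(1)] by blast
      have "u T - kdiff key X1 y1 T \<in> N1 (c - sum deg T)" for T
      proof -
        have "(w T - kdiff key X2 y T) + (kdiff key X2 y T - f (kdiff key X1 y1 T)) - (w T - f (u T)) \<in> N2 (c - sum deg T)"
          by (rule graded_modD(2)[OF N2 graded_modD(6)[OF N2 y(2) congr[OF y1(2)]] d])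
        then have "f (u T - kdiff key X1 y1 T) \<in> N2 (c - sum deg T)"
          by (simp add: additive.diff[OF f(1)])
        moreover have "u T - kdiff key X1 y1 T \<in> M1 (c - sum deg T)"
          using uch kdiff_kchains[OF M1 o1 y1(1)] by (intro graded_modD(2)[OF M1]) (auto simp: kchains_def)
        ultimately show ?thesis using ker by blast
      qed
      then show "u \<in> kbounds key deg X1 M1 N1 p c" using uch y1(1) by (auto simp: kbounds_def)
    qed
    then show "u \<in> kcycles key deg X1 M1 N1 p c \<and> w \<in> kcycles key deg X2 M2 N2 p c \<and>
        (u \<in> kbounds key deg X1 M1 N1 p c \<longleftrightarrow> w \<in> kbounds key deg X2 M2 N2 p c)"
      using R by (auto simp: R_def)
  qed
qed


section \<open>Contraction of the Koszul complex by division by the least variable\<close>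

definition first_var :: "('v::finite \<Rightarrow> nat) \<Rightarrow> 'v set \<Rightarrow> 'v" where
  "first_var key T = arg_min_on key T"

lemma first_var:
  assumes "T \<noteq> {}" "inj key"
  shows "first_var key T \<in> T" "x \<in> T \<Longrightarrow> x \<noteq> first_var key T \<Longrightarrow> key (first_var key T) < key x"
proof -
  have fin: "finite T" by simp
  show *: "first_var key T \<in> T" unfolding first_var_def by (rule arg_min_if_finite(1)[OF fin assms(1)])
  show "key (first_var key T) < key x" if "x \<in> T" "x \<noteq> first_var key T"
    using arg_min_if_finite(2)[OF fin assms(1), of key] that assms(2)
    unfolding first_var_def[symmetric] by (metis injD linorder_neqE_nat)
qed

lemma first_var_eq:
  assumes "inj key" "x \<in> T" "\<And>y. y \<in> T \<Longrightarrow> key x \<le> key y"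
  shows "first_var key T = x"
  using first_var[of T key] assms by (metis empty_iff leD)

text \<open>
  The operator \<open>\<sigma> v\<close> is to be thought of as division by the variable \<open>v\<close> on the monomials that
  involve no smaller variable, and zero on the others.
\<close>

definition khomotopy where
  "khomotopy key \<sigma> u T = (if T = {} then 0 else \<sigma> (first_var key T) (u (T - {first_var key T})))"

lemma num_before_eq_0:
  assumes "\<And>y. y \<in> G \<Longrightarrow> \<not> key y < key x" shows "num_before key G (x :: 'a) = 0"
proof -
  have "card {y \<in> G. key y < key x} = card ({} :: 'a set)"
    by (rule arg_cong[where f = card]) (use assms in blast)
  then show ?thesis unfolding num_before_def card.empty .
qed

lemma num_before_empty [simp]: "num_before key {} x = 0"
  by (simp add: num_before_def)

text \<open>Let x be the least element of T. In the differential of the homotopy, the terms for y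
  below x add up to the sum that \<open>self\<close> subtracts, and those above x are supplied by
  applying \<sigma> x to the cycle condition at T - {x}. For empty T there is no x;
  \<open>tot\<close> takes over, and \<rho> (u {}) is the only obstruction.\<close>

lemma koszul_contraction:
  fixes key :: "'v::finite \<Rightarrow> nat"
  assumes inj: "inj key"
    and aX: "\<And>v. Modules.additive (X v)" and a\<sigma>: "\<And>v. Modules.additive (\<sigma> v)"
    and up: "\<And>x y m. key x < key y \<Longrightarrow> \<sigma> x (X y m) = X y (\<sigma> x m)"
    and down: "\<And>x y m. key y < key x \<Longrightarrow> \<sigma> x (X y m) = 0"
    and self: "\<And>x m. \<sigma> x (X x m) = m - (\<Sum>y | key y < key x. X y (\<sigma> y m))"
    and tot: "\<And>m. m = \<rho> m + (\<Sum>y\<in>UNIV. X y (\<sigma> y m))"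
    and cyc: "kdiff key X u = 0" and r0: "\<rho> (u {}) = 0"
  shows "kdiff key X (khomotopy key \<sigma> u) T = u T"
proof (cases "T = {}")
  case True
  have "first_var key {y} = y" for y using first_var[of "{y}" key] inj by simp
  then have "kdiff key X (khomotopy key \<sigma> u) {} = (\<Sum>y\<in>UNIV. X y (\<sigma> y (u {})))"
    by (simp add: kdiff_def khomotopy_def num_before_eq_0)
  then show ?thesis using tot[of "u {}"] r0 True by simp
next
  case False
  define x where "x = first_var key T"
  define T' where "T' = T - {x}"
  have xT: "x \<in> T" and min: "\<And>y. y \<in> T \<Longrightarrow> y \<noteq> x \<Longrightarrow> key x < key y"
    using first_var[OF False inj] by (auto simp: x_def)
  have T: "T = insert x T'" "x \<notin> T'" using xT by (auto simp: T'_def)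
  have part: "- T = {y. key y < key x} \<union> {y. y \<notin> T \<and> key x < key y}"
  proof (intro set_eqI iffI)
    fix y assume "y \<in> - T"
    then have "key y \<noteq> key x" using xT inj by (auto dest: injD)
    then show "y \<in> {y. key y < key x} \<union> {y. y \<notin> T \<and> key x < key y}" using \<open>y \<in> - T\<close> by auto
  qed (use min xT in fastforce)
  \<comment> \<open>Here y becomes the least element of the enlarged set, with nothing in front of
    it, so no sign appears.\<close>
  have lo: "signed (num_before key T y) (X y (khomotopy key \<sigma> u (insert y T))) = X y (\<sigma> y (u T))" if "key y < key x" for y
  proof -
    have "first_var key (insert y T) = y"
      by (rule first_var_eq[OF inj]) (use that min in \<open>auto simp: order.order_iff_strict intro: less_trans\<close>)
    moreover have "y \<notin> T" using that min by (metis less_asym less_irrefl)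
    moreover have "num_before key T y = 0" by (rule num_before_eq_0) (use that min in \<open>metis less_asym less_irrefl less_trans\<close>)
    ultimately show ?thesis by (simp add: khomotopy_def)
  qed
  \<comment> \<open>Here x stays the least element; it counts once in the position of y in T but not
    in T', which produces the minus sign.\<close>
  have hi: "signed (num_before key T y) (X y (khomotopy key \<sigma> u (insert y T))) = - signed (num_before key T' y) (\<sigma> x (X y (u (insert y T'))))"
    if "y \<notin> T" "key x < key y" for y
  proof -
    have "first_var key (insert y T) = x"
      by (rule first_var_eq[OF inj]) (use that min xT in \<open>auto simp: order.order_iff_strict\<close>)
    moreover have "insert y T - {x} = insert y T'" using that xT by (auto simp: T'_def)
    moreover have "num_before key T y = Suc (num_before key T' y)" using that T by (simp add: num_before_insert)
    ultimately show ?thesis by (simp add: khomotopy_def up[OF that(2)])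
  qed
  have T'eq: "- T' = insert x (- T)" using T by auto
  \<comment> \<open>The cycle condition at T' after \<sigma> x: terms for y below x die by
    \<open>down\<close>, the term for x is rewritten by \<open>self\<close>, and those above x
    remain.\<close>
  have "0 = \<sigma> x (kdiff key X u T')" using cyc additive.zero[OF a\<sigma>] by (metis zero_fun_apply)
  also have "\<dots> = (\<Sum>y\<in>-T'. signed (num_before key T' y) (\<sigma> x (X y (u (insert y T')))))"
    by (simp add: kdiff_def additive.sum[OF a\<sigma>] additive_signed[OF a\<sigma>])
  also have "\<dots> = signed (num_before key T' x) (\<sigma> x (X x (u T)))
      + (\<Sum>y\<in>-T. signed (num_before key T' y) (\<sigma> x (X y (u (insert y T')))))"
    unfolding T'eq using xT T by (subst sum.insert) auto
  also have "num_before key T' x = 0" by (rule num_before_eq_0) (use min in \<open>auto simp: T'_def dest: less_asym\<close>)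
  also have "(\<Sum>y\<in>-T. signed (num_before key T' y) (\<sigma> x (X y (u (insert y T')))))
     = (\<Sum>y | y \<notin> T \<and> key x < key y. signed (num_before key T' y) (\<sigma> x (X y (u (insert y T')))))"
    unfolding part by (rule sum.mono_neutral_right) (auto simp: down)
  finally have *: "u T = (\<Sum>y | key y < key x. X y (\<sigma> y (u T)))
      - (\<Sum>y | y \<notin> T \<and> key x < key y. signed (num_before key T' y) (\<sigma> x (X y (u (insert y T')))))"
    by (simp add: self algebra_simps)
  have "kdiff key X (khomotopy key \<sigma> u) T = (\<Sum>y\<in>-T. signed (num_before key T y) (X y (khomotopy key \<sigma> u (insert y T))))"
    by (simp add: kdiff_def)
  also have "\<dots> = (\<Sum>y | key y < key x. signed (num_before key T y) (X y (khomotopy key \<sigma> u (insert y T))))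
     + (\<Sum>y | y \<notin> T \<and> key x < key y. signed (num_before key T y) (X y (khomotopy key \<sigma> u (insert y T))))"
    unfolding part by (rule sum.union_disjoint) auto
  also have "\<dots> = u T" by (simp add: lo hi sum_negf *[symmetric])
  finally show ?thesis .
qed

lemma khomotopy_kchains:
  fixes key :: "'v::finite \<Rightarrow> nat"
  assumes inj: "inj key" and F: "graded_mod deg s X F" and a\<sigma>: "\<And>v. Modules.additive (\<sigma> v)"
    and \<sigma>F: "\<And>v c m. m \<in> F c \<Longrightarrow> \<sigma> v m \<in> F (c - deg v)"
    and u: "u \<in> kchains deg F p c"
  shows "khomotopy key \<sigma> u \<in> kchains deg F (Suc p) c"
proof -
  have "khomotopy key \<sigma> u T \<in> F (c - sum deg T) \<and> (khomotopy key \<sigma> u T \<noteq> 0 \<longrightarrow> card T = Suc p)" for T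
  proof (cases "T = {}")
    case True then show ?thesis using graded_modD(1)[OF F] by (simp add: khomotopy_def)
  next
    case False
    define x where "x = first_var key T"
    define T' where "T' = T - {x}"
    have T: "T = insert x T'" "x \<notin> T'" using first_var(1)[OF False inj] by (auto simp: T'_def x_def)
    have h: "khomotopy key \<sigma> u T = \<sigma> x (u T')" using False by (simp add: khomotopy_def x_def T'_def)
    have deg: "c - sum deg T = c - sum deg T' - deg x" using T by (simp add: algebra_simps)
    have "u T' \<in> F (c - sum deg T')" "u T' \<noteq> 0 \<longrightarrow> card T' = p" using u by (auto simp: kchains_def)
    then show ?thesis unfolding h deg using \<sigma>F additive.zero[OF a\<sigma>, of x] T by auto
  qed
  then show ?thesis by (auto simp: kchains_def)
qed

text \<open>The laws of division by a least variable. \<open>self\<close> says that dividing x m by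
  x retains the monomials of m without smaller variables; \<open>tot\<close> says that each monomial
  is constant, kept by \<rho>, or has exactly one least variable.\<close>

locale koszul_contraction =
  fixes key :: "'v::finite \<Rightarrow> nat" and deg :: "'v \<Rightarrow> 'g::ab_group_add"
    and s :: "'k::field \<Rightarrow> 'm::ab_group_add \<Rightarrow> 'm" and X \<sigma> :: "'v \<Rightarrow> 'm \<Rightarrow> 'm" and \<rho> :: "'m \<Rightarrow> 'm"
  assumes inj: "inj key" and ops: "graded_ops s X"
    and additive_\<sigma>: "\<And>v. Modules.additive (\<sigma> v)"
    and up: "\<And>x y m. key x < key y \<Longrightarrow> \<sigma> x (X y m) = X y (\<sigma> x m)"
    and down: "\<And>x y m. key y < key x \<Longrightarrow> \<sigma> x (X y m) = 0"
    and self: "\<And>x m. \<sigma> x (X x m) = m - (\<Sum>y | key y < key x. X y (\<sigma> y m))"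
    and tot: "\<And>m. m = \<rho> m + (\<Sum>y\<in>UNIV. X y (\<sigma> y m))"
begin

lemma exact:
  assumes F: "graded_mod deg s X F" and \<sigma>F: "\<And>v c m. m \<in> F c \<Longrightarrow> \<sigma> v m \<in> F (c - deg v)"
    and u: "u \<in> kchains deg F q c" "kdiff key X u = 0" "\<rho> (u {}) = 0"
  shows "\<exists>y\<in>kchains deg F (Suc q) c. kdiff key X y = u"
  using koszul_contraction[OF inj graded_opsD(2)[OF ops] additive_\<sigma> up down self tot u(2,3)]
    khomotopy_kchains[OF inj F additive_\<sigma> \<sigma>F u(1)] by blast

text \<open>The connecting homomorphism of 0 -> M -> F -> F / M -> 0 is an isomorphism because the
  Koszul complex of F is exact in positive degrees. In degree 0 it is still onto, since \<rho>
  vanishes on M and so every element of M bounds in F; for syzygies this is minimality.\<close>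

lemma shift:
  assumes F: "graded_mod deg s X F" and M: "graded_mod deg s X M" and sub: "\<And>c. M c \<subseteq> F c"
    and \<sigma>F: "\<And>v c m. m \<in> F c \<Longrightarrow> \<sigma> v m \<in> F (c - deg v)"
    and \<rho>M: "\<And>c m. m \<in> M c \<Longrightarrow> \<rho> m = 0"
  shows "khomology s key deg X F M (Suc p) c n
     \<longleftrightarrow> khomology s key deg X M (\<lambda>_. {0}) p c n"
proof -
  have aX: "\<And>v. Modules.additive (X v)" using graded_opsD(2)[OF ops] .
  have subch: "kchains deg M q c \<subseteq> kchains deg F q c" for q using sub by (auto simp: kchains_def)
  have \<rho>0: "\<rho> 0 = 0"
    using tot[of 0] additive.zero[OF additive_\<sigma>] additive.zero[OF aX] by simp
  have exact: "\<exists>y\<in>kchains deg F (Suc q) c. kdiff key X y = u"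
    if "u \<in> kchains deg F q c" "kdiff key X u = 0" "\<rho> (u {}) = 0" for q u
    using exact[OF F \<sigma>F that] .
  have exact_Suc: "\<exists>y\<in>kchains deg F (Suc (Suc q)) c. kdiff key X y = u"
    if "u \<in> kchains deg F (Suc q) c" "kdiff key X u = 0" for q u
  proof (rule exact[OF that])
    have "u {} = 0" using that(1) by (auto simp: kchains_def)
    then show "\<rho> (u {}) = 0" using \<rho>0 by simp
  qed
  have Zc: "kcycles key deg X M (\<lambda>_. {0}) p c = {w \<in> kchains deg M p c. kdiff key X w = 0}"
    by (auto simp: kcycles_def fun_eq_iff)
  have Bc: "kbounds key deg X M (\<lambda>_. {0}) p c = {w \<in> kchains deg M p c. \<exists>y\<in>kchains deg M (Suc p) c. w = kdiff key X y}"
    by (auto simp: kbounds_def fun_eq_iff)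
  define R where "R u w \<longleftrightarrow> u \<in> kcycles key deg X F M (Suc p) c \<and> w = kdiff key X u" for u w
  have wch: "kdiff key X u \<in> kchains deg M p c" if "u \<in> kcycles key deg X F M (Suc p) c" for u
    using that kdiff_kchains[OF F ops, of u] by (auto simp: kcycles_def kchains_def)
  have dd: "kdiff key X (kdiff key X u) = 0" for u
    using kdiff_kdiff[OF inj aX graded_opsD(4)[OF ops]] by (auto simp: fun_eq_iff)
  show ?thesis
  proof (rule quot_dim_transfer[where R = R])
    show "R 0 0"
      by (auto simp: R_def kcycles_def kdiff_zero[OF aX] kchains_graded_mod[OF F ops] graded_modD(1)[OF M])
  next
    fix u w u' w' assume "R u w" "R u' w'"
    then show "R (u - u') (w - w')"
      by (auto simp: R_def kcycles_def kdiff_minus[OF aX] intro!: kchains_graded_mod[OF F ops] graded_modD(2)[OF M])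
  next
    fix r u w assume "R u w"
    then show "R (fun_scale s r u) (fun_scale s r w)"
      by (auto simp: R_def kcycles_def kdiff_fun_scale[OF ops] intro!: kchains_graded_mod[OF F ops] graded_modD(3)[OF M])
  next
    fix u assume "u \<in> kcycles key deg X F M (Suc p) c"
    then show "\<exists>w. R u w" by (auto simp: R_def)
  next
    fix w assume w: "w \<in> kcycles key deg X M (\<lambda>_. {0}) p c"
    \<comment> \<open>For positive p this component is zero by cardinality; for p = 0 the assumption
      that \<rho> vanishes on M makes w bound in F.\<close>
    then have "w {} \<in> M (c - sum deg {})" unfolding Zc kchains_def by blast
    then have "\<rho> (w {}) = 0" by (rule \<rho>M)
    moreover have "w \<in> kchains deg F p c" "kdiff key X w = 0"
      using w subch unfolding Zc by blast+
    ultimately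
    obtain u where "u \<in> kchains deg F (Suc p) c" "kdiff key X u = w" using exact by blast
    then have "R u w" using w unfolding Zc by (auto simp: R_def kcycles_def kchains_def)
    then show "\<exists>u. R u w" by blast
  next
    fix u w assume R: "R u w"
    then have w: "w = kdiff key X u" and u: "u \<in> kcycles key deg X F M (Suc p) c" by (auto simp: R_def)
    have uch: "u \<in> kchains deg F (Suc p) c" using u by (auto simp: kcycles_def)
    have "u \<in> kbounds key deg X F M (Suc p) c \<longleftrightarrow> w \<in> kbounds key deg X M (\<lambda>_. {0}) p c"
    proof
      assume "u \<in> kbounds key deg X F M (Suc p) c"
      then obtain y where y: "y \<in> kchains deg F (Suc (Suc p)) c" "\<And>T. u T - kdiff key X y T \<in> M (c - sum deg T)"
        by (auto simp: kbounds_def)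
      have "u - kdiff key X y \<in> kchains deg F (Suc p) c"
        by (rule kchains_graded_mod(2)[OF F ops uch kdiff_kchains[OF F ops y(1)]])
      then have 1: "u - kdiff key X y \<in> kchains deg M (Suc p) c" using y(2) by (auto simp: kchains_def)
      have 2: "w = kdiff key X (u - kdiff key X y)" by (simp add: w kdiff_minus[OF aX] dd)
      have "w \<in> kchains deg M p c" using wch[OF u] by (simp add: w)
      then show "w \<in> kbounds key deg X M (\<lambda>_. {0}) p c"
        unfolding Bc using 1 2 by (intro CollectI conjI bexI[where x = "u - kdiff key X y"])
    next
      assume "w \<in> kbounds key deg X M (\<lambda>_. {0}) p c"
      then obtain y where y: "y \<in> kchains deg M (Suc p) c" "w = kdiff key X y" unfolding Bc by blast
      have "u - y \<in> kchains deg F (Suc p) c" using y subch uch by (intro kchains_graded_mod(2)[OF F ops]) auto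
      moreover have "kdiff key X (u - y) = 0" using w y by (simp add: kdiff_minus[OF aX])
      ultimately obtain z where z: "z \<in> kchains deg F (Suc (Suc p)) c" "kdiff key X z = u - y"
        using exact_Suc by blast
      have "u T - kdiff key X z T \<in> M (c - sum deg T)" for T
        using y(1) by (simp add: z kchains_def)
      then show "u \<in> kbounds key deg X F M (Suc p) c" using uch z(1) by (auto simp: kbounds_def)
    qed
    then show "u \<in> kcycles key deg X F M (Suc p) c \<and> w \<in> kcycles key deg X M (\<lambda>_. {0}) p c \<and>
      (u \<in> kbounds key deg X F M (Suc p) c \<longleftrightarrow> w \<in> kbounds key deg X M (\<lambda>_. {0}) p c)"
      using u wch[OF u] dd unfolding Zc w by auto
  qed
qed

text \<open>In homological degree 0 the quotient is F c modulo M c and the multiples of variables.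
  By exactness of the complex of F, an element killed by \<rho> is a sum of such multiples, while
  \<rho> kills both M and the multiples. Hence \<rho> identifies the homology with \<rho> (F c),
  which has basis g.\<close>

lemma khomology_0:
  fixes g :: "nat \<Rightarrow> 'm"
  assumes F: "graded_mod deg s X F" and M: "graded_mod deg s X M"
    and \<sigma>F: "\<And>v c m. m \<in> F c \<Longrightarrow> \<sigma> v m \<in> F (c - deg v)"
    and \<rho>M: "\<And>c m. m \<in> M c \<Longrightarrow> \<rho> m = 0"
    and \<rho>: "Modules.additive \<rho>" "\<And>v m. \<rho> (X v m) = 0"
    and g: "\<And>j. j < n \<Longrightarrow> g j \<in> F c"
      "\<And>m. m \<in> F c \<Longrightarrow> \<exists>l. \<rho> m = (\<Sum>j<n. s (l j) (g j))"
      "\<And>l. \<rho> (\<Sum>j<n. s (l j) (g j)) = (\<Sum>j<n. s (l j) (g j))"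
      "\<And>l j. (\<Sum>j<n. s (l j) (g j)) = 0 \<Longrightarrow> j < n \<Longrightarrow> l j = 0"
  shows "khomology s key deg X F M 0 c n"
proof -
  have aX: "\<And>v. Modules.additive (X v)" using graded_opsD(2)[OF ops] .
  have sz: "s r 0 = 0" for r using additive.zero[OF graded_opsD(1)[OF ops]] .
  define G where "G j T = (if T = {} then g j else 0)" for j :: nat and T :: "'v set"
  have GT: "(\<Sum>j<n. fun_scale s (l j) (G j)) T = (if T = {} then \<Sum>j<n. s (l j) (g j) else 0)" for l T
  proof -
    have "(\<Sum>j<k. fun_scale s (l j) (G j)) T = (\<Sum>j<k. fun_scale s (l j) (G j) T)" for k
      by (induction k) auto
    then show ?thesis by (auto simp: G_def sz)
  qed
  have ch0: "u T = 0" if "u \<in> kchains deg F 0 c" "T \<noteq> {}" for u T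
    using that by (auto simp: kchains_def)
  have chI: "u \<in> kchains deg F 0 c" if "u {} \<in> F c" "\<And>T. T \<noteq> {} \<Longrightarrow> u T = 0" for u
  proof -
    have "u T \<in> F (c - sum deg T) \<and> (u T \<noteq> 0 \<longrightarrow> card T = 0)" for T
      using that graded_modD(1)[OF F] by (cases "T = {}") auto
    then show ?thesis by (simp add: kchains_def)
  qed
  have d0: "kdiff key X u = 0" if "u \<in> kchains deg F 0 c" for u
    unfolding kdiff_def using ch0[OF that] by (auto simp: fun_eq_iff additive.zero[OF aX])
  have Gch: "(\<Sum>j<n. fun_scale s (l j) (G j)) \<in> kchains deg F 0 c" for l
    by (rule chI) (auto simp: GT intro!: graded_modD(8)[OF F] graded_modD(3)[OF F] g(1))
  show ?thesis unfolding quot_dim_def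
  proof (intro exI[of _ G] conjI allI impI ballI)
    fix j assume "j < n"
    then have "G j \<in> kchains deg F 0 c" by (intro chI) (auto simp: G_def g(1))
    then show "G j \<in> kcycles key deg X F M 0 c" using d0 graded_modD(1)[OF M] by (auto simp: kcycles_def)
  next
    fix z assume "z \<in> kcycles key deg X F M 0 c"
    then have z: "z \<in> kchains deg F 0 c" by (simp add: kcycles_def)
    then have "z {} \<in> F (c - sum deg {})" unfolding kchains_def by blast
    then obtain l where l: "\<rho> (z {}) = (\<Sum>j<n. s (l j) (g j))" using g(2) by auto
    let ?w = "z - (\<Sum>j<n. fun_scale s (l j) (G j))"
    have w: "?w \<in> kchains deg F 0 c" by (rule kchains_graded_mod(2)[OF F ops z Gch])
    have "\<rho> (?w {}) = 0" by (simp add: GT additive.diff[OF \<rho>(1)] l g(3))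
    then obtain y where y: "y \<in> kchains deg F (Suc 0) c" "kdiff key X y = ?w"
      using exact[OF F \<sigma>F w d0[OF w]] by blast
    have "?w T - kdiff key X y T \<in> M (c - sum deg T)" for T
      by (simp only: y(2) diff_self graded_modD(1)[OF M])
    then have "?w \<in> kbounds key deg X F M 0 c" using w y(1) unfolding kbounds_def by blast
    then show "\<exists>l. z - (\<Sum>j<n. fun_scale s (l j) (G j)) \<in> kbounds key deg X F M 0 c" by blast
  next
    fix l j assume "(\<Sum>j<n. fun_scale s (l j) (G j)) \<in> kbounds key deg X F M 0 c" and j: "j < n"
    then obtain y where y: "\<And>T. (\<Sum>j<n. fun_scale s (l j) (G j)) T - kdiff key X y T \<in> M (c - sum deg T)"
      unfolding kbounds_def by blast
    have "\<rho> (kdiff key X y {}) = 0"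
      by (simp add: kdiff_def additive.sum[OF \<rho>(1)] \<rho>(2))
    then have "(\<Sum>j<n. s (l j) (g j)) = 0"
      using \<rho>M[OF y[of "{}"]] by (simp add: GT additive.diff[OF \<rho>(1)] g(3))
    then show "l j = 0" using g(4) j by blast
  qed
qed

text \<open>Degree-zero Koszul homology of M is M modulo the multiples of variables, so a basis of
  it is a system of minimal generators in degree c. The chain notation is unpacked here for the
  construction of resolutions.\<close>

lemma khomology_0_generators:
  assumes M: "graded_mod deg s X M"
    and q: "khomology s key deg X M (\<lambda>_. {0}) 0 c n"
  obtains g :: "nat \<Rightarrow> 'm" where "\<And>j. j < n \<Longrightarrow> g j \<in> M c"
    "\<And>z. z \<in> M c \<Longrightarrow> \<exists>l y. (\<forall>v. y v \<in> M (c - deg v)) \<and> z = (\<Sum>j<n. s (l j) (g j)) + (\<Sum>v\<in>UNIV. X v (y v))"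
    "\<And>l y j. (\<And>v. y v \<in> M (c - deg v)) \<Longrightarrow> (\<Sum>j<n. s (l j) (g j)) = (\<Sum>v\<in>UNIV. X v (y v)) \<Longrightarrow> j < n \<Longrightarrow> l j = 0"
proof -
  have aX: "\<And>v. Modules.additive (X v)" using graded_opsD(2)[OF ops] .
  have sz: "s r 0 = 0" for r using additive.zero[OF graded_opsD(1)[OF ops]] .
  obtain G where G: "\<And>j. j < n \<Longrightarrow> G j \<in> kcycles key deg X M (\<lambda>_. {0}) 0 c"
      "\<And>z. z \<in> kcycles key deg X M (\<lambda>_. {0}) 0 c \<Longrightarrow> \<exists>l. z - (\<Sum>j<n. fun_scale s (l j) (G j)) \<in> kbounds key deg X M (\<lambda>_. {0}) 0 c"
      "\<And>l j. (\<Sum>j<n. fun_scale s (l j) (G j)) \<in> kbounds key deg X M (\<lambda>_. {0}) 0 c \<Longrightarrow> j < n \<Longrightarrow> l j = 0"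
    using q unfolding quot_dim_def by blast
  define g where "g j = G j {}" for j
  have GT: "(\<Sum>j<n. fun_scale s (l j) (G j)) T = (\<Sum>j<n. s (l j) (G j T))" for l T
  proof -
    have "(\<Sum>j<k. fun_scale s (l j) (G j)) T = (\<Sum>j<k. s (l j) (G j T))" for k
      by (induction k) auto
    then show ?thesis .
  qed
  have ch0: "u T = 0" if "u \<in> kchains deg M 0 c" "T \<noteq> {}" for u T
    using that by (auto simp: kchains_def)
  have chI: "u \<in> kchains deg M 0 c" if "u {} \<in> M c" "\<And>T. T \<noteq> {} \<Longrightarrow> u T = 0" for u
  proof -
    have "u T \<in> M (c - sum deg T) \<and> (u T \<noteq> 0 \<longrightarrow> card T = 0)" for T
      using that graded_modD(1)[OF M] by (cases "T = {}") auto
    then show ?thesis by (simp add: kchains_def)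
  qed
  have d0: "kdiff key X u = 0" if "u \<in> kchains deg M 0 c" for u
    unfolding kdiff_def using ch0[OF that] by (auto simp: fun_eq_iff additive.zero[OF aX])
  have kd: "kdiff key X y {} = (\<Sum>v\<in>UNIV. X v (y {v}))" for y
    by (simp add: kdiff_def)
  have Gch: "G j \<in> kchains deg M 0 c" if "j < n" for j using G(1)[OF that] by (simp add: kcycles_def)
  have gM: "g j \<in> M c" if "j < n" for j
  proof -
    have "G j {} \<in> M (c - sum deg {})" using Gch[OF that] unfolding kchains_def by blast
    then show ?thesis by (simp add: g_def)
  qed
  show ?thesis
  proof (rule that[OF gM])
    fix z assume z: "z \<in> M c"
    define w where "w T = (if T = {} then z else 0)" for T :: "'v set"
    have "w \<in> kchains deg M 0 c" by (rule chI) (auto simp: w_def z)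
    then have "w \<in> kcycles key deg X M (\<lambda>_. {0}) 0 c" using d0 by (simp add: kcycles_def)
    then obtain l where "w - (\<Sum>j<n. fun_scale s (l j) (G j)) \<in> kbounds key deg X M (\<lambda>_. {0}) 0 c" using G(2) by blast
    then obtain y where y: "y \<in> kchains deg M (Suc 0) c"
      "\<And>T. (w - (\<Sum>j<n. fun_scale s (l j) (G j))) T - kdiff key X y T \<in> {0}" unfolding kbounds_def by blast
    have "y {v} \<in> M (c - sum deg {v})" for v using y(1) unfolding kchains_def by blast
    moreover have "z = (\<Sum>j<n. s (l j) (g j)) + (\<Sum>v\<in>UNIV. X v (y {v}))"
      using y(2)[of "{}"] by (simp add: GT kd w_def g_def algebra_simps)
    ultimately show "\<exists>l y. (\<forall>v. y v \<in> M (c - deg v)) \<and> z = (\<Sum>j<n. s (l j) (g j)) + (\<Sum>v\<in>UNIV. X v (y v))"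
      by (intro exI[of _ l] exI[of _ "\<lambda>v. y {v}"]) auto
  next
    fix l y j assume y: "\<And>v. y v \<in> M (c - deg v)" "(\<Sum>j<n. s (l j) (g j)) = (\<Sum>v\<in>UNIV. X v (y v))" and j: "j < n"
    \<comment> \<open>A family indexed by the variables is a Koszul 1-chain once it is placed on the
      singletons.\<close>
    define Y where "Y T = (if card T = 1 then y (THE v. T = {v}) else 0)" for T :: "'v set"
    have Y1: "Y {v} = y v" for v by (simp add: Y_def)
    have YM: "Y T \<in> M (c - sum deg T)" for T
    proof (cases "card T = 1")
      case True
      then obtain v where "T = {v}" by (rule card_1_singletonE)
      then show ?thesis using y(1)[of v] Y1 by simp
    qed (simp add: Y_def graded_modD(1)[OF M])
    then have Y: "Y \<in> kchains deg M (Suc 0) c" by (auto simp: kchains_def Y_def)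
    have dY: "kdiff key X Y \<in> kchains deg M 0 c" by (rule kdiff_kchains[OF M ops Y])
    have S: "(\<Sum>j<n. fun_scale s (l j) (G j)) \<in> kchains deg M 0 c"
    proof (rule chI)
      show "(\<Sum>j<n. fun_scale s (l j) (G j)) {} \<in> M c" unfolding GT
        using gM by (intro graded_modD(8)[OF M] graded_modD(3)[OF M]) (auto simp: g_def)
    qed (use ch0[OF Gch] in \<open>auto simp: GT sz\<close>)
    have "(\<Sum>j<n. fun_scale s (l j) (G j)) T - kdiff key X Y T = 0" for T
    proof (cases "T = {}")
      case True then show ?thesis using y(2) by (simp add: GT kd Y1 g_def)
    next
      case False then show ?thesis using ch0[OF S False] ch0[OF dY False] by simp
    qed
    then have "(\<Sum>j<n. fun_scale s (l j) (G j)) \<in> kbounds key deg X M (\<lambda>_. {0}) 0 c"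
      using S Y unfolding kbounds_def by blast
    then show "l j = 0" using G(3) j by blast
  qed
qed

end

section \<open>Orthogonal complements in function spaces\<close>

interpretation fvs: vector_space "fun_scale ((*) :: 'k::field \<Rightarrow> 'k \<Rightarrow> 'k) :: 'k \<Rightarrow> ('t \<Rightarrow> 'k) \<Rightarrow> 't \<Rightarrow> 'k"
  by unfold_locales (auto simp: fun_eq_iff algebra_simps)

definition supp_on :: "'t set \<Rightarrow> ('t \<Rightarrow> 'k::zero) set" where
  "supp_on E = {f. \<forall>T. f T \<noteq> 0 \<longrightarrow> T \<in> E}"

definition delta :: "'t \<Rightarrow> 't \<Rightarrow> 'k::zero_neq_one" where
  "delta T = (\<lambda>S. if S = T then 1 else 0)"

definition pairing :: "('t::finite \<Rightarrow> 'k::field) \<Rightarrow> ('t \<Rightarrow> 'k) \<Rightarrow> 'k" where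
  "pairing f g = (\<Sum>T\<in>UNIV. f T * g T)"

lemma pairing_delta [simp]: "pairing f (delta T) = f T" "pairing (delta T) f = f T"
  by (simp_all add: pairing_def delta_def if_distrib[of "\<lambda>x. _ * x"] if_distrib[of "\<lambda>x. x * _"] cong: if_cong)

lemma pairing_add: "pairing f (g + h) = pairing f g + pairing f h"
  and pairing_zero: "pairing f 0 = 0"
  and pairing_fun_scale: "pairing f (fun_scale (*) r g) = r * pairing f g"
  and pairing_commute: "pairing f g = pairing g f"
  by (simp_all add: pairing_def algebra_simps sum.distrib sum_distrib_left)

lemma pairing_sum: "pairing f (\<Sum>i\<in>I. g i) = (\<Sum>i\<in>I. pairing f (g i))"
proof (induction I rule: infinite_finite_induct)
  case (insert i I)
  then show ?case unfolding sum.insert[OF insert(1,2)] pairing_add by simp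
qed (simp_all only: sum.infinite sum.empty pairing_zero simp_thms)

definition perp :: "'t::finite set \<Rightarrow> ('t \<Rightarrow> 'k::field) set \<Rightarrow> ('t \<Rightarrow> 'k) set" where
  "perp E U = {f \<in> supp_on E. \<forall>u\<in>U. pairing f u = 0}"

lemma sum_fun_apply: "(\<Sum>i\<in>I. g i) x = (\<Sum>i\<in>I. g i x)" for g :: "'i \<Rightarrow> 'a \<Rightarrow> 'b::comm_monoid_add"
  by (induction I rule: infinite_finite_induct) auto

lemma supp_on_expand:
  fixes f :: "'t::finite \<Rightarrow> 'k::field"
  assumes "f \<in> supp_on E" shows "f = (\<Sum>T\<in>E. fun_scale (*) (f T) (delta T))"
proof
  fix S
  have "(\<Sum>T\<in>E. fun_scale (*) (f T) (delta T)) S = (\<Sum>T\<in>E. if T = S then f T else 0)"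
    unfolding sum_fun_apply by (intro sum.cong) (auto simp: delta_def)
  also have "\<dots> = f S" using assms by (auto simp: supp_on_def)
  finally show "f S = (\<Sum>T\<in>E. fun_scale (*) (f T) (delta T)) S" by simp
qed

lemma subspace_supp_on: "fvs.subspace (supp_on E :: ('t \<Rightarrow> 'k::field) set)"
  unfolding fvs.subspace_def supp_on_def by (auto, metis add.right_neutral)

lemma supp_on_span:
  fixes E :: "'t::finite set"
  shows "(supp_on E :: ('t \<Rightarrow> 'k::field) set) = fvs.span (delta ` E)"
proof
  show "supp_on E \<subseteq> fvs.span (delta ` E :: ('t \<Rightarrow> 'k) set)"
  proof
    fix f :: "'t \<Rightarrow> 'k" assume "f \<in> supp_on E"
    then have f: "f = (\<Sum>T\<in>E. fun_scale (*) (f T) (delta T))" by (rule supp_on_expand)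
    show "f \<in> fvs.span (delta ` E)"
      by (subst f) (intro fvs.span_sum fvs.span_scale fvs.span_base imageI)
  qed
  show "fvs.span (delta ` E) \<subseteq> (supp_on E :: ('t \<Rightarrow> 'k) set)"
    by (rule fvs.span_minimal[OF _ subspace_supp_on]) (auto simp: supp_on_def delta_def split: if_splits)
qed

lemma inj_delta: "inj (delta :: 't \<Rightarrow> 't \<Rightarrow> 'k::field)"
  by (rule injI) (metis delta_def zero_neq_one)

lemma independent_delta:
  "fvs.independent (delta ` (E :: 't::finite set) :: ('t \<Rightarrow> 'k::field) set)"
proof (rule fvs.independent_if_scalars_zero)
  fix g :: "('t \<Rightarrow> 'k) \<Rightarrow> 'k" and x :: "'t \<Rightarrow> 'k"
  assume z: "(\<Sum>x\<in>delta ` E. fun_scale (*) (g x) x) = 0" and "x \<in> delta ` E"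
  then obtain S where S: "S \<in> E" "x = delta S" by blast
  have "0 = (\<Sum>T\<in>E. fun_scale (*) (g (delta T)) (delta T)) S"
    using z by (subst (asm) sum.reindex) (auto intro: inj_on_subset[OF inj_delta] simp: fun_eq_iff)
  also have "\<dots> = (\<Sum>T\<in>E. if T = S then g (delta T) else 0)"
    unfolding sum_fun_apply by (intro sum.cong) (auto simp: delta_def)
  finally show "g x = 0" using S by simp
qed simp

lemma dim_supp_on: "fvs.dim (supp_on E :: ('t::finite \<Rightarrow> 'k::field) set) = card E"
  unfolding supp_on_span fvs.dim_span fvs.dim_eq_card_independent[OF independent_delta]
  by (rule card_image) (rule inj_on_subset[OF inj_delta subset_UNIV])

text \<open>Over a general field a space may meet its annihilator, so no orthogonal splitting is
  available. Instead a basis of U is extended to C, and the dual vectors of the added elements form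
  a basis of the annihilator.\<close>

lemma dim_perp:
  fixes U :: "('t::finite \<Rightarrow> 'k::field) set"
  assumes U: "fvs.subspace U" "U \<subseteq> supp_on E"
  shows "fvs.dim (perp E U) + fvs.dim U = card E"
proof -
  obtain B where B: "B \<subseteq> U" "fvs.independent B" "U \<subseteq> fvs.span B" "card B = fvs.dim U"
    using fvs.basis_exists by blast
  have BE: "B \<subseteq> supp_on E" using B U by blast
  obtain C where C: "B \<subseteq> C" "C \<subseteq> supp_on E" "fvs.independent C" "supp_on E \<subseteq> fvs.span C"
    by (rule fvs.maximal_independent_subset_extend[OF BE B(2)])
  have "supp_on E \<subseteq> fvs.span (delta ` E :: ('t \<Rightarrow> 'k) set)" by (simp add: supp_on_span)
  then have finC: "finite C"
    using fvs.independent_span_bound[of "delta ` E" C] C by auto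
  have cC: "card C = card E"
    using fvs.basis_card_eq_dim[OF C(2) C(4) C(3)] dim_supp_on by metis
  \<comment> \<open>The coordinate functional of c with respect to C, represented as a vector for
    the standard pairing: its entry at T is its value on \<open>delta T\<close>.\<close>
  define star where "star c T = (if T \<in> E then fvs.representation C (delta T) c else 0)" for c T
  have star_supp: "star c \<in> supp_on E" for c by (auto simp: star_def supp_on_def)
  have dE: "delta T \<in> fvs.span C" if "T \<in> E" for T
  proof -
    have "delta T \<in> supp_on E" using that by (auto simp: supp_on_def delta_def)
    then show ?thesis using C(4) by blast
  qed
  have star: "pairing v (star c) = fvs.representation C v c" if v: "v \<in> supp_on E" for v c
  proof -
    have "fvs.representation C v c = fvs.representation C (\<Sum>T\<in>E. fun_scale (*) (v T) (delta T)) c"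
      using supp_on_expand[OF v] by simp
    also have "\<dots> = (\<Sum>T\<in>E. v T * fvs.representation C (delta T) c)"
      by (simp add: fvs.representation_sum[OF C(3)] fvs.representation_scale[OF C(3)] fvs.span_scale dE)
    also have "\<dots> = pairing v (star c)"
      unfolding pairing_def by (intro sum.mono_neutral_cong_left) (auto simp: star_def)
    finally show ?thesis by simp
  qed
  have dual: "pairing c' (star c) = (if c' = c then 1 else 0)" if "c' \<in> C" for c c'
    using star[of c' c] that C by (auto simp: fvs.representation_basis[OF C(3) that])
  have inj: "inj_on star C"
  proof (rule inj_onI)
    fix c c' assume c: "c \<in> C" "c' \<in> C" "star c = star c'"
    then show "c = c'" using dual[OF c(1), of c] dual[OF c(1), of c'] by (auto split: if_splits)
  qed
  have ind: "fvs.independent (star ` (C - B))"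
  proof (rule fvs.independent_if_scalars_zero)
    fix g x assume z: "(\<Sum>x\<in>star ` (C - B). fun_scale (*) (g x) x) = 0" and "x \<in> star ` (C - B)"
    then obtain c where c: "c \<in> C - B" "x = star c" by blast
    have "0 = pairing c (\<Sum>d\<in>C - B. fun_scale (*) (g (star d)) (star d))"
      using z by (subst (asm) sum.reindex) (auto intro: inj_on_subset[OF inj] simp: pairing_zero)
    also have "\<dots> = (\<Sum>d\<in>C - B. if d = c then g (star d) else 0)"
      unfolding pairing_sum pairing_fun_scale using c by (intro sum.cong) (auto simp: dual)
    finally show "g x = 0" using c finC by simp
  qed (use finC in simp)
  have sub: "star ` (C - B) \<subseteq> perp E U"
  proof clarify
    fix c assume c: "c \<in> C" "c \<notin> B"
    have "pairing (star c) u = 0" if "u \<in> U" for u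
    proof -
      have "u \<in> fvs.span B" using that B by blast
      then show ?thesis
      proof (induction rule: fvs.span_induct_alt)
        case base then show ?case by (rule pairing_zero)
      next
        case (step r b v)
        then have "b \<in> C" "b \<noteq> c" using c C(1) by auto
        then show ?case using dual[of b c] step unfolding pairing_add pairing_fun_scale pairing_commute[of _ b] by simp
      qed
    qed
    then show "star c \<in> perp E U" using star_supp by (simp add: perp_def)
  qed
  have "perp E U \<subseteq> fvs.span (star ` (C - B))"
  proof
    fix f assume f: "f \<in> perp E U"
    have "f = (\<Sum>c\<in>C - B. fun_scale (*) (pairing f c) (star c))"
    proof
      fix T
      show "f T = (\<Sum>c\<in>C - B. fun_scale (*) (pairing f c) (star c)) T"
      proof (cases "T \<in> E")
        case False
        then show ?thesis using f by (auto simp: sum_fun_apply star_def perp_def supp_on_def)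
      next
        case True
        have "delta T = (\<Sum>c\<in>C. fun_scale (*) (fvs.representation C (delta T) c) c)"
          by (rule fvs.sum_representation_eq[symmetric]) (use C(3) dE True finC in auto)
        then have "f T = pairing f (\<Sum>c\<in>C. fun_scale (*) (star c T) c)"
          using True by (metis (no_types, lifting) pairing_delta(1) star_def sum.cong)
        also have "\<dots> = (\<Sum>c\<in>C. star c T * pairing f c)" by (simp add: pairing_sum pairing_fun_scale)
        also have "\<dots> = (\<Sum>c\<in>C - B. star c T * pairing f c)"
          using f B(1) finC by (intro sum.mono_neutral_right) (auto simp: perp_def)
        finally show ?thesis by (simp add: sum_fun_apply mult.commute)
      qed
    qed
    then show "f \<in> fvs.span (star ` (C - B))"
      by (metis (no_types, lifting) fvs.span_base fvs.span_scale fvs.span_sum imageI)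
  qed
  then have "fvs.dim (perp E U) = card (star ` (C - B))"
    using fvs.basis_card_eq_dim[OF sub _ ind] by simp
  also have "\<dots> = card C - card B"
    using card_Diff_subset[OF finite_subset[OF C(1) finC] C(1)] card_image[OF inj_on_subset[OF inj]]
    by (metis Diff_subset)
  finally show ?thesis using B(4) cC card_mono[OF finC C(1)] by simp
qed

section \<open>Simplicial homology\<close>

definition bd :: "('v::finite \<Rightarrow> nat) \<Rightarrow> ('v set \<Rightarrow> 'k::field) \<Rightarrow> 'v set \<Rightarrow> 'k" where
  "bd key u = kdiff key (\<lambda>_ x. x) u"

definition schains :: "'v set set \<Rightarrow> int \<Rightarrow> ('v set \<Rightarrow> 'k::field) set" where
  "schains K p = supp_on {T \<in> K. int (card T) = p + 1}"

definition scycles :: "('v::finite \<Rightarrow> nat) \<Rightarrow> 'v set set \<Rightarrow> int \<Rightarrow> ('v set \<Rightarrow> 'k::field) set" where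
  "scycles key K p = {u \<in> schains K p. bd key u = 0}"

definition sbounds :: "('v::finite \<Rightarrow> nat) \<Rightarrow> 'v set set \<Rightarrow> int \<Rightarrow> ('v set \<Rightarrow> 'k::field) set" where
  "sbounds key K p = bd key ` schains K (p + 1)"

definition down_closed :: "'v set set \<Rightarrow> bool" where
  "down_closed K \<longleftrightarrow> (\<forall>T\<in>K. \<forall>S\<subseteq>T. S \<in> K)"

text \<open>A relation with n rather than a number: comparisons of complexes become equivalences
  that can be proved before a dimension is known to exist.\<close>

definition shomology :: "'k::field itself \<Rightarrow> ('v::finite \<Rightarrow> nat) \<Rightarrow> 'v set set \<Rightarrow> int \<Rightarrow> nat \<Rightarrow> bool" where
  "shomology _ key K p n \<longleftrightarrow> quot_dim (fun_scale ((*) :: 'k \<Rightarrow> 'k \<Rightarrow> 'k)) (scycles key K p) (sbounds key K p) n"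

text \<open>Degree -1 is included. The void complex is therefore acyclic, as intersections in a
  nerve argument require, while the complex whose only face is empty is not.\<close>

definition acyclic_cx :: "'k::field itself \<Rightarrow> ('v::finite \<Rightarrow> nat) \<Rightarrow> 'v set set \<Rightarrow> bool" where
  "acyclic_cx ty key K \<longleftrightarrow> (\<forall>p. shomology ty key K p 0)"

lemma acyclic_cx_iff: "acyclic_cx TYPE('k::field) key K \<longleftrightarrow> (\<forall>p. scycles key K p \<subseteq> (sbounds key K p :: ('v::finite set \<Rightarrow> 'k) set))"
  by (simp add: acyclic_cx_def shomology_def quot_dim_0_iff)

lemma graded_ops_mult: "graded_ops ((*) :: 'k::field \<Rightarrow> 'k \<Rightarrow> 'k) (\<lambda>_ x. x)"
  by (auto simp: graded_ops_def Modules.additive_def algebra_simps)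

lemma bd_apply: "bd key u G = (\<Sum>x\<in>-G. signed (num_before key G x) (u (insert x G)))"
  by (simp add: bd_def kdiff_def)

lemma bd_minus: "bd key (u - w) = bd key u - bd key w"
  unfolding bd_def by (rule kdiff_minus) (simp add: Modules.additive_def)

lemma bd_add: "bd key (u + w) = bd key u + bd key w"
  unfolding bd_def by (rule kdiff_add) (simp add: Modules.additive_def)

lemma bd_zero: "bd key 0 = 0"
  unfolding bd_def by (rule kdiff_zero) (simp add: Modules.additive_def)

lemma bd_fun_scale: "bd key (fun_scale (*) r u) = fun_scale (*) r (bd key u)"
  unfolding bd_def by (rule kdiff_fun_scale[OF graded_ops_mult])

lemma bd_bd: assumes "inj key" shows "bd key (bd key u) = 0"
  unfolding bd_def by (rule ext) (simp add: kdiff_kdiff[OF assms] Modules.additive_def)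

lemma schains_iff: "u \<in> schains K p \<longleftrightarrow> (\<forall>T. u T \<noteq> 0 \<longrightarrow> T \<in> K \<and> int (card T) = p + 1)"
  by (auto simp: schains_def supp_on_def)

lemma subspace_schains: "fvs.subspace (schains K p)"
  unfolding schains_def by (rule subspace_supp_on)

lemmas schains_closed = fvs.subspace_0[OF subspace_schains] fvs.subspace_diff[OF subspace_schains]
  fvs.subspace_add[OF subspace_schains] fvs.subspace_scale[OF subspace_schains] fvs.subspace_neg[OF subspace_schains]

lemma schains_mono: "K \<subseteq> L \<Longrightarrow> schains K p \<subseteq> schains L p"
  unfolding schains_iff subset_iff by blast

lemma schains_Int: "u \<in> schains K p \<Longrightarrow> u \<in> schains L p \<Longrightarrow> u \<in> schains (K \<inter> L) p"
  unfolding schains_iff by blast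

lemma schains_split:
  assumes "z \<in> schains (K \<union> L) p"
  shows "\<exists>u\<in>schains K p. \<exists>x\<in>schains L p. z = u + x"
proof (intro bexI)
  show "z = (\<lambda>T. if T \<in> K then z T else 0) + (\<lambda>T. if T \<in> K then 0 else z T)" by auto
qed (use assms in \<open>auto simp: schains_iff split: if_splits\<close>)

lemma bd_schains:
  assumes "down_closed K" "u \<in> schains K (p + 1)"
  shows "bd key u \<in> schains K p"
  unfolding schains_iff
proof (intro allI impI)
  fix T assume "bd key u T \<noteq> 0"
  then obtain x where "x \<notin> T" "u (insert x T) \<noteq> 0"
    unfolding bd_apply by (metis (mono_tags, lifting) ComplD signed_simps(2) sum.neutral)
  then have "insert x T \<in> K" "int (card (insert x T)) = p + 2" "x \<notin> T" using assms(2) by (auto simp: schains_iff)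
  then show "T \<in> K \<and> int (card T) = p + 1" using assms(1) by (auto simp: down_closed_def)
qed

lemma bd_Ch': "down_closed K \<Longrightarrow> u \<in> schains K p \<Longrightarrow> bd key u \<in> schains K (p - 1)"
  using bd_schains[of K u "p - 1"] by simp

section \<open>Mayer-Vietoris, cones, and families with acyclic intersections\<close>

lemma down_closed_Int: "down_closed K \<Longrightarrow> down_closed L \<Longrightarrow> down_closed (K \<inter> L)"
  and down_closed_UN: "(\<And>j. j \<in> J \<Longrightarrow> down_closed (X j)) \<Longrightarrow> down_closed (\<Union>j\<in>J. X j)"
  by (unfold down_closed_def, blast+)

lemma acyclic_cxD:
  fixes u :: "'v::finite set \<Rightarrow> 'k::field"
  assumes "acyclic_cx TYPE('k) key K" "u \<in> schains K p" "bd key u = 0"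
  obtains y where "y \<in> schains K (p + 1)" "bd key y = u"
  using assms unfolding acyclic_cx_iff scycles_def sbounds_def by blast

text \<open>With K and L acyclic, the outer terms of the Mayer-Vietoris sequence vanish and the
  connecting homomorphism is an isomorphism. R is its graph on cycles: split z as u + x along K and
  L and take the boundary of u. It admits all splittings at once.\<close>

lemma mayer_vietoris:
  fixes key :: "'v::finite \<Rightarrow> nat"
  assumes inj: "inj key" and dK: "down_closed K" and dL: "down_closed L"
    and aK: "acyclic_cx TYPE('k::field) key K" and aL: "acyclic_cx TYPE('k) key L"
  shows "shomology TYPE('k) key (K \<union> L) (p + 1) n \<longleftrightarrow> shomology TYPE('k) key (K \<inter> L) p n"
proof -
  define R :: "('v set \<Rightarrow> 'k) \<Rightarrow> ('v set \<Rightarrow> 'k) \<Rightarrow> bool" where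
    "R z w \<longleftrightarrow> (\<exists>u\<in>schains K (p + 1). \<exists>x\<in>schains L (p + 1). z = u + x \<and> w = bd key u \<and> bd key x = - w)" for z w
  have neg: "a + b = 0 \<Longrightarrow> b = - a" for a b :: "'v set \<Rightarrow> 'k"
    by (metis add_eq_0_iff)
  show ?thesis unfolding shomology_def
  proof (rule quot_dim_transfer[where R = R])
    show "R 0 0"
      unfolding R_def by (intro bexI[OF _ schains_closed(1)]) (simp add: bd_zero)
  next
    fix z w z' w' assume "R z w" "R z' w'"
    then obtain u x u' x' where 1: "u \<in> schains K (p + 1)" "x \<in> schains L (p + 1)" "z = u + x" "w = bd key u" "bd key x = - w"
      and 2: "u' \<in> schains K (p + 1)" "x' \<in> schains L (p + 1)" "z' = u' + x'" "w' = bd key u'" "bd key x' = - w'"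
      unfolding R_def by blast
    show "R (z - z') (w - w')"
      unfolding R_def
    proof (intro bexI conjI)
      show "z - z' = (u - u') + (x - x')" by (simp only: 1 2 add_diff_add)
      show "w - w' = bd key (u - u')" by (simp only: 1 2 bd_minus)
      show "bd key (x - x') = - (w - w')" by (simp only: bd_minus 1(5) 2(5)) simp
    qed (use 1 2 schains_closed in blast)+
  next
    fix r z w assume "R z w"
    then obtain u x where 1: "u \<in> schains K (p + 1)" "x \<in> schains L (p + 1)" "z = u + x" "w = bd key u" "bd key x = - w"
      unfolding R_def by blast
    show "R (fun_scale (*) r z) (fun_scale (*) r w)"
      unfolding R_def
    proof (intro bexI conjI)
      show "fun_scale (*) r z = fun_scale (*) r u + fun_scale (*) r x" by (simp only: 1 fvs.scale_right_distrib)
      show "fun_scale (*) r w = bd key (fun_scale (*) r u)" by (simp only: 1 bd_fun_scale)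
      show "bd key (fun_scale (*) r x) = - fun_scale (*) r w" by (simp only: bd_fun_scale 1(5) fvs.scale_minus_right)
    qed (use 1 schains_closed in blast)+
  next
    fix z :: "'v set \<Rightarrow> 'k" assume "z \<in> scycles key (K \<union> L) (p + 1)"
    then obtain u x where ux: "u \<in> schains K (p + 1)" "x \<in> schains L (p + 1)" "z = u + x" "bd key z = 0"
      using schains_split[of z K L] unfolding scycles_def by blast
    have "bd key u + bd key x = 0" using ux(4) unfolding ux(3) bd_add .
    then have "R z (bd key u)" unfolding R_def using ux neg by blast
    then show "\<exists>w. R z w" by blast
  next
    fix w :: "'v set \<Rightarrow> 'k" assume "w \<in> scycles key (K \<inter> L) p"
    then have w: "w \<in> schains (K \<inter> L) p" "bd key w = 0" by (auto simp: scycles_def)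
    obtain u where u: "u \<in> schains K (p + 1)" "bd key u = w"
      using acyclic_cxD[OF aK, of w p] w schains_mono[of "K \<inter> L" K p] by blast
    obtain x where x: "x \<in> schains L (p + 1)" "bd key x = w"
      using acyclic_cxD[OF aL, of w p] w schains_mono[of "K \<inter> L" L p] by blast
    \<comment> \<open>Two fillings of w, one in each complex, glue with opposite signs to a cycle of
      the union.\<close>
    have "bd key (- x) = - w" using bd_minus[of key 0 x] by (simp add: bd_zero x)
    then have "R (u + - x) w" unfolding R_def using u x schains_closed(5) by blast
    then show "\<exists>z. R z w" by blast
  next
    fix z w assume "R z w"
    then obtain u x where ux: "u \<in> schains K (p + 1)" "x \<in> schains L (p + 1)" "z = u + x" "w = bd key u" "bd key x = - w"
      unfolding R_def by blast
    have z: "z \<in> scycles key (K \<union> L) (p + 1)"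
    proof -
      have "u \<in> schains (K \<union> L) (p + 1)" "x \<in> schains (K \<union> L) (p + 1)"
        using ux schains_mono[of K "K \<union> L"] schains_mono[of L "K \<union> L"] by blast+
      then have "z \<in> schains (K \<union> L) (p + 1)" unfolding ux(3) by (rule schains_closed(3))
      moreover have "bd key z = 0" unfolding ux(3) bd_add ux(5) ux(4)[symmetric] by simp
      ultimately show ?thesis by (simp add: scycles_def)
    qed
    have wK: "w \<in> schains K p" unfolding ux(4) by (rule bd_schains[OF dK ux(1)])
    have "- w \<in> schains L p" unfolding ux(5)[symmetric] by (rule bd_schains[OF dL ux(2)])
    then have "w \<in> schains L p" using schains_closed(5)[of "- w"] by simp
    then have w: "w \<in> scycles key (K \<inter> L) p"
      using schains_Int[OF wK] bd_bd[OF inj] ux(4) by (simp add: scycles_def)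
    have "z \<in> sbounds key (K \<union> L) (p + 1) \<longleftrightarrow> w \<in> sbounds key (K \<inter> L) p"
    proof
      assume "z \<in> sbounds key (K \<union> L) (p + 1)"
      then obtain y where y: "y \<in> schains (K \<union> L) (p + 1 + 1)" "z = bd key y" by (auto simp: sbounds_def)
      obtain a b where ab: "a \<in> schains K (p + 1 + 1)" "b \<in> schains L (p + 1 + 1)" "y = a + b" using schains_split[OF y(1)] by blast
      \<comment> \<open>The left side lives on K and the right side on L, so their common value is a
        chain of the intersection, and its boundary is w.\<close>
      have e: "u - bd key a = bd key b - x"
        using y(2) unfolding ux(3) ab(3) bd_add by (simp add: algebra_simps)
      have "u - bd key a \<in> schains K (p + 1)" by (rule schains_closed(2)[OF ux(1) bd_schains[OF dK ab(1)]])
      moreover have "u - bd key a \<in> schains L (p + 1)" unfolding e by (rule schains_closed(2)[OF bd_schains[OF dL ab(2)] ux(2)])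
      ultimately have "u - bd key a \<in> schains (K \<inter> L) (p + 1)" by (rule schains_Int)
      moreover have "w = bd key (u - bd key a)" by (simp only: bd_minus bd_bd[OF inj] ux(4)) simp
      ultimately show "w \<in> sbounds key (K \<inter> L) p" unfolding sbounds_def by blast
    next
      assume "w \<in> sbounds key (K \<inter> L) p"
      then obtain y where y: "y \<in> schains (K \<inter> L) (p + 1)" "w = bd key y" by (auto simp: sbounds_def)
      have yy: "y \<in> schains K (p + 1)" "y \<in> schains L (p + 1)"
        using y schains_mono[of "K \<inter> L" K] schains_mono[of "K \<inter> L" L] by blast+
      have "bd key (u - y) = 0" by (simp only: bd_minus y(2)[symmetric] ux(4)[symmetric]) simp
      then obtain a where a: "a \<in> schains K (p + 1 + 1)" "bd key a = u - y"
        using acyclic_cxD[OF aK, of "u - y"] schains_closed(2)[OF ux(1) yy(1)] by blast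
      have "bd key (x + y) = 0" by (simp only: bd_add y(2)[symmetric] ux(5)) simp
      then obtain b where b: "b \<in> schains L (p + 1 + 1)" "bd key b = x + y"
        using acyclic_cxD[OF aL, of "x + y"] schains_closed(3)[OF ux(2) yy(2)] by blast
      have "a \<in> schains (K \<union> L) (p + 1 + 1)" "b \<in> schains (K \<union> L) (p + 1 + 1)"
        using a b schains_mono[of K "K \<union> L"] schains_mono[of L "K \<union> L"] by blast+
      then have "a + b \<in> schains (K \<union> L) (p + 1 + 1)" by (rule schains_closed(3))
      moreover have "z = bd key (a + b)" by (simp only: bd_add a b ux(3)) simp
      ultimately show "z \<in> sbounds key (K \<union> L) (p + 1)" unfolding sbounds_def by blast
    qed
    then show "z \<in> scycles key (K \<union> L) (p + 1) \<and> w \<in> scycles key (K \<inter> L) p \<and>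
      (z \<in> sbounds key (K \<union> L) (p + 1) \<longleftrightarrow> w \<in> sbounds key (K \<inter> L) p)" using z w by blast
  qed
qed

text \<open>Adding the apex to each face, with the sign of its position, is a contracting homotopy.
  At a face without the apex only the term that adds it survives; at a face containing it, the cycle
  condition of the opposite face is used.\<close>

lemma acyclic_cx_cone:
  fixes key :: "'v::finite \<Rightarrow> nat"
  assumes inj: "inj key" and cone: "\<And>T. T \<in> K \<Longrightarrow> insert x0 T \<in> K"
  shows "acyclic_cx TYPE('k::field) key K"
  unfolding acyclic_cx_iff
proof (intro allI subsetI)
  fix p and u :: "'v set \<Rightarrow> 'k" assume "u \<in> scycles key K p"
  then have u: "u \<in> schains K p" "bd key u = 0" by (auto simp: scycles_def)
  define h where "h T = (if x0 \<in> T then signed (num_before key (T - {x0}) x0) (u (T - {x0})) else 0)" for T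
  have "h \<in> schains K (p + 1)" unfolding schains_iff
  proof (intro allI impI)
    fix T assume "h T \<noteq> 0"
    then have x: "x0 \<in> T" "u (T - {x0}) \<noteq> 0" by (auto simp: h_def split: if_splits)
    then have "insert x0 (T - {x0}) \<in> K" "int (card (T - {x0})) = p + 1" using u cone unfolding schains_iff by blast+
    moreover have "Suc (card (T - {x0})) = card T" by (rule card_Suc_Diff1) (use x in auto)
    ultimately show "T \<in> K \<and> int (card T) = p + 1 + 1" using x by (auto simp: insert_absorb)
  qed
  moreover have "bd key h G = u G" for G
  proof (cases "x0 \<in> G")
    case False
    have "bd key h G = (\<Sum>x\<in>-G. if x = x0 then u G else 0)"
      unfolding bd_apply using False by (intro sum.cong) (auto simp: h_def)
    then show ?thesis using False by simp
  next
    case True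
    define H where "H = G - {x0}"
    have G: "G = insert x0 H" "x0 \<notin> H" using True by (auto simp: H_def)
    \<comment> \<open>The cycle condition at the face opposite the apex, to be solved for u
      G.\<close>
    have "0 = bd key u H" by (simp only: u zero_fun_apply)
    also have "\<dots> = (\<Sum>x\<in>insert x0 (-G). signed (num_before key H x) (u (insert x H)))"
      unfolding bd_apply using G by (intro sum.cong) auto
    also have "\<dots> = signed (num_before key H x0) (u G) + (\<Sum>x\<in>-G. signed (num_before key H x) (u (insert x H)))"
      using G by (subst sum.insert) auto
    finally have "0 = signed (num_before key H x0) (signed (num_before key H x0) (u G) + (\<Sum>x\<in>-G. signed (num_before key H x) (u (insert x H))))"
      by simp
    also have "\<dots> = u G + (\<Sum>x\<in>-G. signed (num_before key H x0 + num_before key H x) (u (insert x H)))"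
      by (simp only: signed_def sum_negf[symmetric]) (auto simp: sum_distrib_left signed_def sum_negf[symmetric] intro!: sum.cong)
    finally have *: "u G = (\<Sum>x\<in>-G. - signed (num_before key H x0 + num_before key H x) (u (insert x H)))"
      by (simp add: sum_negf eq_neg_iff_add_eq_0)
    have "bd key h G = (\<Sum>x\<in>-G. signed (num_before key G x) (signed (num_before key (insert x H) x0) (u (insert x H))))"
      unfolding bd_apply
    proof (intro sum.cong refl)
      fix x assume "x \<in> - G"
      then have "insert x G - {x0} = insert x H" using G by auto
      then show "signed (num_before key G x) (h (insert x G)) = signed (num_before key G x) (signed (num_before key (insert x H) x0) (u (insert x H)))"
        using G by (simp add: h_def)
    qed
    also have "\<dots> = (\<Sum>x\<in>-G. - signed (num_before key H x0 + num_before key H x) (u (insert x H)))"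
    proof (intro sum.cong refl)
      fix x assume "x \<in> - G"
      then have x: "x \<noteq> x0" "x \<notin> H" using G by auto
      have "key x < key x0 \<or> key x0 < key x" using x inj by (metis injD linorder_neqE_nat)
      then show "signed (num_before key G x) (signed (num_before key (insert x H) x0) (u (insert x H))) =
          - signed (num_before key H x0 + num_before key H x) (u (insert x H))"
        using x G(2) unfolding G(1) by (auto simp: num_before_insert signed_signed add.commute)
    qed
    finally show ?thesis using * by simp
  qed
  ultimately show "u \<in> sbounds key K p" unfolding sbounds_def by (metis ext imageI)
qed

text \<open>Induction on J, splitting off X j. Mayer-Vietoris gives a shift by one, from the union
  of all to the intersection of X j with the union of the rest. That intersection is the union of
  the family X i \<inter> X j, whose proper intersections are proper intersections of the old
  family.\<close>

lemma nerve:
  fixes key :: "'v::finite \<Rightarrow> nat" and X :: "'j \<Rightarrow> 'v set set"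
  assumes inj: "inj key" and fin: "finite J" and ne: "J \<noteq> {}"
    and "\<And>j. j \<in> J \<Longrightarrow> down_closed (X j)"
    and "\<And>I. I \<subset> J \<Longrightarrow> I \<noteq> {} \<Longrightarrow> acyclic_cx TYPE('k::field) key (\<Inter>i\<in>I. X i)"
  shows "shomology TYPE('k) key (\<Union>j\<in>J. X j) (p + int (card J) - 1) n \<longleftrightarrow> shomology TYPE('k) key (\<Inter>j\<in>J. X j) p n"
  using fin ne assms(4-)
proof (induction J arbitrary: X p n rule: finite_ne_induct)
  case (singleton j)
  then show ?case by simp
next
  case (insert j J)
  have dU: "down_closed (\<Union>i\<in>J. X i)" and dj: "down_closed (X j)" using insert.prems(1) by (auto intro: down_closed_UN)
  have aJ: "acyclic_cx TYPE('k) key (\<Inter>i\<in>I. X i)" if "I \<subseteq> J" "I \<noteq> {}" for I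
    by (rule insert.prems(2)) (use that insert.hyps in auto)
  have aj: "acyclic_cx TYPE('k) key (X j)" using insert.prems(2)[of "{j}"] insert.hyps by auto
  have aU: "acyclic_cx TYPE('k) key (\<Union>i\<in>J. X i)"
    unfolding acyclic_cx_def
  proof
    fix q
    \<comment> \<open>J is a proper subset of \<open>insert j J\<close>, so its total intersection
      is acyclic; the induction hypothesis with dimension 0 carries the vanishing to the union, in
      every degree q.\<close>
    have "shomology TYPE('k) key (\<Inter>i\<in>J. X i) (q - int (card J) + 1) 0"
      using aJ[of J] insert.hyps by (simp add: acyclic_cx_def)
    then show "shomology TYPE('k) key (\<Union>i\<in>J. X i) q 0"
      using insert.IH[of X "q - int (card J) + 1" 0] insert.prems(1) aJ by auto
  qed
  have ii: "(\<Inter>i\<in>I. X i \<inter> X j) = (\<Inter>i\<in>insert j I. X i)" if "I \<noteq> {}" for I using that by auto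
  have "shomology TYPE('k) key (\<Union>i\<in>insert j J. X i) (p + int (card (insert j J)) - 1) n
      \<longleftrightarrow> shomology TYPE('k) key ((\<Union>i\<in>J. X i) \<union> X j) ((p + int (card J) - 1) + 1) n"
    using insert.hyps by (simp add: Un_commute algebra_simps)
  also have "\<dots> \<longleftrightarrow> shomology TYPE('k) key ((\<Union>i\<in>J. X i) \<inter> X j) (p + int (card J) - 1) n"
    by (rule mayer_vietoris[OF inj dU dj aU aj])
  also have "(\<Union>i\<in>J. X i) \<inter> X j = (\<Union>i\<in>J. X i \<inter> X j)" by auto
  also have "shomology TYPE('k) key \<dots> (p + int (card J) - 1) n \<longleftrightarrow> shomology TYPE('k) key (\<Inter>i\<in>J. X i \<inter> X j) p n"
  proof (rule insert.IH)
    show "down_closed (X i \<inter> X j)" if "i \<in> J" for i using that insert.prems(1) by (auto intro: down_closed_Int)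
    show "acyclic_cx TYPE('k) key (\<Inter>i\<in>I. X i \<inter> X j)" if "I \<subset> J" "I \<noteq> {}" for I
      unfolding ii[OF that(2)] by (rule insert.prems(2)) (use that insert.hyps in auto)
  qed
  finally show ?case unfolding ii[OF insert.hyps(2)] .
qed

section \<open>Alexander duality\<close>

definition cobd :: "('v::finite \<Rightarrow> nat) \<Rightarrow> ('v set \<Rightarrow> 'k::field) \<Rightarrow> 'v set \<Rightarrow> 'k" where
  "cobd key v T = (\<Sum>x\<in>T. signed (num_before key T x) (v (T - {x})))"

text \<open>Cochains of K are functions supported on K, whereas \<open>cobd\<close> is the
  coboundary of the full simplex and may leave K. Its values are therefore tested on faces of K
  only.\<close>

definition cocycles :: "('v::finite \<Rightarrow> nat) \<Rightarrow> 'v set set \<Rightarrow> int \<Rightarrow> ('v set \<Rightarrow> 'k::field) set" where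
  "cocycles key K q = {v \<in> schains K q. \<forall>T\<in>K. cobd key v T = 0}"

definition cobounds :: "('v::finite \<Rightarrow> nat) \<Rightarrow> 'v set set \<Rightarrow> int \<Rightarrow> ('v set \<Rightarrow> 'k::field) set" where
  "cobounds key K q = {v \<in> schains K q. \<exists>y\<in>schains K (q - 1). \<forall>T\<in>K. v T = cobd key y T}"

lemma signed_add: "signed n (x + y) = signed n x + signed n y"
  by (auto simp: signed_def)

lemma signed_mult: "signed n x * y = signed n (x * (y::'k::field))" "x * signed n y = signed n (x * y)"
  by (auto simp: signed_def)

lemma pairing_bd:
  fixes key :: "'v::finite \<Rightarrow> nat"
  shows "pairing (bd key g) f = pairing g (cobd key f)"
proof -
  have "pairing (bd key g) f = (\<Sum>G\<in>UNIV. \<Sum>x\<in>-G. signed (num_before key G x) (g (insert x G) * f G))"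
    by (simp add: pairing_def bd_apply sum_distrib_right signed_mult)
  also have "\<dots> = (\<Sum>(G,x)\<in>(SIGMA G:UNIV. -G). signed (num_before key G x) (g (insert x G) * f G))"
    by (simp add: sum.Sigma)
  also have "\<dots> = (\<Sum>(T,x)\<in>(SIGMA T:UNIV. T). signed (num_before key T x) (g T * f (T - {x})))"
    by (rule sum.reindex_bij_witness[where i = "\<lambda>(T,x). (T - {x}, x)" and j = "\<lambda>(G,x). (insert x G, x)"])
       (auto simp: num_before_insert insert_absorb)
  also have "\<dots> = (\<Sum>T\<in>UNIV. \<Sum>x\<in>T. signed (num_before key T x) (g T * f (T - {x})))"
    by (simp add: sum.Sigma)
  also have "\<dots> = pairing g (cobd key f)"
    by (simp add: pairing_def cobd_def sum_distrib_left signed_mult)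
  finally show ?thesis .
qed

lemma delta_schains: "T \<in> K \<Longrightarrow> int (card T) = p + 1 \<Longrightarrow> delta T \<in> schains K p"
  by (auto simp: schains_iff delta_def split: if_splits)

definition restrict_to :: "'t set \<Rightarrow> ('t \<Rightarrow> 'k::zero) \<Rightarrow> 't \<Rightarrow> 'k" where
  "restrict_to K v T = (if T \<in> K then v T else 0)"

lemma cobd_schains:
  assumes "y \<in> schains K (q - 1)"
  shows "restrict_to K (cobd key y) \<in> schains K q"
  unfolding schains_iff
proof (intro allI impI)
  fix T assume "restrict_to K (cobd key y) T \<noteq> 0"
  then have T: "T \<in> K" "cobd key y T \<noteq> 0" by (auto simp: restrict_to_def split: if_splits)
  then obtain x where x: "x \<in> T" "y (T - {x}) \<noteq> 0"
    unfolding cobd_def by (metis (mono_tags, lifting) signed_simps(2) sum.neutral)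
  then have "int (card (T - {x})) = q" using assms by (auto simp: schains_iff)
  moreover have "Suc (card (T - {x})) = card T" by (rule card_Suc_Diff1) (use x in auto)
  ultimately show "T \<in> K \<and> int (card T) = q + 1" using T by auto
qed

text \<open>\<open>cobd\<close> is adjoint to \<open>bd\<close>. The cocycle condition at a face T
  of the right size is the pairing with the boundary of \<open>delta T\<close>; at other sizes it
  holds for reasons of cardinality.\<close>

lemma cocycles_perp:
  fixes key :: "'v::finite \<Rightarrow> nat"
  shows "(cocycles key K q :: ('v set \<Rightarrow> 'k::field) set) = perp {T \<in> K. int (card T) = q + 1} (sbounds key K q)"
proof (intro set_eqI iffI)
  fix f :: "'v set \<Rightarrow> 'k" assume f: "f \<in> cocycles key K q"
  have "pairing f (bd key g) = 0" if "g \<in> schains K (q + 1)" for g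
  proof -
    have "pairing f (bd key g) = pairing g (cobd key f)" by (metis pairing_bd pairing_commute)
    also have "\<dots> = 0" unfolding pairing_def
      using f that by (intro sum.neutral) (auto simp: cocycles_def schains_iff)
    finally show ?thesis .
  qed
  then show "f \<in> perp {T \<in> K. int (card T) = q + 1} (sbounds key K q)"
    using f by (auto simp: perp_def sbounds_def cocycles_def schains_def)
next
  fix f :: "'v set \<Rightarrow> 'k" assume f: "f \<in> perp {T \<in> K. int (card T) = q + 1} (sbounds key K q)"
  then have fC: "f \<in> schains K q" by (simp add: perp_def schains_def)
  have "cobd key f T = 0" if "T \<in> K" for T
  proof (cases "int (card T) = q + 1 + 1")
    case True
    have "cobd key f T = pairing f (bd key (delta T))"
      by (metis pairing_bd pairing_commute pairing_delta(2))
    then show ?thesis using f delta_schains[OF that True] by (auto simp: perp_def sbounds_def)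
  next
    case False
    have "f (T - {x}) = 0" if "x \<in> T" for x
    proof (rule ccontr)
      assume "f (T - {x}) \<noteq> 0"
      then have "int (card (T - {x})) = q + 1" using fC by (auto simp: schains_iff)
      moreover have "Suc (card (T - {x})) = card T" by (rule card_Suc_Diff1) (use that in auto)
      ultimately show False using False by auto
    qed
    then show ?thesis by (simp add: cobd_def)
  qed
  then show "f \<in> cocycles key K q" using fC by (simp add: cocycles_def)
qed

lemma cobounds_eq: "cobounds key K q = (\<lambda>y. restrict_to K (cobd key y)) ` schains K (q - 1)"
proof (intro set_eqI iffI)
  fix v assume "v \<in> cobounds key K q"
  then obtain y where y: "v \<in> schains K q" "y \<in> schains K (q - 1)" "\<And>T. T \<in> K \<Longrightarrow> v T = cobd key y T"
    by (auto simp: cobounds_def)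
  have "v T = restrict_to K (cobd key y) T" for T
    using y(1,3) by (cases "T \<in> K") (auto simp: restrict_to_def schains_iff)
  then show "v \<in> (\<lambda>y. restrict_to K (cobd key y)) ` schains K (q - 1)" using y(2) by blast
next
  fix v assume "v \<in> (\<lambda>y. restrict_to K (cobd key y)) ` schains K (q - 1)"
  then show "v \<in> cobounds key K q" using cobd_schains by (auto simp: cobounds_def) (auto simp: restrict_to_def)
qed

lemma scycles_perp:
  fixes key :: "'v::finite \<Rightarrow> nat"
  assumes K: "down_closed K"
  shows "(scycles key K q :: ('v set \<Rightarrow> 'k::field) set) = perp {T \<in> K. int (card T) = q + 1} (cobounds key K q)"
proof -
  have adj: "pairing u (restrict_to K (cobd key y)) = pairing (bd key u) y" if "u \<in> schains K q" for u y :: "'v set \<Rightarrow> 'k"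
    unfolding pairing_bd unfolding pairing_def
    using that by (intro sum.cong) (auto simp: restrict_to_def schains_iff)
  show ?thesis
  proof (intro set_eqI iffI)
    fix u :: "'v set \<Rightarrow> 'k" assume "u \<in> scycles key K q"
    then have u: "u \<in> schains K q" "bd key u = 0" by (auto simp: scycles_def)
    then show "u \<in> perp {T \<in> K. int (card T) = q + 1} (cobounds key K q)"
      unfolding perp_def cobounds_eq using adj[OF u(1)] by (auto simp: schains_def u(2) pairing_def)
  next
    fix u :: "'v set \<Rightarrow> 'k" assume u: "u \<in> perp {T \<in> K. int (card T) = q + 1} (cobounds key K q)"
    then have uC: "u \<in> schains K q" by (simp add: perp_def schains_def)
    have "bd key u T = 0" for T
    proof (rule ccontr)
      assume ne: "bd key u T \<noteq> 0"
      then have "T \<in> K" "int (card T) = q" using bd_Ch'[OF K uC, of key] by (auto simp: schains_iff)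
      then have "delta T \<in> (schains K (q - 1) :: ('v set \<Rightarrow> 'k) set)" by (intro delta_schains) auto
      then have "pairing u (restrict_to K (cobd key (delta T))) = 0" using u by (auto simp: perp_def cobounds_eq)
      then show False using ne adj[OF uC] by simp
    qed
    then show "u \<in> scycles key K q" using uC by (auto simp: scycles_def fun_eq_iff)
  qed
qed

lemma subspace_image:
  assumes V: "fvs.subspace V" and "f 0 = 0" "\<And>x y. f (x + y) = f x + f y"
    "\<And>r x. f (fun_scale (*) r x) = fun_scale (*) r (f x)"
  shows "fvs.subspace (f ` V)"
proof (rule fvs.subspaceI)
  show "0 \<in> f ` V" using fvs.subspace_0[OF V] assms(2) by (metis imageI)
  show "x + y \<in> f ` V" if "x \<in> f ` V" "y \<in> f ` V" for x y
    using that assms(3) fvs.subspace_add[OF V] by (metis (no_types, lifting) image_iff)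
  show "fun_scale (*) r x \<in> f ` V" if "x \<in> f ` V" for r x
    using that assms(4) fvs.subspace_scale[OF V] by (metis (no_types, lifting) image_iff)
qed

lemma subspace_sbounds: "fvs.subspace (sbounds key K p)"
  unfolding sbounds_def by (rule subspace_image[OF subspace_schains]) (rule bd_zero bd_add bd_fun_scale)+

lemma subspace_cobounds: "fvs.subspace (cobounds key K q)"
  unfolding cobounds_eq
  by (rule subspace_image[OF subspace_schains])
     (auto simp: fun_eq_iff restrict_to_def cobd_def signed_add sum.distrib sum_distrib_left signed_mult)

lemma subspace_perp: "fvs.subspace (perp E (U :: ('a::finite \<Rightarrow> 'b::field) set))"
proof -
  have "pairing (0 :: 'a \<Rightarrow> 'b) u = 0" "pairing (f + g) u = pairing f u + pairing g u"
    "pairing (fun_scale (*) r f) u = r * pairing f u" for f g u :: "'a \<Rightarrow> 'b" and r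
    by (simp_all add: pairing_def algebra_simps sum.distrib sum_distrib_left)
  then show ?thesis unfolding perp_def
    by (intro fvs.subspaceI CollectI conjI ballI)
      (simp_all add: fvs.subspace_0[OF subspace_supp_on] fvs.subspace_add[OF subspace_supp_on]
        fvs.subspace_scale[OF subspace_supp_on])
qed

lemma sbounds_subset_scycles: "inj key \<Longrightarrow> down_closed K \<Longrightarrow> sbounds key K p \<subseteq> scycles key K p"
  by (auto simp: sbounds_def scycles_def bd_bd intro: bd_schains)

lemma scycles_fin: "scycles key K p \<subseteq> fvs.span (delta ` {T \<in> K. int (card T) = p + 1})"
  unfolding supp_on_span[symmetric] by (auto simp: scycles_def schains_def)

lemma subspace_scycles: "fvs.subspace (scycles key K p)"
  unfolding scycles_def
  by (rule fvs.subspaceI) (auto simp: bd_add bd_fun_scale bd_zero intro: schains_closed)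

lemma shomology_iff_dim:
  assumes "inj key" "down_closed K"
  shows "shomology TYPE('k::field) key K p n \<longleftrightarrow>
    fvs.dim (scycles key K p :: ('v::finite set \<Rightarrow> 'k) set) = fvs.dim (sbounds key K p :: ('v set \<Rightarrow> 'k) set) + n"
  unfolding shomology_def
  by (rule fvs.quot_dim_iff_dim[OF subspace_scycles subspace_sbounds sbounds_subset_scycles[OF assms] _ scycles_fin]) simp

text \<open>Inside the space of q-chains, cycles annihilate coboundaries and cocycles annihilate
  boundaries, each being the full annihilator. The two dimension counts have the same total, so the
  differences of dimensions agree.\<close>

lemma cohomology_dim:
  assumes inj: "inj key" and K: "down_closed K"
  shows "quot_dim (fun_scale ((*) :: 'k::field \<Rightarrow> 'k \<Rightarrow> 'k)) (cocycles key K q) (cobounds key K q) n \<longleftrightarrow> shomology TYPE('k) key K q n"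
proof -
  let ?E = "{T \<in> K. int (card T) = q + 1}"
  let ?scycles = "scycles key K q :: ('a set \<Rightarrow> 'k) set" and ?sbounds = "sbounds key K q :: ('a set \<Rightarrow> 'k) set"
  let ?cZ = "cocycles key K q :: ('a set \<Rightarrow> 'k) set" and ?cB = "cobounds key K q :: ('a set \<Rightarrow> 'k) set"
  have 1: "fvs.dim ?scycles + fvs.dim ?cB = card ?E"
    unfolding scycles_perp[OF K] by (rule dim_perp[OF subspace_cobounds]) (auto simp: cobounds_def schains_def)
  have 2: "fvs.dim ?cZ + fvs.dim ?sbounds = card ?E"
    unfolding cocycles_perp by (rule dim_perp[OF subspace_sbounds]) (use bd_schains[OF K] in \<open>auto simp: sbounds_def schains_def\<close>)
  have "pairing f u = 0" if "f \<in> ?cB" "u \<in> ?sbounds" for f u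
  proof -
    have "u \<in> ?scycles" using that sbounds_subset_scycles[OF inj K] by blast
    then have "pairing u f = 0" using that(1) unfolding scycles_perp[OF K] perp_def by blast
    then show ?thesis by (simp add: pairing_commute)
  qed
  then have sub: "?cB \<subseteq> ?cZ" unfolding cocycles_perp perp_def by (auto simp: cobounds_def schains_def)
  have "quot_dim (fun_scale ((*) :: 'k \<Rightarrow> 'k \<Rightarrow> 'k)) ?cZ ?cB n \<longleftrightarrow> fvs.dim ?cZ = fvs.dim ?cB + n"
  proof (rule fvs.quot_dim_iff_dim[OF _ subspace_cobounds sub])
    show "fvs.subspace ?cZ" unfolding cocycles_perp by (rule subspace_perp)
    show "?cZ \<subseteq> fvs.span (delta ` ?E)" unfolding supp_on_span[symmetric] by (auto simp: cocycles_def schains_def)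
  qed simp
  then show ?thesis unfolding shomology_iff_dim[OF inj K] using 1 2 by linarith
qed

text \<open>
  The sign that turns the boundary into the coboundary of the complement: it is the sum over
  \<open>x \<in> T\<close> of the positions of \<open>x\<close> in the whole vertex set, and such a position is
  \<open>num_before key T x + num_before key (- T) x\<close>.
\<close>

definition star_exp :: "('v::finite \<Rightarrow> nat) \<Rightarrow> 'v set \<Rightarrow> nat" where
  "star_exp key T = (\<Sum>x\<in>T. num_before key UNIV x)"

definition star :: "('v::finite \<Rightarrow> nat) \<Rightarrow> ('v set \<Rightarrow> 'k::field) \<Rightarrow> 'v set \<Rightarrow> 'k" where
  "star key u T = signed (star_exp key T) (u (- T))"

definition unstar :: "('v::finite \<Rightarrow> nat) \<Rightarrow> ('v set \<Rightarrow> 'k::field) \<Rightarrow> 'v set \<Rightarrow> 'k" where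
  "unstar key v S = signed (star_exp key (- S)) (v (- S))"

lemma star_unstar: "star key (unstar key v) = v"
  by (auto simp: star_def unstar_def)

lemma cobd_star: "cobd key (star key u) = star key (bd key u)"
proof
  fix T
  have "signed (num_before key T x) (signed (star_exp key (T - {x})) (u (- (T - {x}))))
      = signed (star_exp key T) (signed (num_before key (- T) x) (u (insert x (- T))))" if x: "x \<in> T" for x
  proof -
    have "{y \<in> UNIV. key y < key x} = {y \<in> T. key y < key x} \<union> {y \<in> - T. key y < key x}" by auto
    then have "num_before key UNIV x = num_before key T x + num_before key (- T) x"
      unfolding num_before_def by (simp add: card_Un_disjoint disjoint_iff)
    moreover have "star_exp key T = num_before key UNIV x + star_exp key (T - {x})"
      unfolding star_exp_def by (rule sum.remove) (use x in auto)
    moreover have "- (T - {x}) = insert x (- T)" using x by auto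
    ultimately show ?thesis by (auto simp: signed_def)
  qed
  then show "cobd key (star key u) T = star key (bd key u) T"
    by (simp add: cobd_def star_def bd_apply signed_sum)
qed

lemma cobd_restrict_to: "down_closed K \<Longrightarrow> T \<in> K \<Longrightarrow> cobd key (restrict_to K v) T = cobd key v T"
  unfolding cobd_def by (intro sum.cong) (auto simp: restrict_to_def down_closed_def)

lemma int_card_Compl: "int (card (- T)) = int CARD('v) - int (card T)" for T :: "'v::finite set"
  using card_mono[of UNIV T] by (simp add: Compl_eq_Diff_UNIV card_Diff_subset of_nat_diff)

lemma star_schains: "u \<in> schains UNIV p \<Longrightarrow> star key u \<in> schains UNIV (int CARD('v) - p - 2)"
  for u :: "'v::finite set \<Rightarrow> 'k::field"
proof (unfold schains_iff, intro allI impI)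
  fix T assume u: "\<forall>T. u T \<noteq> 0 \<longrightarrow> T \<in> UNIV \<and> int (card T) = p + 1" "star key u T \<noteq> 0"
  then have "int (card (- T)) = p + 1" by (simp add: star_def)
  then show "T \<in> UNIV \<and> int (card T) = int CARD('v) - p - 2 + 1" unfolding int_card_Compl by simp
qed

lemma unstar_schains: "v \<in> schains UNIV q \<Longrightarrow> unstar key v \<in> schains UNIV (int CARD('v) - q - 2)"
  for v :: "'v::finite set \<Rightarrow> 'k::field"
proof (unfold schains_iff, intro allI impI)
  fix T assume u: "\<forall>T. v T \<noteq> 0 \<longrightarrow> T \<in> UNIV \<and> int (card T) = q + 1" "unstar key v T \<noteq> 0"
  then have "int (card (- T)) = q + 1" by (simp add: unstar_def)
  then show "T \<in> UNIV \<and> int (card T) = int CARD('v) - q - 2 + 1" unfolding int_card_Compl by simp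
qed

text \<open>The full simplex is acyclic, so a cycle w of G is the boundary of some u there,
  determined modulo boundaries up to chains of G. What matters of u lives outside G, which is where
  the complements of the faces of K lie; \<open>star\<close> turns it into a cocycle of K. As u sits
  on sets of size j + 2, the complements have size CARD('v) - j - 2, hence dimension CARD('v) - j -
  3.\<close>

lemma alexander:
  fixes key :: "'v::finite \<Rightarrow> nat"
  assumes inj: "inj key" and G: "down_closed G"
  shows "shomology TYPE('k::field) key G j n \<longleftrightarrow> shomology TYPE('k) key {T. - T \<notin> G} (int CARD('v) - j - 3) n"
proof -
  define K where "K = {T. - T \<notin> G}"
  define q where "q = int CARD('v) - j - 3"
  have K: "down_closed K" using G unfolding down_closed_def K_def by (metis (no_types, lifting) Compl_subset_Compl_iff mem_Collect_eq)
  have aU: "acyclic_cx TYPE('k) key (UNIV :: 'v set set)" by (rule acyclic_cx_cone[OF inj]) simp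
  define R :: "('v set \<Rightarrow> 'k) \<Rightarrow> ('v set \<Rightarrow> 'k) \<Rightarrow> bool" where
    "R w v \<longleftrightarrow> w \<in> scycles key G j \<and> (\<exists>u\<in>schains UNIV (j + 1). bd key u = w \<and> v = restrict_to K (star key u))" for w v
  have restrC: "restrict_to K v \<in> schains K p" if "v \<in> schains UNIV p" for v :: "'v set \<Rightarrow> 'k" and p
    using that by (auto simp: restrict_to_def schains_iff split: if_splits)
  have starC: "star key u \<in> schains UNIV q" if "u \<in> schains UNIV (j + 1)" for u :: "'v set \<Rightarrow> 'k"
    using star_schains[OF that] by (simp add: q_def)
  have SZC: "w \<in> schains UNIV j" if "w \<in> scycles key G j" for w :: "'v set \<Rightarrow> 'k"
    using that schains_mono[of G UNIV] by (auto simp: scycles_def)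
  have inK: "- S \<in> K \<longleftrightarrow> S \<notin> G" for S by (simp add: K_def)
  have e1: "int CARD('v) - q - 2 = j + 1" and e2: "int CARD('v) - (q - 1) - 2 = j + 1 + 1"
    and e3: "int CARD('v) - (j + 1 + 1) - 2 = q - 1" by (simp_all add: q_def)
  have star0: "star key w T = 0 \<longleftrightarrow> w (- T) = 0" for w :: "'v set \<Rightarrow> 'k" and T by (simp add: star_def)
  have "quot_dim (fun_scale ((*) :: 'k \<Rightarrow> 'k \<Rightarrow> 'k)) (scycles key G j) (sbounds key G j) n \<longleftrightarrow>
      quot_dim (fun_scale ((*) :: 'k \<Rightarrow> 'k \<Rightarrow> 'k)) (cocycles key K q) (cobounds key K q) n"
  proof (rule quot_dim_transfer[where R = R])
    show "R 0 0" unfolding R_def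
      by (intro conjI bexI[OF _ schains_closed(1)]) (auto simp: scycles_def bd_zero fun_eq_iff restrict_to_def star_def intro: schains_closed)
  next
    fix w v w' v' assume "R w v" "R w' v'"
    then obtain u u' where u: "u \<in> schains UNIV (j + 1)" "bd key u = w" "v = restrict_to K (star key u)" "w \<in> scycles key G j"
      and u': "u' \<in> schains UNIV (j + 1)" "bd key u' = w'" "v' = restrict_to K (star key u')" "w' \<in> scycles key G j"
      unfolding R_def by blast
    show "R (w - w') (v - v')" unfolding R_def
      by (intro conjI bexI[of _ "u - u'"] fvs.subspace_diff[OF subspace_scycles] u u' schains_closed(2))
         (simp_all only: bd_minus u u', auto simp: fun_eq_iff restrict_to_def star_def signed_diff)
  next
    fix r w v assume "R w v"
    then obtain u where u: "u \<in> schains UNIV (j + 1)" "bd key u = w" "v = restrict_to K (star key u)" "w \<in> scycles key G j"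
      unfolding R_def by blast
    show "R (fun_scale (*) r w) (fun_scale (*) r v)" unfolding R_def
      by (intro conjI bexI[of _ "fun_scale (*) r u"] fvs.subspace_scale[OF subspace_scycles] u schains_closed(4))
         (simp_all only: bd_fun_scale u, auto simp: fun_eq_iff restrict_to_def star_def signed_mult)
  next
    fix w :: "'v set \<Rightarrow> 'k" assume w: "w \<in> scycles key G j"
    then have "bd key w = 0" by (simp add: scycles_def)
    then obtain u where "u \<in> schains UNIV (j + 1)" "bd key u = w"
      using acyclic_cxD[OF aU SZC[OF w]] by blast
    then show "\<exists>v. R w v" using w unfolding R_def by blast
  next
    fix v :: "'v set \<Rightarrow> 'k" assume "v \<in> cocycles key K q"
    then have v: "v \<in> schains K q" "\<And>T. T \<in> K \<Longrightarrow> cobd key v T = 0" by (auto simp: cocycles_def)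
    define u where "u = unstar key v"
    have "v \<in> schains UNIV q" using v schains_mono[of K UNIV] by blast
    from unstar_schains[OF this, where key = key] have u: "u \<in> schains UNIV (j + 1)" unfolding u_def e1 .
    have su: "star key u = v" by (simp add: u_def star_unstar)
    \<comment> \<open>A set is outside G exactly when its complement is in K, so the cocycle
      condition on K confines \<open>bd key u\<close> to G.\<close>
    have "bd key u S = 0" if "S \<notin> G" for S
    proof -
      have "star key (bd key u) (- S) = 0"
        unfolding cobd_star[symmetric] su using v(2) that inK by blast
      then show ?thesis by (simp add: star0)
    qed
    moreover have "bd key u \<in> schains UNIV j" by (rule bd_schains[OF _ u]) (simp add: down_closed_def)
    ultimately have "bd key u \<in> schains G j" unfolding schains_iff by blast
    then have "bd key u \<in> scycles key G j" by (simp add: scycles_def bd_bd[OF inj])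
    moreover have "v = restrict_to K (star key u)" using v(1) by (auto simp: su restrict_to_def schains_iff fun_eq_iff)
    ultimately show "\<exists>w. R w v" using u unfolding R_def by blast
  next
    fix w v assume "R w v"
    then obtain u where u: "u \<in> schains UNIV (j + 1)" "bd key u = w" "v = restrict_to K (star key u)" and w: "w \<in> scycles key G j"
      unfolding R_def by blast
    have wG: "w T = 0" if "T \<notin> G" for T using w that by (auto simp: scycles_def schains_iff)
    have vC: "v \<in> schains K q" unfolding u(3) by (rule restrC[OF starC[OF u(1)]])
    have "cobd key v T = 0" if "T \<in> K" for T
    proof -
      have "cobd key v T = star key w T" unfolding u(3) cobd_restrict_to[OF K that] cobd_star u(2) ..
      also have "\<dots> = 0" using wG that by (simp add: star0 K_def)
      finally show ?thesis .
    qed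
    then have v: "v \<in> cocycles key K q" using vC by (simp add: cocycles_def)
    have "w \<in> sbounds key G j \<longleftrightarrow> v \<in> cobounds key K q"
    proof
      assume "w \<in> sbounds key G j"
      then obtain z where z: "z \<in> schains G (j + 1)" "w = bd key z" by (auto simp: sbounds_def)
      have "z \<in> schains UNIV (j + 1)" using z(1) schains_mono[of G UNIV] by blast
      then have "u - z \<in> schains UNIV (j + 1)" by (rule schains_closed(2)[OF u(1)])
      moreover have "bd key (u - z) = 0" unfolding bd_minus u(2) z(2)[symmetric] by simp
      ultimately obtain y where y: "y \<in> schains UNIV (j + 1 + 1)" "bd key y = u - z"
        by (rule acyclic_cxD[OF aU])
      have "v T = cobd key (restrict_to K (star key y)) T" if "T \<in> K" for T
      proof -
        have "z (- T) = 0" using z(1) that by (auto simp: schains_iff K_def)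
        then show ?thesis using that
          unfolding cobd_restrict_to[OF K that] cobd_star y(2) u(3) by (simp add: restrict_to_def star_def)
      qed
      moreover have "restrict_to K (star key y) \<in> schains K (q - 1)"
        using restrC[OF star_schains[OF y(1), where key = key]] unfolding e3 .
      ultimately show "v \<in> cobounds key K q" using vC unfolding cobounds_def by blast
    next
      assume "v \<in> cobounds key K q"
      then obtain y' where y': "y' \<in> schains K (q - 1)" "\<And>T. T \<in> K \<Longrightarrow> v T = cobd key y' T" by (auto simp: cobounds_def)
      define y where "y = unstar key y'"
      have "y' \<in> schains UNIV (q - 1)" using y' schains_mono[of K UNIV] by blast
      from unstar_schains[OF this, where key = key] have y: "y \<in> schains UNIV (j + 1 + 1)" unfolding y_def e2 .
      have "u S = bd key y S" if "S \<notin> G" for S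
      proof -
        have T: "- S \<in> K" using that inK by blast
        have "star key u (- S) = v (- S)" using T by (simp add: u(3) restrict_to_def)
        also have "\<dots> = star key (bd key y) (- S)"
          unfolding cobd_star[symmetric] using y'(2)[OF T] by (simp add: y_def star_unstar)
        finally have "star key (u - bd key y) (- S) = 0" by (simp add: star_def signed_diff)
        then show ?thesis by (simp add: star0)
      qed
      moreover have "u - bd key y \<in> schains UNIV (j + 1)"
        by (intro schains_closed(2) u bd_schains y) (simp add: down_closed_def)
      ultimately have "u - bd key y \<in> schains G (j + 1)" unfolding schains_iff by (metis minus_apply right_minus_eq)
      moreover have "w = bd key (u - bd key y)" unfolding bd_minus bd_bd[OF inj] u(2) by simp
      ultimately show "w \<in> sbounds key G j" unfolding sbounds_def by blast
    qed
    then show "w \<in> scycles key G j \<and> v \<in> cocycles key K q \<and> (w \<in> sbounds key G j \<longleftrightarrow> v \<in> cobounds key K q)"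
      using v w by blast
  qed
  then show ?thesis unfolding cohomology_dim[OF inj K] unfolding shomology_def K_def q_def .
qed

section \<open>Free modules over the polynomial ring\<close>

abbreviation "plookup \<equiv> Poly_Mapping.lookup"
abbreviation "pkeys \<equiv> Poly_Mapping.keys"

lemma poly_mapping_expand:
  "f = (\<Sum>k\<in>pkeys f. Poly_Mapping.single k (plookup f k))"
proof (rule poly_mapping_eqI)
  fix k
  have "plookup (\<Sum>k\<in>pkeys f. Poly_Mapping.single k (plookup f k)) k
      = (\<Sum>k'\<in>pkeys f. if k' = k then plookup f k' else 0)"
    unfolding lookup_sum by (intro sum.cong) (auto simp: lookup_single)
  also have "\<dots> = plookup f k" by (simp add: in_keys_iff)
  finally show "plookup f k = plookup (\<Sum>k\<in>pkeys f. Poly_Mapping.single k (plookup f k)) k" by simp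
qed

lemma lookup_single_times:
  fixes f :: "'e::cancel_comm_monoid_add \<Rightarrow>\<^sub>0 'k::comm_ring_1"
  shows "plookup (Poly_Mapping.single t r * f) k = (\<Sum>e\<in>pkeys f. if t + e = k then r * plookup f e else 0)"
proof -
  have "Poly_Mapping.single t r * f = (\<Sum>e\<in>pkeys f. Poly_Mapping.single (t + e) (r * plookup f e))"
    by (subst (1) poly_mapping_expand) (simp add: sum_distrib_left mult_single)
  then show ?thesis by (simp add: lookup_sum lookup_single when_def)
qed

lemma lookup_single_times_add:
  fixes f :: "'e::cancel_comm_monoid_add \<Rightarrow>\<^sub>0 'k::comm_ring_1"
  shows "plookup (Poly_Mapping.single t r * f) (t + e) = r * plookup f e"
  unfolding lookup_single_times by (simp add: in_keys_iff)

lemma lookup_const_times [simp]: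
  fixes f :: "'e::cancel_comm_monoid_add \<Rightarrow>\<^sub>0 'k::comm_ring_1"
  shows "plookup (Poly_Mapping.single 0 r * f) e = r * plookup f e"
  using lookup_single_times_add[of 0 r f e] by simp

section \<open>Multiplication and division by variables\<close>

definition var :: "'v \<Rightarrow> 'v \<Rightarrow>\<^sub>0 nat" where
  "var v = Poly_Mapping.single v 1"

lemma lookup_var: "plookup (var v) w = (if v = w then 1 else 0)"
  by (simp add: var_def lookup_single)

definition var_mult :: "'v \<Rightarrow> ('v, 'k::field) mpoly \<Rightarrow> ('v, 'k) mpoly" where
  "var_mult v f = Poly_Mapping.single (var v) 1 * f"

lemma minus_var: "plookup e v \<noteq> 0 \<Longrightarrow> e - var v + var v = e"
  by (rule poly_mapping_eqI) (auto simp: lookup_add lookup_minus lookup_var)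

lemma lookup_var_mult: "plookup (var_mult v f) e = (if plookup e v = 0 then 0 else plookup f (e - var v))"
proof (cases "plookup e v = 0")
  case True
  have "var v + e' \<noteq> e" for e'
  proof
    assume "var v + e' = e"
    then have "plookup (var v + e') v = plookup e v" by simp
    then show False using True by (simp add: lookup_add lookup_var)
  qed
  then show ?thesis using True by (simp add: var_mult_def lookup_single_times)
next
  case False
  then show ?thesis
    using lookup_single_times_add[where t = "var v" and r = 1 and f = f and e = "e - var v"] minus_var[OF False]
    by (simp add: var_mult_def add.commute)
qed

definition has_smaller_var :: "('v \<Rightarrow> nat) \<Rightarrow> 'v \<Rightarrow> ('v \<Rightarrow>\<^sub>0 nat) \<Rightarrow> bool" where
  "has_smaller_var key v e \<longleftrightarrow> (\<exists>w. key w < key v \<and> plookup e w \<noteq> 0)"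

text \<open>The test for smaller variables is made on the quotient monomial e; this is the same as
  testing \<open>e + var v\<close>, because v is not smaller than itself.\<close>

definition var_div :: "('v \<Rightarrow> nat) \<Rightarrow> 'v \<Rightarrow> ('v, 'k::field) mpoly \<Rightarrow> ('v, 'k) mpoly" where
  "var_div key v f = Abs_poly_mapping (\<lambda>e. if has_smaller_var key v e then 0 else plookup f (e + var v))"

lemma lookup_var_div: "plookup (var_div key v f) e = (if has_smaller_var key v e then 0 else plookup f (e + var v))"
proof -
  have "{e. (if has_smaller_var key v e then 0 else plookup f (e + var v)) \<noteq> 0} \<subseteq> (\<lambda>e. e - var v) ` pkeys f"
  proof
    fix e assume "e \<in> {e. (if has_smaller_var key v e then 0 else plookup f (e + var v)) \<noteq> 0}"
    then have "e + var v \<in> pkeys f" by (auto simp: in_keys_iff split: if_splits)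
    then show "e \<in> (\<lambda>e. e - var v) ` pkeys f" by (rule rev_image_eqI) simp
  qed
  then have "finite {e. (if has_smaller_var key v e then 0 else plookup f (e + var v)) \<noteq> 0}"
    by (rule finite_subset) simp
  then show ?thesis unfolding var_div_def by simp
qed

text \<open>Among the variables of e that lie in S, exactly the least has no smaller variable of e
  before it, because S is an initial segment. So a single summand survives.\<close>

lemma sum_first:
  fixes key :: "'v::finite \<Rightarrow> nat" and c :: "'k::comm_monoid_add"
  assumes inj: "inj key" and S: "\<And>y z. y \<in> S \<Longrightarrow> key z < key y \<Longrightarrow> z \<in> S"
  shows "(\<Sum>y\<in>S. if plookup e y = 0 \<or> has_smaller_var key y e then 0 else c) = (if \<exists>y\<in>S. plookup e y \<noteq> 0 then c else 0)"
proof (cases "\<exists>y\<in>S. plookup e y \<noteq> 0")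
  case True
  define m where "m = first_var key {y \<in> S. plookup e y \<noteq> 0}"
  have ne: "{y \<in> S. plookup e y \<noteq> 0} \<noteq> {}" using True by blast
  have m: "m \<in> S" "plookup e m \<noteq> 0" "\<And>y. y \<in> S \<Longrightarrow> plookup e y \<noteq> 0 \<Longrightarrow> y \<noteq> m \<Longrightarrow> key m < key y"
    using first_var[OF ne inj] unfolding m_def by blast+
  have "\<not> has_smaller_var key m e" using m S unfolding has_smaller_var_def by (metis less_asym less_irrefl)
  moreover have "has_smaller_var key y e" if "y \<in> S" "plookup e y \<noteq> 0" "y \<noteq> m" for y
    using m that unfolding has_smaller_var_def by blast
  ultimately have "(\<Sum>y\<in>S. if plookup e y = 0 \<or> has_smaller_var key y e then 0 else c) = (\<Sum>y\<in>S. if y = m then c else 0)"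
    using m(2) by (intro sum.cong) auto
  then show ?thesis using True m(1) by simp
next
  case False
  then have "(\<Sum>y\<in>S. if plookup e y = 0 \<or> has_smaller_var key y e then 0 else c) = 0"
    by (intro sum.neutral) auto
  then show ?thesis using False by simp
qed

lemma has_smaller_var_minus_self: "has_smaller_var key v (e - var v) \<longleftrightarrow> has_smaller_var key v e"
  unfolding has_smaller_var_def by (auto simp: lookup_minus lookup_var)

lemma var_mult_var_div: "plookup (var_mult y (var_div key y f)) e = (if plookup e y = 0 \<or> has_smaller_var key y e then 0 else plookup f e)"
  by (auto simp: lookup_var_mult lookup_var_div has_smaller_var_minus_self minus_var)

lemma var_mult_zero [simp]: "var_mult v 0 = 0" and var_div_zero [simp]: "var_div key v 0 = 0"
  by (auto intro!: poly_mapping_eqI simp: lookup_var_mult lookup_var_div)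

definition const_part :: "('v, 'k::field) mpoly \<Rightarrow> ('v, 'k) mpoly" where
  "const_part f = Poly_Mapping.single 0 (plookup f 0)"

lemma lookup_const_part: "plookup (const_part f) e = (if e = 0 then plookup f 0 else 0)"
  by (auto simp: const_part_def lookup_single when_def)

lemma const_part_zero [simp]: "const_part 0 = 0"
  by (simp add: const_part_def)

definition fmult :: "'v \<Rightarrow> ('n, 'v, 'k::field) free_elem \<Rightarrow> ('n, 'v, 'k) free_elem" where
  "fmult v u = pm_scale (Poly_Mapping.single (var v) 1) u"

definition fdiv :: "('v \<Rightarrow> nat) \<Rightarrow> 'v \<Rightarrow> ('n, 'v, 'k::field) free_elem \<Rightarrow> ('n, 'v, 'k) free_elem" where
  "fdiv key v u = Poly_Mapping.map (var_div key v) u"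

definition fconst :: "('n, 'v, 'k::field) free_elem \<Rightarrow> ('n, 'v, 'k) free_elem" where
  "fconst u = Poly_Mapping.map const_part u"

definition fscale :: "'k \<Rightarrow> ('n, 'v, 'k::field) free_elem \<Rightarrow> ('n, 'v, 'k) free_elem" where
  "fscale r u = pm_scale (Poly_Mapping.single 0 r) u"

lemma lookup_map_zero: "f 0 = 0 \<Longrightarrow> plookup (Poly_Mapping.map f u) k = f (plookup u k)"
  by (simp add: Poly_Mapping.map.rep_eq when_def)

lemma lookup_free_ops [simp]:
  "plookup (fmult v u) k = var_mult v (plookup u k)"
  "plookup (fdiv key v u) k = var_div key v (plookup u k)"
  "plookup (fconst u) k = const_part (plookup u k)"
  "plookup (fscale r u) k = Poly_Mapping.single 0 r * plookup u k"
  by (simp_all add: fmult_def fdiv_def fconst_def fscale_def var_mult_def lookup_map_zero)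

lemma free_elem_eqI:
  "(\<And>k e. plookup (plookup u k) e = plookup (plookup w k) e) \<Longrightarrow> u = w"
  by (intro poly_mapping_eqI) auto

lemma additive_free_ops: "Modules.additive (fmult v)" "Modules.additive (fdiv key v)" "Modules.additive fconst" "Modules.additive (fscale r)"
  unfolding Modules.additive_def
  by (auto intro!: free_elem_eqI simp: lookup_add lookup_var_mult lookup_var_div lookup_const_part distrib_left)

lemma graded_ops_free: "graded_ops (fscale :: 'k::field \<Rightarrow> ('n, 'v, 'k) free_elem \<Rightarrow> _) fmult"
proof -
  have "fmult v (fmult w m) = fmult w (fmult v m)" for v w and m :: "('n, 'v, 'k) free_elem"
    by (simp add: fmult_def pm_scale_def, intro poly_mapping_eqI) (simp add: lookup_map_zero ac_simps)
  moreover have "fmult v (fscale r m) = fscale r (fmult v m)" for v r and m :: "('n, 'v, 'k) free_elem"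
    by (intro free_elem_eqI) (simp add: lookup_var_mult)
  ultimately show ?thesis by (simp add: graded_ops_def additive_free_ops)
qed

lemma has_smaller_var_minus:
  assumes "key y \<ge> key x" shows "has_smaller_var key x (e - var y) \<longleftrightarrow> has_smaller_var key x e"
  using assms unfolding has_smaller_var_def by (auto simp: lookup_minus lookup_var)

lemma koszul_contraction_free:
  fixes key :: "'v::finite \<Rightarrow> nat"
  assumes inj: "inj key"
  shows "koszul_contraction key (fscale :: 'k::field \<Rightarrow> ('n, 'v, 'k) free_elem \<Rightarrow> _) fmult (fdiv key) fconst"
proof (rule koszul_contraction.intro)
  show "inj key" by fact
  show "graded_ops fscale (fmult :: 'v \<Rightarrow> ('n, 'v, 'k) free_elem \<Rightarrow> _)" by (rule graded_ops_free)
  fix x y and m :: "('n, 'v, 'k) free_elem"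
  show "Modules.additive (fdiv key x :: ('n, 'v, 'k) free_elem \<Rightarrow> _)" by (rule additive_free_ops)
  show "fdiv key x (fmult y m) = fmult y (fdiv key x m)" if "key x < key y"
  proof (intro free_elem_eqI)
    fix k e
    have xy: "x \<noteq> y" using that by auto
    have "e + var x - var y = e - var y + var x" if "plookup e y \<noteq> 0"
      by (rule poly_mapping_eqI) (use that xy in \<open>auto simp: lookup_add lookup_minus lookup_var\<close>)
    then show "plookup (plookup (fdiv key x (fmult y m)) k) e = plookup (plookup (fmult y (fdiv key x m)) k) e"
      using that xy by (auto simp: lookup_var_mult lookup_var_div lookup_add lookup_var has_smaller_var_minus)
  qed
  show "fdiv key x (fmult y m) = 0" if "key y < key x"
    by (intro free_elem_eqI) (use that in \<open>auto simp: lookup_var_mult lookup_var_div lookup_add lookup_var has_smaller_var_def\<close>)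
  have sums: "plookup (plookup (\<Sum>y\<in>S. fmult y (fdiv key y m)) k) e
      = (\<Sum>y\<in>S. if plookup e y = 0 \<or> has_smaller_var key y e then 0 else plookup (plookup m k) e)" for S k e
    by (simp add: lookup_sum var_mult_var_div)
  show "fdiv key x (fmult x m) = m - (\<Sum>y | key y < key x. fmult y (fdiv key y m))"
  proof (intro free_elem_eqI)
    fix k e
    have "(\<exists>y\<in>{y. key y < key x}. plookup e y \<noteq> 0) \<longleftrightarrow> has_smaller_var key x e" by (auto simp: has_smaller_var_def)
    moreover have "plookup (plookup (\<Sum>y | key y < key x. fmult y (fdiv key y m)) k) e
      = (if \<exists>y\<in>{y. key y < key x}. plookup e y \<noteq> 0 then plookup (plookup m k) e else 0)"
      unfolding sums by (rule sum_first[OF inj]) auto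
    ultimately show "plookup (plookup (fdiv key x (fmult x m)) k) e
        = plookup (plookup (m - (\<Sum>y | key y < key x. fmult y (fdiv key y m))) k) e"
      by (simp add: lookup_minus lookup_var_div lookup_var_mult lookup_add lookup_var)
  qed
  show "m = fconst m + (\<Sum>y\<in>UNIV. fmult y (fdiv key y m))"
  proof (intro free_elem_eqI)
    fix k e
    have "plookup (plookup (\<Sum>y\<in>UNIV. fmult y (fdiv key y m)) k) e
      = (if \<exists>y\<in>UNIV. plookup e y \<noteq> 0 then plookup (plookup m k) e else 0)"
      unfolding sums by (rule sum_first[OF inj]) auto
    moreover have "(\<exists>y\<in>UNIV. plookup e y \<noteq> 0) \<longleftrightarrow> e \<noteq> 0"
      by (auto simp: poly_mapping_eq_iff fun_eq_iff)
    ultimately show "plookup (plookup m k) e = plookup (plookup (fconst m + (\<Sum>y\<in>UNIV. fmult y (fdiv key y m))) k) e"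
      by (simp add: lookup_add lookup_const_part)
  qed
qed

section \<open>The multigrading of the polynomial ring and of free modules\<close>

lemma mdeg_zero [simp]: "mdeg a 0 = 0"
  by (simp add: mdeg_def)

lemma mdeg_add: "mdeg a (e + e') = mdeg a e + mdeg a e'"
  by (simp add: mdeg_def lookup_add algebra_simps sum.distrib vec_eq_iff)

lemma mdeg_var [simp]: "mdeg a (var v) = a v"
proof -
  have "mdeg a (var v) = (\<Sum>w\<in>UNIV. if w = v then a w else 0)"
    unfolding mdeg_def by (intro sum.cong) (auto simp: lookup_var vec_eq_iff)
  then show ?thesis by simp
qed

definition fgraded :: "('v::finite \<Rightarrow> int ^ 'n) \<Rightarrow> (int ^ 'n \<Rightarrow> nat) \<Rightarrow> int ^ 'n \<Rightarrow> ('n, 'v, 'k::field) free_elem set" where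
  "fgraded a m c = {u \<in> free_module m. free_homogeneous a c u}"

lemma free_module_iff: "u \<in> free_module m \<longleftrightarrow> (\<forall>b j. plookup u (b, j) \<noteq> 0 \<longrightarrow> j < m b)"
  by (auto simp: free_module_def in_keys_iff)

lemma free_homogeneous_iff:
  "free_homogeneous a c u \<longleftrightarrow> (\<forall>b j e. plookup (plookup u (b, j)) e \<noteq> 0 \<longrightarrow> mdeg a e + b = c)"
proof -
  have *: "plookup u (b, j) \<noteq> 0" if "plookup (plookup u (b, j)) e \<noteq> 0" for b j e
    using that by auto
  have "mdeg a e = c - b \<longleftrightarrow> mdeg a e + b = c" for e b by (simp add: eq_diff_eq)
  then show ?thesis
    unfolding free_homogeneous_def mhomogeneous_def Ball_def split_paired_All prod.case in_keys_iff
    using * by blast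
qed

lemma fgraded_iff:
  "u \<in> fgraded a m c \<longleftrightarrow> (\<forall>b j e. plookup (plookup u (b, j)) e \<noteq> 0 \<longrightarrow> j < m b \<and> mdeg a e + b = c)"
proof -
  have "plookup u (b, j) \<noteq> 0 \<longleftrightarrow> (\<exists>e. plookup (plookup u (b, j)) e \<noteq> 0)" for b j
    by (auto simp: poly_mapping_eq_iff fun_eq_iff)
  then show ?thesis unfolding fgraded_def free_module_iff free_homogeneous_iff by blast
qed

lemma graded_mod_fgraded: "graded_mod a fscale fmult (fgraded a m)"
  unfolding graded_mod_def
proof (intro conjI allI ballI)
  fix c v and u w :: "('b, 'a, 'c) free_elem" and r
  show "0 \<in> fgraded a m c" by (simp add: fgraded_iff)
  assume u: "u \<in> fgraded a m c"
  show "fscale r u \<in> fgraded a m c" using u unfolding fgraded_iff by auto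
  show "u - w \<in> fgraded a m c" if "w \<in> fgraded a m c"
    using u that unfolding fgraded_iff by (auto simp: lookup_minus) (metis right_minus_eq)+
  show "fmult v u \<in> fgraded a m (c + a v)"
    unfolding fgraded_iff
  proof (intro allI impI)
    fix b j e assume "plookup (plookup (fmult v u) (b, j)) e \<noteq> 0"
    then have e: "plookup e v \<noteq> 0" "plookup (plookup u (b, j)) (e - var v) \<noteq> 0"
      by (auto simp: lookup_var_mult split: if_splits)
    then have "j < m b" "mdeg a (e - var v) + b = c" using u by (auto simp: fgraded_iff)
    moreover have "mdeg a e = mdeg a (e - var v) + a v"
      using mdeg_add[of a "e - var v" "var v"] by (simp add: minus_var[OF e(1)])
    ultimately show "j < m b \<and> mdeg a e + b = c + a v" by (simp add: algebra_simps)
  qed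
qed

lemma fdiv_fgraded:
  assumes "u \<in> fgraded a m c" shows "fdiv key v u \<in> fgraded a m (c - a v)"
  unfolding fgraded_iff
proof (intro allI impI)
  fix b j e assume "plookup (plookup (fdiv key v u) (b, j)) e \<noteq> 0"
  then have "plookup (plookup u (b, j)) (e + var v) \<noteq> 0" by (auto simp: lookup_var_div split: if_splits)
  then have "j < m b" "mdeg a (e + var v) + b = c" using assms by (auto simp: fgraded_iff)
  then show "j < m b \<and> mdeg a e + b = c - a v" by (simp add: mdeg_add algebra_simps)
qed

definition fgen :: "int ^ 'n \<Rightarrow> nat \<Rightarrow> ('n, 'v, 'k::field) free_elem" where
  "fgen c j = Poly_Mapping.single (c, j) 1"

text \<open>The constant coefficients of an element of degree c sit on generators of degree exactly
  c, and \<open>fconst\<close> kills both M and the multiples of variables. This is where a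
  multiplicity in a resolution becomes a homology dimension.\<close>

lemma khomology_0_free:
  fixes a :: "'v::finite \<Rightarrow> int ^ 'n" and M :: "int ^ 'n \<Rightarrow> ('n, 'v, 'k::field) free_elem set"
  assumes inj: "inj key" and M: "graded_mod a fscale fmult M" and \<rho>: "\<And>c w. w \<in> M c \<Longrightarrow> fconst w = 0"
  shows "khomology fscale key a fmult (fgraded a m) M 0 c (m c)"
proof -
  interpret koszul_contraction key a "fscale :: 'k \<Rightarrow> ('n, 'v, 'k) free_elem \<Rightarrow> _" fmult "fdiv key" fconst
    by (rule koszul_contraction_free[OF inj])
  define g :: "nat \<Rightarrow> ('n, 'v, 'k) free_elem" where "g = fgen c"
  have L: "plookup (plookup (\<Sum>j<m c. fscale (l j) (g j)) (b, i)) e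
      = (if b = c \<and> e = 0 \<and> i < m c then l i else 0)" for l and b :: "int ^ 'n" and i :: nat and e :: "'v \<Rightarrow>\<^sub>0 nat"
  proof -
    have "plookup (plookup (fscale (l j) (g j)) (b, i)) e = (if j = i then (if b = c \<and> e = 0 then l i else 0) else 0)" for j
      by (auto simp: g_def fgen_def lookup_single when_def lookup_one)
    then show ?thesis by (simp add: lookup_sum)
  qed
  show ?thesis
  proof (rule khomology_0[OF graded_mod_fgraded M fdiv_fgraded \<rho> additive_free_ops(3), where g = g])
    show "fconst (fmult v w) = 0" for v and w :: "('n, 'v, 'k) free_elem"
      by (intro free_elem_eqI) (simp add: lookup_const_part lookup_var_mult)
    show "g j \<in> fgraded a m c" if "j < m c" for j
      using that by (auto simp: fgraded_iff g_def fgen_def lookup_single when_def lookup_one split: if_splits)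
    show "\<exists>l. fconst w = (\<Sum>j<m c. fscale (l j) (g j))" if "w \<in> fgraded a m c" for w :: "('n, 'v, 'k) free_elem"
    proof (intro exI free_elem_eqI)
      fix k :: "(int ^ 'n) \<times> nat" and e :: "'v \<Rightarrow>\<^sub>0 nat"
      obtain b i where k: "k = (b, i)" by (cases k)
      have "plookup (plookup w (b, i)) 0 \<noteq> 0 \<Longrightarrow> b = c \<and> i < m c"
        using that by (fastforce simp: fgraded_iff)
      then show "plookup (plookup (fconst w) k) e
          = plookup (plookup (\<Sum>j<m c. fscale (plookup (plookup w (c, j)) 0) (g j)) k) e"
        unfolding k L by (auto simp: lookup_const_part)
    qed
    show "fconst (\<Sum>j<m c. fscale (l j) (g j)) = (\<Sum>j<m c. fscale (l j) (g j))" for l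
    proof (intro free_elem_eqI)
      fix k :: "(int ^ 'n) \<times> nat" and e :: "'v \<Rightarrow>\<^sub>0 nat"
      obtain b i where k: "k = (b, i)" by (cases k)
      show "plookup (plookup (fconst (\<Sum>j<m c. fscale (l j) (g j))) k) e
          = plookup (plookup (\<Sum>j<m c. fscale (l j) (g j)) k) e"
        unfolding k lookup_free_ops lookup_const_part L by simp
    qed
    show "l j = 0" if "(\<Sum>j<m c. fscale (l j) (g j)) = 0" "j < m c" for l j
    proof -
      have "plookup (plookup 0 (c, j)) 0 = (if j < m c then l j else 0)"
        using L[of l c j 0] unfolding that(1) by simp
      then show ?thesis using that(2) by simp
    qed
  qed
qed

section \<open>Homogeneous components and the toric ideal\<close>

definition hom_part :: "('v::finite \<Rightarrow> int ^ 'n) \<Rightarrow> int ^ 'n \<Rightarrow> ('v, 'k::field) mpoly \<Rightarrow> ('v, 'k) mpoly" where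
  "hom_part a c f = Poly_Mapping.mapp (\<lambda>e r. if mdeg a e = c then r else 0) f"

lemma lookup_hom_part: "plookup (hom_part a c f) e = (if mdeg a e = c then plookup f e else 0)"
  by (auto simp: hom_part_def lookup_mapp when_def in_keys_iff)

definition fhom_part :: "('v::finite \<Rightarrow> int ^ 'n) \<Rightarrow> int ^ 'n \<Rightarrow> ('n, 'v, 'k::field) free_elem \<Rightarrow> ('n, 'v, 'k) free_elem" where
  "fhom_part a c u = Poly_Mapping.mapp (\<lambda>(b, j). hom_part a (c - b)) u"

lemma hom_part_zero [simp]: "hom_part a c 0 = 0"
  by (rule poly_mapping_eqI) (simp add: lookup_hom_part)

lemma lookup_fhom_part: "plookup (fhom_part a c u) (b, j) = hom_part a (c - b) (plookup u (b, j))"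
  by (auto simp: fhom_part_def lookup_mapp when_def in_keys_iff)

lemma lookup_lookup_fhom_part:
  "plookup (plookup (fhom_part a c u) (b, j)) e = (if mdeg a e + b = c then plookup (plookup u (b, j)) e else 0)"
  by (auto simp: lookup_fhom_part lookup_hom_part eq_diff_eq)

lemma free_elem_eqI':
  "(\<And>b j e. plookup (plookup u (b, j)) e = plookup (plookup w (b, j)) e) \<Longrightarrow> u = w"
  by (rule free_elem_eqI) (metis surj_pair)

text \<open>Projections to homogeneous components. The polynomial ring and the free modules over it
  are both instances, so maps between them can be treated uniformly.\<close>

locale grading =
  fixes pc :: "'g \<Rightarrow> 'm::ab_group_add \<Rightarrow> 'm"
  assumes additive_pc: "Modules.additive (pc c)" and finite_pc: "finite {c. pc c m \<noteq> 0}"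
    and sum_pc: "m = (\<Sum>c | pc c m \<noteq> 0. pc c m)"
    and pc_pc: "pc c (pc b m) = (if b = c then pc c m else 0)"

text \<open>Expand m into its components: f preserves the degree of each, so q c retains only the
  image of the one of degree c.\<close>

lemma grading_commute:
  assumes "grading p" "grading q" and f: "Modules.additive f"
    and deg: "\<And>b. q b (f (p b m)) = f (p b m)"
  shows "q c (f m) = f (p c m)"
proof -
  interpret p: grading p by fact
  interpret q: grading q by fact
  let ?S = "{c. p c m \<noteq> 0}"
  have f0: "f 0 = 0" "q c 0 = 0" by (rule additive.zero[OF f], rule additive.zero[OF q.additive_pc])
  have "q c (f m) = q c (f (\<Sum>b\<in>?S. p b m))" using p.sum_pc[of m] by simp
  also have "\<dots> = (\<Sum>b\<in>?S. q c (f (p b m)))"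
    by (simp add: additive.sum[OF f] additive.sum[OF q.additive_pc])
  also have "\<dots> = (\<Sum>b\<in>?S. if b = c then f (p c m) else 0)"
  proof (rule sum.cong[OF refl])
    fix b
    show "q c (f (p b m)) = (if b = c then f (p c m) else 0)"
      using q.pc_pc[of c b "f (p b m)"] deg by auto
  qed
  also have "\<dots> = f (p c m)" using p.finite_pc[of m] f0 by auto
  finally show ?thesis .
qed

lemma grading_hom_part:
  fixes a :: "'v::finite \<Rightarrow> int ^ 'n"
  shows "grading (hom_part a :: _ \<Rightarrow> ('v, 'k::field) mpoly \<Rightarrow> _)"
proof (rule grading.intro)
  fix c b :: "int ^ 'n" and f :: "('v, 'k) mpoly"
  show "Modules.additive (hom_part a c :: ('v, 'k) mpoly \<Rightarrow> _)"
    unfolding Modules.additive_def by (auto intro!: poly_mapping_eqI simp: lookup_hom_part lookup_add)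
  have sub: "{c. hom_part a c f \<noteq> 0} \<subseteq> mdeg a ` pkeys f"
  proof
    fix c assume "c \<in> {c. hom_part a c f \<noteq> 0}"
    then obtain e where "plookup (hom_part a c f) e \<noteq> 0" using poly_mapping_eqI[of "hom_part a c f" 0] by auto
    then show "c \<in> mdeg a ` pkeys f" by (auto simp: lookup_hom_part in_keys_iff split: if_splits)
  qed
  then show fin: "finite {c. hom_part a c f \<noteq> 0}" by (rule finite_subset) simp
  show "f = (\<Sum>c | hom_part a c f \<noteq> 0. hom_part a c f)"
  proof (rule poly_mapping_eqI)
    fix e
    have "hom_part a (mdeg a e) f = 0 \<Longrightarrow> plookup f e = 0"
      using lookup_hom_part[of a "mdeg a e" f e] by simp
    then show "plookup f e = plookup (\<Sum>c | hom_part a c f \<noteq> 0. hom_part a c f) e"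
      unfolding lookup_sum lookup_hom_part using fin by (auto simp: sum.delta')
  qed
  show "hom_part a c (hom_part a b f) = (if b = c then hom_part a c f else 0)"
    by (auto intro!: poly_mapping_eqI simp: lookup_hom_part)
qed

lemma grading_fhom_part:
  fixes a :: "'v::finite \<Rightarrow> int ^ 'n"
  shows "grading (fhom_part a :: _ \<Rightarrow> ('n, 'v, 'k::field) free_elem \<Rightarrow> _)"
proof (rule grading.intro)
  fix c b :: "int ^ 'n" and u :: "('n, 'v, 'k) free_elem"
  show "Modules.additive (fhom_part a c :: ('n, 'v, 'k) free_elem \<Rightarrow> _)"
    unfolding Modules.additive_def by (auto intro!: free_elem_eqI' simp: lookup_lookup_fhom_part lookup_add)
  have sub: "{c. fhom_part a c u \<noteq> 0} \<subseteq> (\<Union>(b, j)\<in>pkeys u. (\<lambda>e. mdeg a e + b) ` pkeys (plookup u (b, j)))"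
  proof
    fix c assume "c \<in> {c. fhom_part a c u \<noteq> 0}"
    then obtain b j e where "plookup (plookup (fhom_part a c u) (b, j)) e \<noteq> 0"
      using free_elem_eqI'[of "fhom_part a c u" 0] by auto
    then have "mdeg a e + b = c" "plookup (plookup u (b, j)) e \<noteq> 0" by (auto simp: lookup_lookup_fhom_part split: if_splits)
    moreover have "(b, j) \<in> pkeys u" using calculation(2) by (auto simp: in_keys_iff)
    ultimately show "c \<in> (\<Union>(b, j)\<in>pkeys u. (\<lambda>e. mdeg a e + b) ` pkeys (plookup u (b, j)))"
      by (auto simp: in_keys_iff intro!: bexI[of _ "(b, j)"] image_eqI[of _ _ e])
  qed
  then show fin: "finite {c. fhom_part a c u \<noteq> 0}" by (rule finite_subset) auto
  show "u = (\<Sum>c | fhom_part a c u \<noteq> 0. fhom_part a c u)"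
  proof (rule free_elem_eqI')
    fix b j e
    have "fhom_part a (mdeg a e + b) u = 0 \<Longrightarrow> plookup (plookup u (b, j)) e = 0"
      using lookup_lookup_fhom_part[of a "mdeg a e + b" u b j e] by simp
    then show "plookup (plookup u (b, j)) e = plookup (plookup (\<Sum>c | fhom_part a c u \<noteq> 0. fhom_part a c u) (b, j)) e"
      unfolding lookup_sum lookup_lookup_fhom_part using fin by (auto simp: sum.delta')
  qed
  show "fhom_part a c (fhom_part a b u) = (if b = c then fhom_part a c u else 0)"
    by (auto intro!: free_elem_eqI' simp: lookup_lookup_fhom_part)
qed

lemma fgraded_iff_fhom_part: "u \<in> fgraded a m c \<longleftrightarrow> u \<in> free_module m \<and> fhom_part a c u = u"
proof -
  have "free_homogeneous a c u \<longleftrightarrow> fhom_part a c u = u"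
  proof
    show "fhom_part a c u = u" if "free_homogeneous a c u"
      using that unfolding free_homogeneous_iff by (intro free_elem_eqI') (auto simp: lookup_lookup_fhom_part)
    show "free_homogeneous a c u" if "fhom_part a c u = u"
      unfolding free_homogeneous_iff using that lookup_lookup_fhom_part[of a c u] by metis
  qed
  then show ?thesis by (simp add: fgraded_def)
qed

lemma mhomogeneous_iff: "mhomogeneous a c f \<longleftrightarrow> hom_part a c f = f"
proof
  show "hom_part a c f = f" if "mhomogeneous a c f"
    using that by (intro poly_mapping_eqI) (auto simp: lookup_hom_part mhomogeneous_def in_keys_iff)
  show "mhomogeneous a c f" if "hom_part a c f = f"
    unfolding mhomogeneous_def
  proof
    fix e assume "e \<in> pkeys f"
    then have "plookup (hom_part a c f) e \<noteq> 0" using that by (simp add: in_keys_iff)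
    then show "mdeg a e = c" by (auto simp: lookup_hom_part split: if_splits)
  qed
qed

lemma fhom_part_free_module: "u \<in> free_module m \<Longrightarrow> fhom_part a c u \<in> free_module m"
  by (auto simp: free_module_iff lookup_fhom_part) (metis hom_part_zero)

lemma fhom_part_fgraded: "u \<in> free_module m \<Longrightarrow> fhom_part a c u \<in> fgraded a m c"
  unfolding fgraded_iff_fhom_part grading.pc_pc[OF grading_fhom_part] by (simp add: fhom_part_free_module)

text \<open>Evaluation with all variables set to 1. Multiplication by a variable becomes the
  identity under it, which is why it identifies graded pieces of R with the field.\<close>

definition coeff_sum :: "('e \<Rightarrow>\<^sub>0 'k::comm_ring_1) \<Rightarrow> 'k" where
  "coeff_sum f = (\<Sum>e\<in>pkeys f. plookup f e)"

lemma coeff_sum_superset: "finite E \<Longrightarrow> pkeys f \<subseteq> E \<Longrightarrow> coeff_sum f = (\<Sum>e\<in>E. plookup f e)"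
  unfolding coeff_sum_def by (rule sum.mono_neutral_left) (auto simp: in_keys_iff)

lemma additive_coeff_sum: "Modules.additive coeff_sum"
proof
  fix f g :: "'a \<Rightarrow>\<^sub>0 'b"
  have "coeff_sum (f + g) = (\<Sum>e\<in>pkeys f \<union> pkeys g. plookup (f + g) e)"
    by (rule coeff_sum_superset) (use keys_add[of f g] in auto)
  also have "\<dots> = (\<Sum>e\<in>pkeys f \<union> pkeys g. plookup f e) + (\<Sum>e\<in>pkeys f \<union> pkeys g. plookup g e)"
    by (simp add: lookup_add sum.distrib)
  also have "\<dots> = coeff_sum f + coeff_sum g" by (subst (1 2) coeff_sum_superset[symmetric]) auto
  finally show "coeff_sum (f + g) = coeff_sum f + coeff_sum g" .
qed

lemma coeff_sum_single [simp]: "coeff_sum (Poly_Mapping.single e r) = r"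
  by (simp add: coeff_sum_def)

lemma coeff_sum_single_times:
  fixes f :: "'e::cancel_comm_monoid_add \<Rightarrow>\<^sub>0 'k::comm_ring_1"
  shows "coeff_sum (Poly_Mapping.single t r * f) = r * coeff_sum f"
proof -
  have "Poly_Mapping.single t r * f = (\<Sum>e\<in>pkeys f. Poly_Mapping.single (t + e) (r * plookup f e))"
    by (subst (1) poly_mapping_expand) (simp add: sum_distrib_left mult_single)
  then show ?thesis by (simp add: additive.sum[OF additive_coeff_sum] sum_distrib_left coeff_sum_def[of f])
qed

lemma coeff_sum_hom_part: "coeff_sum (hom_part a c f) = (\<Sum>e | e \<in> pkeys f \<and> mdeg a e = c. plookup f e)"
proof -
  have "pkeys (hom_part a c f) = {e \<in> pkeys f. mdeg a e = c}"
    by (auto simp: in_keys_iff lookup_hom_part split: if_splits)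
  then show ?thesis unfolding coeff_sum_def by (intro sum.cong) (auto simp: lookup_hom_part)
qed

lemma hom_part_single_times:
  "hom_part a c (Poly_Mapping.single t r * f) = Poly_Mapping.single t r * hom_part a (c - mdeg a t) f"
proof (rule poly_mapping_eqI)
  fix k
  have k: "pkeys (hom_part a (c - mdeg a t) f) = {e \<in> pkeys f. mdeg a t + mdeg a e = c}"
    by (auto simp: in_keys_iff lookup_hom_part algebra_simps split: if_splits)
  have "plookup (Poly_Mapping.single t r * hom_part a (c - mdeg a t) f) k
      = (\<Sum>e | e \<in> pkeys f \<and> mdeg a t + mdeg a e = c. if t + e = k then r * plookup f e else 0)"
    unfolding lookup_single_times k by (intro sum.cong) (auto simp: lookup_hom_part algebra_simps)
  also have "\<dots> = (\<Sum>e\<in>pkeys f. if mdeg a t + mdeg a e = c then (if t + e = k then r * plookup f e else 0) else 0)"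
    by (simp add: sum.inter_filter)
  also have "\<dots> = (if mdeg a k = c then plookup (Poly_Mapping.single t r * f) k else 0)"
    unfolding lookup_single_times by (auto simp: mdeg_add intro!: sum.cong sum.neutral)
  finally show "plookup (hom_part a c (Poly_Mapping.single t r * f)) k
      = plookup (Poly_Mapping.single t r * hom_part a (c - mdeg a t) f) k" by (simp add: lookup_hom_part)
qed

section \<open>Monomials in the target ring and membership in the toric ideal\<close>

definition nvec :: "int ^ 'n \<Rightarrow> 'n \<Rightarrow>\<^sub>0 nat" where
  "nvec b = Abs_poly_mapping (\<lambda>j. nat (b $ j))"

lemma lookup_nvec [simp]: "plookup (nvec b) j = nat (b $ j)"
  unfolding nvec_def by simp

lemma nvec_add: "0 \<le> b \<Longrightarrow> 0 \<le> c \<Longrightarrow> nvec (b + c) = nvec b + nvec c"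
  by (rule poly_mapping_eqI) (simp add: lookup_add less_eq_vec_def nat_add_distrib)

lemma nvec_inj: "0 \<le> b \<Longrightarrow> 0 \<le> c \<Longrightarrow> nvec b = nvec c \<Longrightarrow> b = c"
  unfolding vec_eq_iff less_eq_vec_def by (metis eq_nat_nat_iff lookup_nvec zero_index)

lemma nvec_zero [simp]: "nvec 0 = 0"
  by (rule poly_mapping_eqI) simp

lemma scale_nonneg: "0 \<le> (b :: int ^ 'n) \<Longrightarrow> 0 \<le> of_nat k *s b"
  by (simp add: less_eq_vec_def)

lemma monomial_power: "0 \<le> b \<Longrightarrow> monomial b ^ k = Poly_Mapping.single (nvec (of_nat k *s b)) (1::'k::field)"
proof (induction k)
  case 0
  then show ?case by (simp add: vector_smult_lzero)
next
  case (Suc k)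
  have "of_nat (Suc k) *s b = b + of_nat k *s b" by (simp add: vec_eq_iff algebra_simps)
  then have "nvec (of_nat (Suc k) *s b) = nvec b + nvec (of_nat k *s b)"
    using nvec_add[OF Suc.prems scale_nonneg[OF Suc.prems, of k]] by simp
  then show ?case using Suc by (simp add: monomial_def nvec_def[symmetric] mult_single)
qed

lemma vec_sum_nonneg:
  assumes "\<And>i. i \<in> I \<Longrightarrow> 0 \<le> (f i :: int ^ 'n)" shows "0 \<le> sum f I"
  using assms unfolding less_eq_vec_def by (auto intro!: sum_nonneg)

lemma mdeg_nonneg: "(\<And>v. 0 \<le> a v) \<Longrightarrow> 0 \<le> mdeg a e"
  unfolding mdeg_def by (intro vec_sum_nonneg scale_nonneg) auto

lemma prod_monomial:
  fixes a :: "'v::finite \<Rightarrow> int ^ 'n"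
  assumes a: "\<And>v. 0 \<le> a v"
  shows "(\<Prod>v\<in>UNIV. monomial (a v) ^ plookup e v) = Poly_Mapping.single (nvec (mdeg a e)) (1::'k::field)"
proof -
  have "(\<Prod>v\<in>V. monomial (a v) ^ plookup e v)
      = Poly_Mapping.single (nvec (\<Sum>v\<in>V. of_nat (plookup e v) *s a v)) (1::'k)" if "finite V" for V
    using that
  proof (induction V)
    case empty
    then show ?case by simp
  next
    case (insert v V)
    have "0 \<le> (\<Sum>v\<in>V. of_nat (plookup e v) *s a v)" by (intro vec_sum_nonneg scale_nonneg a)
    then show ?case using insert
      by (simp add: monomial_power[OF a] nvec_add scale_nonneg[OF a] mult_single)
  qed
  then show ?thesis by (simp add: mdeg_def)
qed

text \<open>The toric map sends every monomial of degree c to the same monomial Y^c, and distinct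
  nonnegative degrees to distinct monomials. The coefficient of Y^c in the image is thus the
  coefficient sum of the component of degree c.\<close>

lemma toric_ideal_iff:
  fixes a :: "'v::finite \<Rightarrow> int ^ 'n" and f :: "('v, 'k::field) mpoly"
  assumes a: "\<And>v. 0 \<le> a v"
  shows "f \<in> toric_ideal a \<longleftrightarrow> (\<forall>c. coeff_sum (hom_part a c f) = 0)"
proof -
  have md: "0 \<le> mdeg a e" for e by (rule mdeg_nonneg) (rule a)
  have "toric_map a f = (\<Sum>e\<in>pkeys f. Poly_Mapping.single (nvec (mdeg a e)) (plookup f e))"
    unfolding toric_map_def prod_monomial[OF a] by (simp add: mult_single)
  then have L: "plookup (toric_map a f) t = (\<Sum>e | e \<in> pkeys f \<and> nvec (mdeg a e) = t. plookup f e)" for t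
    by (simp add: lookup_sum lookup_single when_def sum.inter_filter)
  show ?thesis
  proof
    assume "f \<in> toric_ideal a"
    then have 0: "toric_map a f = 0" by (simp add: toric_ideal_def)
    show "\<forall>c. coeff_sum (hom_part a c f) = 0"
    proof
      fix c
      show "coeff_sum (hom_part a c f) = 0"
      \<comment> \<open>\<open>nvec\<close> truncates negative entries and is injective on
        nonnegative vectors only; in any other degree there are no monomials at all.\<close>
      proof (cases "0 \<le> c")
        case True
        then have "nvec (mdeg a e) = nvec c \<longleftrightarrow> mdeg a e = c" for e
          using nvec_inj[OF md True] by blast
        then have "coeff_sum (hom_part a c f) = plookup (toric_map a f) (nvec c)" unfolding L coeff_sum_hom_part by simp
        then show ?thesis by (simp add: 0)
      next
        case False
        then have "{e. e \<in> pkeys f \<and> mdeg a e = c} = {}" using md by blast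
        then show ?thesis unfolding coeff_sum_hom_part by (simp only: sum.empty)
      qed
    qed
  next
    assume 0: "\<forall>c. coeff_sum (hom_part a c f) = 0"
    have "toric_map a f = 0"
    proof (rule poly_mapping_eqI)
      fix t :: "'n \<Rightarrow>\<^sub>0 nat"
      define c :: "int ^ 'n" where "c = (\<chi> j. int (plookup t j))"
      have c: "0 \<le> c" "nvec c = t"
        by (auto simp: c_def less_eq_vec_def intro!: poly_mapping_eqI)
      have "nvec (mdeg a e) = t \<longleftrightarrow> mdeg a e = c" for e
        unfolding c(2)[symmetric] using nvec_inj[OF md c(1)] by blast
      then have "plookup (toric_map a f) t = coeff_sum (hom_part a c f)" unfolding L coeff_sum_hom_part by simp
      then show "plookup (toric_map a f) t = plookup 0 t" using 0 by simp
    qed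
    then show "f \<in> toric_ideal a" by (simp add: toric_ideal_def)
  qed
qed

lemma toric_ideal_closed:
  fixes a :: "'v::finite \<Rightarrow> int ^ 'n" and f g :: "('v, 'k::field) mpoly"
  assumes a: "\<And>v. 0 \<le> a v"
  shows "0 \<in> toric_ideal a" "f \<in> toric_ideal a \<Longrightarrow> g \<in> toric_ideal a \<Longrightarrow> f - g \<in> toric_ideal a"
    "f \<in> toric_ideal a \<Longrightarrow> g * f \<in> toric_ideal a"
proof -
  have ah: "Modules.additive (hom_part a c :: ('v, 'k) mpoly \<Rightarrow> _)" for c by (rule grading.additive_pc[OF grading_hom_part])
  have 0: "coeff_sum 0 = 0" by (rule additive.zero[OF additive_coeff_sum])
  show "0 \<in> toric_ideal a" by (simp add: toric_ideal_iff[OF a] 0)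
  show "f - g \<in> toric_ideal a" if "f \<in> toric_ideal a" "g \<in> toric_ideal a"
    using that by (simp add: toric_ideal_iff[OF a] additive.diff[OF ah] additive.diff[OF additive_coeff_sum])
  show "g * f \<in> toric_ideal a" if f: "f \<in> toric_ideal a"
  proof -
    have "coeff_sum (hom_part a c (g * f)) = 0" for c
    proof -
      have "g * f = (\<Sum>t\<in>pkeys g. Poly_Mapping.single t (plookup g t) * f)"
        by (subst (1) poly_mapping_expand[of g]) (simp add: sum_distrib_right)
      then show ?thesis using f
        by (simp add: additive.sum[OF ah] additive.sum[OF additive_coeff_sum] hom_part_single_times coeff_sum_single_times toric_ideal_iff[OF a])
    qed
    then show ?thesis by (simp add: toric_ideal_iff[OF a])
  qed
qed

section \<open>Dimension shifting and the Koszul complex of R\<close>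

lemma module_hom_additive: "module_hom s t f \<Longrightarrow> Modules.additive f"
  by (simp add: Modules.additive_def module_hom.add)

text \<open>Two moves: \<open>shift\<close> replaces F / N in degree p + 1 by N in degree p, and
  \<open>khomology_cover\<close> replaces N by the quotient of the next free module by the kernel of
  d, which is the same module up to isomorphism.\<close>

lemma tor_step:
  fixes d :: "('n::finite, 'v::finite, 'k::field) free_elem \<Rightarrow> ('n, 'v, 'k) free_elem" and a :: "'v \<Rightarrow> int ^ 'n"
  assumes inj: "inj key" and N: "graded_mod a fscale fmult N" and sub: "\<And>c. N c \<subseteq> fgraded a m c"
    and \<rho>: "\<And>c w. w \<in> N c \<Longrightarrow> fconst w = 0"
    and d: "module_hom pm_scale pm_scale d"
    and into: "\<And>c u. u \<in> fgraded a m' c \<Longrightarrow> d u \<in> N c"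
    and onto: "\<And>c w. w \<in> N c \<Longrightarrow> \<exists>u\<in>fgraded a m' c. d u = w"
  shows "khomology fscale key a fmult (fgraded a m) N (Suc p) c n \<longleftrightarrow>
    khomology fscale key a fmult (fgraded a m') (\<lambda>c. {u \<in> fgraded a m' c. d u = 0}) p c n"
proof -
  interpret koszul_contraction key a "fscale :: 'k \<Rightarrow> ('n, 'v, 'k) free_elem \<Rightarrow> _" fmult "fdiv key" fconst
    by (rule koszul_contraction_free[OF inj])
  interpret d: module_hom pm_scale pm_scale d by fact
  have da: "Modules.additive d" by (rule module_hom_additive[OF d])
  have dk: "d (fscale r u) = fscale r (d u)" and dx: "d (fmult v u) = fmult v (d u)" for r u v
    by (simp_all add: fscale_def fmult_def d.scale)
  have z: "graded_mod a fscale fmult (\<lambda>_. {0 :: ('n, 'v, 'k) free_elem})"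
    using additive.zero[OF additive_free_ops(1)] additive.zero[OF additive_free_ops(4)] by (auto simp: graded_mod_def)
  have N': "graded_mod a fscale fmult (\<lambda>c. {u \<in> fgraded a m' c. d u = 0})"
    using graded_mod_fgraded[of a m'] additive.zero[OF additive_free_ops(1)] additive.zero[OF additive_free_ops(4)]
    by (auto simp: graded_mod_def dk dx d.zero d.diff)
  have shifted: "khomology fscale key a fmult (fgraded a m) N (Suc p) c n \<longleftrightarrow>
      khomology fscale key a fmult N (\<lambda>_. {0}) p c n"
    by (rule shift[OF graded_mod_fgraded N sub fdiv_fgraded \<rho>])
  have s0: "{0} \<subseteq> N c" for c using graded_modD(1)[OF N] by blast
  have on: "\<exists>u\<in>fgraded a m' c. w - d u \<in> {0}" if "w \<in> N c" for c w
  proof -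
    obtain u where "u \<in> fgraded a m' c" "d u = w" using onto[OF \<open>w \<in> N c\<close>] by blast
    then show ?thesis by (intro bexI[of _ u]) simp_all
  qed
  have ker: "u \<in> {u \<in> fgraded a m' c. d u = 0} \<longleftrightarrow> d u \<in> {0}" if "u \<in> fgraded a m' c" for u c
    using that by blast
  have "khomology fscale key a fmult (fgraded a m') (\<lambda>c. {u \<in> fgraded a m' c. d u = 0}) p c n \<longleftrightarrow>
    khomology fscale key a fmult N (\<lambda>_. {0}) p c n"
    by (rule khomology_cover[OF graded_ops_free graded_ops_free graded_mod_fgraded N' N z s0 da dk dx into on ker])
  with shifted show ?thesis by simp
qed

text \<open>The coefficient sum of \<epsilon> u identifies each graded piece of F_0 / N with the
  field or zero, and turns every variable into the identity. The Koszul differential is then the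
  simplicial boundary, and a set of size p is a face of dimension p - 1.\<close>

lemma tor_simplicial:
  fixes \<epsilon> :: "('n::finite, 'v::finite, 'k::field) free_elem \<Rightarrow> ('v, 'k) mpoly" and a :: "'v \<Rightarrow> int ^ 'n"
  assumes a: "\<And>v. 0 \<le> a v"
    and e: "module_hom pm_scale (*) \<epsilon>"
    and deg: "\<And>c u. u \<in> fgraded a m c \<Longrightarrow> mhomogeneous a c (\<epsilon> u)"
    and onto: "\<And>f. \<exists>u\<in>free_module m. f - \<epsilon> u \<in> toric_ideal a"
  defines "N \<equiv> (\<lambda>c. {u \<in> fgraded a m c. \<epsilon> u \<in> toric_ideal a})"
  shows "khomology fscale key a fmult (fgraded a m) N p c n \<longleftrightarrow>
    shomology TYPE('k) key {T. c - sum a T \<in> range (mdeg a)} (int p - 1) n"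
proof -
  interpret e: module_hom pm_scale "(*)" \<epsilon> by fact
  have ea: "Modules.additive \<epsilon>" by (rule module_hom_additive[OF e])
  define M where "M b = (if b \<in> range (mdeg a) then UNIV else {0 :: 'k})" for b
  define f where "f u = coeff_sum (\<epsilon> u)" for u
  have fa: "Modules.additive f"
    unfolding f_def Modules.additive_def by (simp add: additive.add[OF ea] additive.add[OF additive_coeff_sum])
  have fk: "f (fscale r u) = r * f u" and fx: "f (fmult v u) = f u" for r u v
    by (simp_all add: f_def fscale_def fmult_def e.scale coeff_sum_single_times)
  have scm: "coeff_sum (hom_part a b (\<epsilon> u)) = (if b = c then f u else 0)" if "u \<in> fgraded a m c" for u b c
    using grading.pc_pc[OF grading_hom_part, of a b c "\<epsilon> u"] deg[OF that] additive.zero[OF additive_coeff_sum]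
    by (auto simp: mhomogeneous_iff f_def)
  have ker: "u \<in> N c \<longleftrightarrow> f u \<in> {0}" if "u \<in> fgraded a m c" for u c
    using that scm[OF that] unfolding N_def toric_ideal_iff[OF a] by auto
  have M: "graded_mod a (*) (\<lambda>_ x. x) M"
  proof -
    have "b + a v \<in> range (mdeg a)" if b: "b \<in> range (mdeg a)" for b v
    proof -
      obtain e where "b = mdeg a e" using b by blast
      then have "b + a v = mdeg a (e + var v)" by (simp add: mdeg_add)
      then show ?thesis by blast
    qed
    then show ?thesis by (auto simp: graded_mod_def M_def)
  qed
  have z: "graded_mod a (*) (\<lambda>_ x. x) (\<lambda>_. {0 :: 'k})" by (auto simp: graded_mod_def)
  have N: "graded_mod a fscale fmult N"
  proof -
    have "N = (\<lambda>c. {u \<in> fgraded a m c. f u = 0})"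
      using ker by (auto simp: fun_eq_iff N_def)
    then show ?thesis using graded_mod_fgraded[of a m, where ?'c = 'k]
      by (simp add: graded_mod_def fk fx additive.zero[OF fa] additive.diff[OF fa])
  qed
  have "khomology fscale key a fmult (fgraded a m) N p c n \<longleftrightarrow>
      khomology (*) key a (\<lambda>_ x. x) M (\<lambda>_. {0}) p c n"
  proof (rule khomology_cover[OF graded_ops_free graded_ops_mult graded_mod_fgraded N M z _ fa fk fx _ _ ker])
    show "{0} \<subseteq> M c" for c by (simp add: M_def)
    show "f u \<in> M c" if "u \<in> fgraded a m c" for u c
    proof (cases "c \<in> range (mdeg a)")
      case False
      have "pkeys (\<epsilon> u) = {}"
      proof (rule equals0I)
        fix e assume "e \<in> pkeys (\<epsilon> u)"
        then have "mdeg a e = c" using deg[OF that] by (auto simp: mhomogeneous_def)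
        then show False using False by blast
      qed
      then show ?thesis by (simp add: f_def coeff_sum_def M_def)
    qed (simp add: M_def)
    show "\<exists>u\<in>fgraded a m c. r - f u \<in> {0}" if r: "r \<in> M c" for r c
    proof (cases "c \<in> range (mdeg a)")
      case True
      then obtain t where t: "mdeg a t = c" by blast
      obtain u where u: "u \<in> free_module m" "Poly_Mapping.single t r - \<epsilon> u \<in> toric_ideal a"
        using onto by blast
      have ah: "Modules.additive (hom_part a c :: ('v, 'k) mpoly \<Rightarrow> _)" by (rule grading.additive_pc[OF grading_hom_part])
      have "hom_part a c (Poly_Mapping.single t r) = Poly_Mapping.single t r"
        by (rule poly_mapping_eqI) (auto simp: lookup_hom_part lookup_single t when_def)
      then have "r = coeff_sum (hom_part a c (\<epsilon> u))"
        using u(2) unfolding toric_ideal_iff[OF a]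
        by (metis (no_types, lifting) additive.diff[OF ah] additive.diff[OF additive_coeff_sum] eq_iff_diff_eq_0 coeff_sum_single)
      \<comment> \<open>The preimage u of a monomial multiple need not be homogeneous; its component
        of degree c has the same relevant coefficient sum.\<close>
      also have "hom_part a c (\<epsilon> u) = \<epsilon> (fhom_part a c u)"
        by (rule grading_commute[OF grading_fhom_part grading_hom_part ea])
          (use deg[OF fhom_part_fgraded[OF u(1)]] in \<open>simp add: mhomogeneous_iff\<close>)
      finally show ?thesis using fhom_part_fgraded[OF u(1)] by (auto simp: f_def)
    next
      case False
      then show ?thesis using r additive.zero[OF fa]
        by (intro bexI[OF _ graded_modD(1)[OF graded_mod_fgraded]]) (simp add: M_def)
    qed
  qed
  also have "\<dots> \<longleftrightarrow> shomology TYPE('k) key {T. c - sum a T \<in> range (mdeg a)} (int p - 1) n"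
  proof -
    have ch: "kchains a M q c = schains {T. c - sum a T \<in> range (mdeg a)} (int q - 1)" for q
      by (auto simp: kchains_def schains_iff M_def split: if_splits)
    have "kcycles key a (\<lambda>_ x. x) M (\<lambda>_. {0}) p c = scycles key {T. c - sum a T \<in> range (mdeg a)} (int p - 1)"
      unfolding kcycles_def scycles_def ch by (auto simp: bd_def fun_eq_iff)
    moreover have "kbounds key a (\<lambda>_ x. x) M (\<lambda>_. {0}) p c = sbounds key {T. c - sum a T \<in> range (mdeg a)} (int p - 1)"
    proof -
      have "kdiff key (\<lambda>_ x. x) y \<in> kchains a M p c" if "y \<in> kchains a M (Suc p) c" for y
        by (rule kdiff_kchains[OF M graded_ops_mult that])
      then have "kbounds key a (\<lambda>_ x. x) M (\<lambda>_. {0}) p c = kdiff key (\<lambda>_ x. x) ` kchains a M (Suc p) c"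
        by (auto simp: kbounds_def fun_eq_iff image_iff)
      then show ?thesis unfolding sbounds_def ch bd_def[abs_def] by simp
    qed
    ultimately show ?thesis by (simp add: shomology_def)
  qed
  finally show ?thesis .
qed

section \<open>Betti numbers as simplicial homology\<close>

lemma shomology_exists:
  assumes "inj key" "down_closed K"
  shows "\<exists>n. shomology TYPE('k::field) key K p n"
proof -
  let ?scycles = "scycles key K p :: ('a set \<Rightarrow> 'k) set" and ?sbounds = "sbounds key K p :: ('a set \<Rightarrow> 'k) set"
  obtain W where W: "W \<subseteq> ?scycles" "fvs.independent W" "?scycles \<subseteq> fvs.span W" "card W = fvs.dim ?scycles"
    using fvs.basis_exists by blast
  have "W \<subseteq> fvs.span (delta ` {T \<in> K. int (card T) = p + 1})"
    using W(1) scycles_fin[of key K p] by blast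
  then have "finite W" by (intro conjunct1[OF fvs.independent_span_bound[OF _ W(2)]]) auto
  then have "fvs.dim ?sbounds \<le> fvs.dim ?scycles"
    using fvs.dim_le_card[of ?sbounds W] sbounds_subset_scycles[OF assms, of p] W by auto
  then show ?thesis unfolding shomology_iff_dim[OF assms] by (metis le_add_diff_inverse)
qed

lemma shomology_unique:
  assumes "inj key" "down_closed K" "shomology TYPE('k::field) key K p n" "shomology TYPE('k) key K p n'"
  shows "n = n'"
  using assms(3,4) unfolding shomology_iff_dim[OF assms(1,2)] by simp

definition submod :: "('n, 'v, 'k::field) free_elem set \<Rightarrow> bool" where
  "submod N \<longleftrightarrow> 0 \<in> N \<and> (\<forall>u\<in>N. \<forall>w\<in>N. u - w \<in> N) \<and> (\<forall>g. \<forall>u\<in>N. pm_scale g u \<in> N)"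

lemma submodD:
  assumes "submod N"
  shows "0 \<in> N" "u \<in> N \<Longrightarrow> w \<in> N \<Longrightarrow> u - w \<in> N" "u \<in> N \<Longrightarrow> pm_scale g u \<in> N"
    "(\<And>i. i \<in> I \<Longrightarrow> f i \<in> N) \<Longrightarrow> sum f I \<in> N"
proof -
  show *: "0 \<in> N" "\<And>u w. u \<in> N \<Longrightarrow> w \<in> N \<Longrightarrow> u - w \<in> N" "u \<in> N \<Longrightarrow> pm_scale g u \<in> N"
    using assms by (auto simp: submod_def)
  show "(\<And>i. i \<in> I \<Longrightarrow> f i \<in> N) \<Longrightarrow> sum f I \<in> N" by (rule sum_in) (use * in auto)
qed

lemma submod_free_module: "submod (free_module m :: ('n::finite, 'v, 'k::field) free_elem set)"
  unfolding submod_def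
proof (intro conjI ballI allI)
  show "0 \<in> free_module m" by (simp add: free_module_iff)
  fix u w :: "('n, 'v, 'k) free_elem" and g assume u: "u \<in> free_module m"
  have "plookup u k \<noteq> 0" if "plookup (pm_scale g u) k \<noteq> 0" for k using that by auto
  then show "pm_scale g u \<in> free_module m" using u unfolding free_module_iff by blast
  assume w: "w \<in> free_module m"
  have "plookup u k \<noteq> 0 \<or> plookup w k \<noteq> 0" if "plookup (u - w) k \<noteq> 0" for k
    using that by (auto simp: lookup_minus)
  then show "u - w \<in> free_module m" using u w unfolding free_module_iff by blast
qed

lemma submod_kernel:
  assumes "module_hom pm_scale pm_scale d"
  shows "submod {u \<in> free_module m. d u = 0}"
proof -
  interpret module_hom pm_scale pm_scale d by fact
  show ?thesis using submod_free_module[of m]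
    by (auto simp: submod_def zero diff scale module.scale_zero_right[OF module_pm_scale])
qed

lemma submod_ideal:
  fixes a :: "'v::finite \<Rightarrow> int ^ 'n" and \<epsilon> :: "('n, 'v, 'k::field) free_elem \<Rightarrow> _"
  assumes "\<And>v. 0 \<le> a v" "module_hom pm_scale (*) \<epsilon>"
  shows "submod {u \<in> free_module m. \<epsilon> u \<in> toric_ideal a}"
proof -
  interpret module_hom pm_scale "(*)" \<epsilon> by fact
  show ?thesis using submod_free_module[of m] toric_ideal_closed[of a] assms(1)
    by (auto simp: submod_def zero diff scale)
qed

lemma graded_mod_submod:
  assumes "submod N" shows "graded_mod a fscale fmult (\<lambda>c. N \<inter> fgraded a m c)"
proof -
  have "fscale r u \<in> N" "fmult v u \<in> N" if "u \<in> N" for r u v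
    unfolding fscale_def fmult_def by (rule submodD(3)[OF assms that])+
  then show ?thesis
    unfolding graded_mod_def by (simp add: graded_modD(1-4)[OF graded_mod_fgraded] submodD(1,2)[OF assms])
qed

text \<open>Going down from F_i / N_i in homological degree 0 to F_0 / N_0 in degree i takes i
  dimension shifts. At the start the dimension is the number of generators of degree c, at the end
  it is a homology of the divisor complex, whatever the resolution.\<close>

lemma minimal_free_resolution_shomology:
  fixes a :: "'v::finite \<Rightarrow> int ^ 'n"
  assumes a: "\<And>v. 0 \<le> a v" and inj: "inj key"
    and min: "minimal_free_resolution a (toric_ideal a :: ('v, 'k::field) mpoly set) \<beta> \<epsilon> d"
  shows "shomology TYPE('k) key {T. c - sum a T \<in> range (mdeg a)} (int i - 1) (\<beta> i c)"
proof -
  let ?I = "toric_ideal a :: ('v, 'k) mpoly set"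
  have res: "free_resolution a ?I \<beta> \<epsilon> d"
    and mind: "\<And>i u x. u \<in> free_module (\<beta> (Suc i)) \<Longrightarrow> plookup (plookup (d i u) x) 0 = 0"
    using min by (auto simp: minimal_free_resolution_def)
  have e: "module_hom pm_scale (*) \<epsilon>" and d: "\<And>i. module_hom pm_scale pm_scale (d i)"
    and edeg: "\<And>c u. u \<in> fgraded a (\<beta> 0) c \<Longrightarrow> mhomogeneous a c (\<epsilon> u)"
    and ddeg: "\<And>i c u. u \<in> fgraded a (\<beta> (Suc i)) c \<Longrightarrow> free_homogeneous a c (d i u)"
    and surj: "(\<lambda>u. ideal_rel ?I `` {\<epsilon> u}) ` free_module (\<beta> 0) = UNIV // ideal_rel ?I"
    and ex0: "d 0 ` free_module (\<beta> 1) = {u \<in> free_module (\<beta> 0). \<epsilon> u \<in> ?I}"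
    and exS: "\<And>i. d (Suc i) ` free_module (\<beta> (Suc (Suc i))) = {u \<in> free_module (\<beta> (Suc i)). d i u = 0}"
    using res unfolding free_resolution_def fgraded_def by auto
  \<comment> \<open>The syzygy module inside F_i. For i = 0 it is the preimage of the toric ideal,
    so that F_0 / N_0 is R.\<close>
  define N where "N i = (case i of 0 \<Rightarrow> {u \<in> free_module (\<beta> 0). \<epsilon> u \<in> ?I} | Suc i \<Rightarrow> {u \<in> free_module (\<beta> (Suc i)). d i u = 0})" for i
  have im: "d i ` free_module (\<beta> (Suc i)) = N i" for i
    using ex0 exS by (cases i) (auto simp: N_def)
  have NF: "N i \<subseteq> free_module (\<beta> i)" for i by (cases i) (auto simp: N_def)
  have sub: "submod (N i)" for i
    by (cases i) (auto simp: N_def intro: submod_ideal[OF a e] submod_kernel[OF d])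
  \<comment> \<open>Minimality enters here: N_i is the image of the next differential, whose values
    have no constant coefficients.\<close>
  have rho0: "fconst w = 0" if "w \<in> N i" for i w
  proof -
    have "w \<in> d i ` free_module (\<beta> (Suc i))" unfolding im by fact
    then obtain u where "u \<in> free_module (\<beta> (Suc i))" "w = d i u" by blast
    then show ?thesis by (intro free_elem_eqI) (simp add: lookup_const_part mind)
  qed
  have into: "d i u \<in> N i \<inter> fgraded a (\<beta> i) c" if "u \<in> fgraded a (\<beta> (Suc i)) c" for i c u
  proof -
    have "d i u \<in> N i" using that im[of i] by (auto simp: fgraded_def)
    then show ?thesis using ddeg[OF that] NF[of i] by (auto simp: fgraded_def)
  qed
  have onto: "\<exists>u\<in>fgraded a (\<beta> (Suc i)) c. d i u = w" if w: "w \<in> N i \<inter> fgraded a (\<beta> i) c" for i c w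
  proof -
    have "w \<in> d i ` free_module (\<beta> (Suc i))" unfolding im using w by blast
    then obtain u where u: "u \<in> free_module (\<beta> (Suc i))" "w = d i u" by blast
    \<comment> \<open>Exactness provides a preimage without control of its degree; since d preserves
      degrees, its component of degree c is a preimage too.\<close>
    have "fhom_part a c (d i u) = d i (fhom_part a c u)"
      by (rule grading_commute[OF grading_fhom_part grading_fhom_part module_hom_additive[OF d]])
        (use into[OF fhom_part_fgraded[OF u(1)]] in \<open>auto simp: fgraded_iff_fhom_part\<close>)
    then have "d i (fhom_part a c u) = w" using w u by (auto simp: fgraded_iff_fhom_part)
    then show ?thesis using fhom_part_fgraded[OF u(1)] by blast
  qed
  let ?H = "\<lambda>i p c n. khomology fscale key a fmult (fgraded a (\<beta> i)) (\<lambda>c. N i \<inter> fgraded a (\<beta> i) c) p c n"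
  have step: "?H i (Suc p) c n \<longleftrightarrow> ?H (Suc i) p c n" for i p c n
  proof -
    have "(\<lambda>c. {u \<in> fgraded a (\<beta> (Suc i)) c. d i u = 0}) = (\<lambda>c. N (Suc i) \<inter> fgraded a (\<beta> (Suc i)) c)"
      by (auto simp: N_def fgraded_def)
    then show ?thesis
      using tor_step[OF inj graded_mod_submod[OF sub] Int_lower2 _ d into onto, of i p c n] rho0 by auto
  qed
  have "?H 0 (p + i) c n \<longleftrightarrow> ?H i p c n" for p n
  proof (induction i arbitrary: p)
    case (Suc i)
    have "?H 0 (p + Suc i) c n \<longleftrightarrow> ?H 0 (Suc p + i) c n" by simp
    also have "\<dots> \<longleftrightarrow> ?H i (Suc p) c n" by (rule Suc.IH)
    also have "\<dots> \<longleftrightarrow> ?H (Suc i) p c n" by (rule step)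
    finally show ?case .
  qed simp
  from this[of 0 "\<beta> i c"] have "?H 0 i c (\<beta> i c)"
    using khomology_0_free[OF inj graded_mod_submod[OF sub[of i], of a "\<beta> i"], of "\<beta> i" c] rho0[of _ i] by auto
  moreover have "(\<lambda>c. N 0 \<inter> fgraded a (\<beta> 0) c) = (\<lambda>c. {u \<in> fgraded a (\<beta> 0) c. \<epsilon> u \<in> ?I})"
    by (auto simp: N_def fgraded_def)
  moreover have "\<exists>u\<in>free_module (\<beta> 0). f - \<epsilon> u \<in> ?I" for f
  proof -
    have "ideal_rel ?I `` {f} \<in> UNIV // ideal_rel ?I" by (auto simp: quotient_def)
    then obtain u where u: "u \<in> free_module (\<beta> 0)" "ideal_rel ?I `` {f} = ideal_rel ?I `` {\<epsilon> u}"
      using surj by blast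
    have I0: "0 \<in> ?I" using toric_ideal_closed(1)[of a] a by blast
    then have "f \<in> ideal_rel ?I `` {f}" by (simp add: ideal_rel_def)
    then have "\<epsilon> u - f \<in> ?I" unfolding u(2) by (simp add: ideal_rel_def)
    then have "0 - (\<epsilon> u - f) \<in> ?I" using toric_ideal_closed(2)[of a 0] a I0 by blast
    then show ?thesis using u(1) by auto
  qed
  ultimately show ?thesis
    using tor_simplicial[where \<epsilon> = \<epsilon> and a = a and m = "\<beta> 0" and key = key, OF a e edeg] by simp
qed

section \<open>Existence of minimal resolutions\<close>

definition gen_map :: "((int ^ 'n) \<times> nat \<Rightarrow> ('n, 'v, 'k::field) free_elem) \<Rightarrow> ('n, 'v, 'k) free_elem \<Rightarrow> ('n, 'v, 'k) free_elem" where
  "gen_map G u = (\<Sum>k\<in>pkeys u. pm_scale (plookup u k) (G k))"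

lemma gen_map_superset:
  assumes "finite E" "pkeys u \<subseteq> E" shows "gen_map G u = (\<Sum>k\<in>E. pm_scale (plookup u k) (G k))"
  unfolding gen_map_def
  by (rule sum.mono_neutral_left)
     (use assms in \<open>auto simp: in_keys_iff module.scale_zero_left[OF module_pm_scale]\<close>)

lemma module_hom_gen_map: "module_hom pm_scale pm_scale (gen_map G)"
  unfolding module_hom_iff
proof (intro conjI allI module_pm_scale)
  fix u w and g
  have "gen_map G (u + w) = (\<Sum>k\<in>pkeys u \<union> pkeys w. pm_scale (plookup (u + w) k) (G k))"
    by (rule gen_map_superset) (use keys_add[of u w] in auto)
  also have "\<dots> = (\<Sum>k\<in>pkeys u \<union> pkeys w. pm_scale (plookup u k) (G k))
      + (\<Sum>k\<in>pkeys u \<union> pkeys w. pm_scale (plookup w k) (G k))"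
    by (simp add: lookup_add module.scale_left_distrib[OF module_pm_scale] sum.distrib)
  also have "\<dots> = gen_map G u + gen_map G w" by (subst (1 2) gen_map_superset[symmetric]) auto
  finally show "gen_map G (u + w) = gen_map G u + gen_map G w" .
  have "gen_map G (pm_scale g u) = (\<Sum>k\<in>pkeys u. pm_scale (plookup (pm_scale g u) k) (G k))"
    by (rule gen_map_superset) (auto simp: in_keys_iff)
  then show "gen_map G (pm_scale g u) = pm_scale g (gen_map G u)"
    by (simp add: gen_map_def module.scale_sum_right[OF module_pm_scale] module.scale_scale[OF module_pm_scale])
qed

lemma gen_map_fgen: "gen_map G (fgen b j) = G (b, j)"
  by (simp add: gen_map_def fgen_def module.scale_one[OF module_pm_scale])

lemma pm_scale_fgraded:
  fixes a :: "'v::finite \<Rightarrow> int ^ 'n" and w :: "('n, 'v, 'k::field) free_elem"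
  assumes "mhomogeneous a c g" "w \<in> fgraded a m b"
  shows "pm_scale g w \<in> fgraded a m (b + c)"
  unfolding fgraded_iff
proof (intro allI impI)
  fix b' j e assume ne: "plookup (plookup (pm_scale g w) (b', j)) e \<noteq> 0"
  have "g * plookup w (b', j) = (\<Sum>t\<in>pkeys g. Poly_Mapping.single t (plookup g t) * plookup w (b', j))"
    by (subst (1) poly_mapping_expand[of g]) (simp add: sum_distrib_right)
  then have "(\<Sum>t\<in>pkeys g. plookup (Poly_Mapping.single t (plookup g t) * plookup w (b', j)) e) \<noteq> 0"
    using ne by (simp add: lookup_sum)
  then obtain t where t: "t \<in> pkeys g" "plookup (Poly_Mapping.single t (plookup g t) * plookup w (b', j)) e \<noteq> 0"
    by (meson sum.neutral)
  have "\<exists>s\<in>pkeys (plookup w (b', j)). t + s = e"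
  proof (rule ccontr)
    assume "\<not> (\<exists>s\<in>pkeys (plookup w (b', j)). t + s = e)"
    then have "plookup (Poly_Mapping.single t (plookup g t) * plookup w (b', j)) e = 0"
      unfolding lookup_single_times by (intro sum.neutral) auto
    then show False using t(2) by simp
  qed
  then obtain s where s: "s \<in> pkeys (plookup w (b', j))" "t + s = e" by blast
  have "mdeg a t = c" using assms(1) t(1) by (auto simp: mhomogeneous_def)
  moreover have "j < m b'" "mdeg a s + b' = b" using assms(2) s(1) by (auto simp: fgraded_iff in_keys_iff)
  ultimately show "j < m b' \<and> mdeg a e + b' = b + c" using s(2) by (auto simp: mdeg_add algebra_simps)
qed

lemma gen_map_fgraded:
  assumes G: "\<And>b j. j < m' b \<Longrightarrow> G (b, j) \<in> fgraded a m b" and u: "u \<in> fgraded a m' c"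
  shows "gen_map G u \<in> fgraded a m c"
  unfolding gen_map_def
proof (rule graded_modD(8)[OF graded_mod_fgraded])
  fix k assume k: "k \<in> pkeys u"
  obtain b j where kb: "k = (b, j)" by (cases k)
  have "j < m' b" using u k by (auto simp: fgraded_def free_module_def kb)
  moreover have "mhomogeneous a (c - b) (plookup u k)"
    using u k unfolding fgraded_def free_homogeneous_def kb by blast
  ultimately show "pm_scale (plookup u k) (G k) \<in> fgraded a m c"
    using pm_scale_fgraded[of a "c - b" "plookup u k" "G k" m b] G unfolding kb by simp
qed

lemma fhom_part_zero [simp]: "fhom_part a c 0 = 0"
  by (rule additive.zero[OF grading.additive_pc[OF grading_fhom_part]])

lemma fhom_part_kernel:
  assumes d: "module_hom pm_scale pm_scale d"
    and deg: "\<And>c u. u \<in> fgraded a m' c \<Longrightarrow> d u \<in> fgraded a m c" and u: "u \<in> free_module m'"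
  shows "fhom_part a c (d u) = d (fhom_part a c u)"
  by (rule grading_commute[OF grading_fhom_part grading_fhom_part module_hom_additive[OF d]])
    (use deg[OF fhom_part_fgraded[OF u]] in \<open>auto simp: fgraded_iff_fhom_part\<close>)

lemma fgen_sum_fgraded:
  fixes a :: "'v::finite \<Rightarrow> int ^ 'n"
  shows "(\<Sum>j<m c. fscale (l j) (fgen c j)) \<in> (fgraded a m c :: ('n, 'v, 'k::field) free_elem set)"
proof (intro graded_modD(8)[OF graded_mod_fgraded] graded_modD(3)[OF graded_mod_fgraded])
  fix j assume "j \<in> {..<m c}"
  then show "fgen c j \<in> (fgraded a m c :: ('n, 'v, 'k) free_elem set)"
    by (auto simp: fgraded_iff fgen_def lookup_single when_def lookup_one split: if_splits)
qed

text \<open>The invariant of the recursive construction. Koszul homology is required to be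
  finite-dimensional in all p because each step uses up one homological degree; its finiteness in
  degree 1 takes the place of a Noetherian argument. The bound on the degrees of generators makes
  the induction on degrees well-founded.\<close>

definition syz_invar where
  "syz_invar a key m N \<longleftrightarrow> submod N \<and> N \<subseteq> free_module m \<and> (\<forall>u\<in>N. \<forall>c. fhom_part a c u \<in> N) \<and> (\<forall>u\<in>N. fconst u = 0) \<and>
     (\<forall>b. 0 < m b \<longrightarrow> 0 \<le> b) \<and>
     (\<forall>p c. \<exists>n. khomology fscale key a fmult (fgraded a m) (\<lambda>c. N \<inter> fgraded a m c) p c n)"

text \<open>A linear functional that is positive on nonzero nonnegative vectors; it drops whenever
  the degree of a variable is subtracted, which makes it the measure for generation by
  degree.\<close>

definition coord_sum :: "int ^ 'n \<Rightarrow> int" where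
  "coord_sum c = (\<Sum>i\<in>UNIV. c $ i)"

lemma coord_sum_pos:
  assumes "0 \<le> c" "c \<noteq> 0" shows "0 < coord_sum c"
proof -
  obtain i where "c $ i \<noteq> 0" using assms(2) by (auto simp: vec_eq_iff)
  then show ?thesis unfolding coord_sum_def
    using assms(1) by (intro sum_pos2[of UNIV i]) (auto simp: less_eq_vec_def less_le)
qed

text \<open>A minimal cover of N: in each degree, as many generators as a basis of N modulo the
  multiples of variables, mapped to representatives. Surjectivity is the graded Nakayama argument.
  Minimality of the choice means that a relation among the generators has no constant coefficients,
  which is the condition on the next syzygies.\<close>

lemma resolution_step:
  fixes a :: "'v::finite \<Rightarrow> int ^ 'n" and N :: "('n, 'v, 'k::field) free_elem set"
  assumes a: "\<And>v. 0 \<le> a v" "\<And>v. a v \<noteq> 0" and inj: "inj key" and I: "syz_invar a key m N"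
  shows "\<exists>m' d. module_hom pm_scale pm_scale d \<and> (\<forall>c. \<forall>u\<in>fgraded a m' c. d u \<in> fgraded a m c) \<and>
    d ` free_module m' = N \<and> syz_invar a key m' {u \<in> free_module m'. d u = 0}"
proof -
  interpret koszul_contraction key a "fscale :: 'k \<Rightarrow> ('n, 'v, 'k) free_elem \<Rightarrow> _" fmult "fdiv key" fconst
    by (rule koszul_contraction_free[OF inj])
  define M where "M c = N \<inter> fgraded a m c" for c
  have sub: "submod N" and NF: "N \<subseteq> free_module m" and Nfc: "\<And>u c. u \<in> N \<Longrightarrow> fhom_part a c u \<in> N"
    and Nr: "\<And>u. u \<in> N \<Longrightarrow> fconst u = 0" and mpos: "\<And>b. 0 < m b \<Longrightarrow> 0 \<le> b"
    and fin: "\<And>p c. \<exists>n. khomology fscale key a fmult (fgraded a m) M p c n"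
    using I unfolding syz_invar_def M_def by blast+
  have gM: "graded_mod a fscale fmult M" unfolding M_def by (rule graded_mod_submod[OF sub])
  have MF: "M c \<subseteq> fgraded a m c" for c by (auto simp: M_def)
  have Mr: "fconst u = 0" if "u \<in> M c" for u c using that Nr by (auto simp: M_def)
  have Mfc: "fhom_part a c u \<in> M c" if "u \<in> N" for u c
  proof -
    have "u \<in> free_module m" using that NF by blast
    then show ?thesis by (simp add: M_def Nfc[OF that] fhom_part_fgraded)
  qed
  have Mpos: "u = 0" if "u \<in> M c" "\<not> 0 \<le> c" for u c
  proof (rule free_elem_eqI')
    fix b j e
    show "plookup (plookup u (b, j)) e = plookup (plookup 0 (b, j)) e"
    proof (rule ccontr)
      assume "plookup (plookup u (b, j)) e \<noteq> plookup (plookup 0 (b, j)) e"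
      then have "j < m b" "mdeg a e + b = c" using that(1) by (auto simp: M_def fgraded_iff)
      moreover have "0 \<le> mdeg a e" by (rule mdeg_nonneg) (rule a)
      ultimately show False using that(2) mpos[of b] by (auto simp: less_eq_vec_def)
    qed
  qed
  \<comment> \<open>In degree c, g is a basis of N modulo the multiples of variables.\<close>
  define P where "P c n g \<longleftrightarrow> (\<forall>j<n. g j \<in> M c) \<and>
      (\<forall>z\<in>M c. \<exists>l y. (\<forall>v. y v \<in> M (c - a v)) \<and> z = (\<Sum>j<n. fscale (l j) (g j)) + (\<Sum>v\<in>UNIV. fmult v (y v))) \<and>
      (\<forall>l y j. (\<forall>v. y v \<in> M (c - a v)) \<longrightarrow> (\<Sum>j<n. fscale (l j) (g j)) = (\<Sum>v\<in>UNIV. fmult v (y v)) \<longrightarrow> j < n \<longrightarrow> l j = 0)"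
    for c and n :: nat and g
  have "\<exists>n g. P c n g" for c
  proof -
    \<comment> \<open>Finite dimension is known for the quotient in homological degree 1;
      \<open>shift\<close> turns it into a finite number of minimal generators of N in degree
      c.\<close>
    obtain n where "khomology fscale key a fmult (fgraded a m) M (Suc 0) c n"
      using fin by blast
    moreover have "khomology fscale key a fmult (fgraded a m) M (Suc 0) c n
        \<longleftrightarrow> khomology fscale key a fmult M (\<lambda>_. {0}) 0 c n"
      by (rule shift[OF graded_mod_fgraded gM MF fdiv_fgraded Mr])
    ultimately have "khomology fscale key a fmult M (\<lambda>_. {0}) 0 c n" by blast
    then obtain g where "\<And>j. j < n \<Longrightarrow> g j \<in> M c"
      "\<And>z. z \<in> M c \<Longrightarrow> \<exists>l y. (\<forall>v. y v \<in> M (c - a v)) \<and> z = (\<Sum>j<n. fscale (l j) (g j)) + (\<Sum>v\<in>UNIV. fmult v (y v))"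
      "\<And>l y j. (\<And>v. y v \<in> M (c - a v)) \<Longrightarrow> (\<Sum>j<n. fscale (l j) (g j)) = (\<Sum>v\<in>UNIV. fmult v (y v)) \<Longrightarrow> j < n \<Longrightarrow> l j = 0"
      by (rule khomology_0_generators[OF gM]) blast
    then show ?thesis unfolding P_def by blast
  qed
  then obtain m' g where P: "\<And>c. P c (m' c) (g c)" by metis
  have gM': "g c j \<in> M c" if "j < m' c" for c j using P that by (auto simp: P_def)
  have fgen_M: "\<exists>l y. (\<forall>v. y v \<in> M (c - a v)) \<and> z = (\<Sum>j<m' c. fscale (l j) (g c j)) + (\<Sum>v\<in>UNIV. fmult v (y v))"
    if "z \<in> M c" for z c using P that unfolding P_def by blast
  have ind: "l j = 0" if "\<And>v. y v \<in> M (c - a v)" "(\<Sum>j<m' c. fscale (l j) (g c j)) = (\<Sum>v\<in>UNIV. fmult v (y v))" "j < m' c" for l y j c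
    using P[of c] that unfolding P_def by blast
  define G where "G k = (case k of (b, j) \<Rightarrow> if j < m' b then g b j else 0)" for k
  define d where "d = gen_map G"
  have d: "module_hom pm_scale pm_scale d" unfolding d_def by (rule module_hom_gen_map)
  interpret d: module_hom pm_scale pm_scale d by fact
  have dk: "d (fscale r u) = fscale r (d u)" and dx: "d (fmult v u) = fmult v (d u)" for r u v
    by (simp_all add: fscale_def fmult_def d.scale)
  have dgen: "d (\<Sum>j<m' c. fscale (l j) (fgen c j)) = (\<Sum>j<m' c. fscale (l j) (g c j))" for l c
    unfolding d.sum dk by (intro sum.cong) (auto simp: d_def gen_map_fgen G_def)
  have GM: "G (b, j) \<in> M b" for b j
    using gM' graded_modD(1)[OF gM] by (simp add: G_def)
  have ddeg: "d u \<in> fgraded a m c" if "u \<in> fgraded a m' c" for u c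
    unfolding d_def by (rule gen_map_fgraded[OF _ that]) (use GM in \<open>auto simp: M_def\<close>)
  have dN: "d u \<in> N" for u
    unfolding d_def gen_map_def
    by (intro submodD(4)[OF sub] submodD(3)[OF sub]) (use GM in \<open>auto simp: M_def\<close>)
  have dM: "d u \<in> M c" if "u \<in> fgraded a m' c" for u c using ddeg[OF that] dN by (simp add: M_def)
  have onto: "\<exists>u\<in>fgraded a m' c. d u = z" if "z \<in> M c" for z c
    using that
  proof (induction "nat (coord_sum c)" arbitrary: c z rule: less_induct)
    case less
    show ?case
    proof (cases "0 \<le> c")
      case False
      then show ?thesis using Mpos[OF less.prems] graded_modD(1)[OF graded_mod_fgraded, of a m' c] d.zero by blast
    next
      case c: True
      obtain l y where y: "\<And>v. y v \<in> M (c - a v)"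
        "z = (\<Sum>j<m' c. fscale (l j) (g c j)) + (\<Sum>v\<in>UNIV. fmult v (y v))"
        using fgen_M[OF less.prems] by blast
      \<comment> \<open>The measure is cut off at zero by \<open>nat\<close>, so the induction
        hypothesis is used only if c - a v is nonnegative; otherwise y v is zero.\<close>
      have "\<exists>w\<in>fgraded a m' (c - a v). d w = y v" for v
      proof (cases "0 \<le> c - a v")
        case True
        have "coord_sum (c - a v) = coord_sum c - coord_sum (a v)" by (simp add: coord_sum_def sum_subtractf)
        moreover have "0 < coord_sum (a v)" by (rule coord_sum_pos[OF a])
        moreover have "0 \<le> coord_sum (c - a v)" using True by (simp add: coord_sum_def less_eq_vec_def sum_nonneg)
        ultimately have "nat (coord_sum (c - a v)) < nat (coord_sum c)" by simp
        then show ?thesis using less.hyps y(1) by blast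
      next
        case False
        then show ?thesis using Mpos[OF y(1)] graded_modD(1)[OF graded_mod_fgraded, of a m' "c - a v"] d.zero by force
      qed
      then obtain w where w: "\<And>v. w v \<in> fgraded a m' (c - a v)" "\<And>v. d (w v) = y v" by metis
      let ?u = "(\<Sum>j<m' c. fscale (l j) (fgen c j)) + (\<Sum>v\<in>UNIV. fmult v (w v))"
      have "fmult v (w v) \<in> fgraded a m' c" for v
        using graded_modD(4)[OF graded_mod_fgraded w(1)[of v], of v] by simp
      then have "?u \<in> fgraded a m' c"
        by (intro graded_modD(6)[OF graded_mod_fgraded] graded_modD(8)[OF graded_mod_fgraded] fgen_sum_fgraded)
      moreover have "d ?u = z" unfolding y(2) d.add dgen by (simp add: d.sum dx w(2))
      ultimately show ?thesis by blast
    qed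
  qed
  have im: "d ` free_module m' = N"
  proof (intro equalityI subsetI)
    fix w assume "w \<in> N"
    have "w = (\<Sum>c | fhom_part a c w \<noteq> 0. fhom_part a c w)" by (rule grading.sum_pc[OF grading_fhom_part])
    moreover have "\<exists>u\<in>free_module m'. d u = fhom_part a c w" for c
      using onto[OF Mfc[OF \<open>w \<in> N\<close>]] by (auto simp: fgraded_def)
    then obtain u where u: "\<And>c. u c \<in> free_module m'" "\<And>c. d (u c) = fhom_part a c w" by metis
    ultimately have "w = d (\<Sum>c | fhom_part a c w \<noteq> 0. u c)" by (simp add: d.sum u(2))
    moreover have "(\<Sum>c | fhom_part a c w \<noteq> 0. u c) \<in> free_module m'"
      by (intro submodD(4)[OF submod_free_module] u(1))
    ultimately show "w \<in> d ` free_module m'" by blast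
  qed (use dN in auto)
  let ?K = "{u \<in> free_module m'. d u = 0}"
  have Kfc: "fhom_part a c u \<in> ?K" if "u \<in> ?K" for u c
  proof -
    have "fhom_part a c (d u) = d (fhom_part a c u)" by (rule fhom_part_kernel[OF d ddeg]) (use that in auto)
    then show ?thesis using that fhom_part_free_module[of u m' a c] by auto
  qed
  have Kr: "fconst u = 0" if "u \<in> ?K" for u
  proof (rule free_elem_eqI')
    fix c j and e :: "'v \<Rightarrow>\<^sub>0 nat"
    define w where "w = fhom_part a c u"
    have w: "w \<in> fgraded a m' c" "d w = 0" using Kfc[OF that, of c] that fhom_part_fgraded[of u m' a c] by (auto simp: w_def)
    define l where "l j = plookup (plookup w (c, j)) 0" for j
    have rw: "fconst w = (\<Sum>j<m' c. fscale (l j) (fgen c j))"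
    proof (rule free_elem_eqI')
      fix b i and e :: "'v \<Rightarrow>\<^sub>0 nat"
      have "plookup (plookup (fscale (l j) (fgen c j)) (b, i)) e = (if j = i then (if b = c \<and> e = 0 then l i else 0) else 0)" for j
        by (auto simp: fgen_def lookup_single when_def lookup_one)
      then have "plookup (plookup (\<Sum>j<m' c. fscale (l j) (fgen c j)) (b, i)) e = (if b = c \<and> e = 0 \<and> i < m' c then l i else 0)"
        by (simp add: lookup_sum)
      moreover have "plookup (plookup w (b, i)) 0 \<noteq> 0 \<Longrightarrow> b = c \<and> i < m' c"
        using w(1) by (fastforce simp: fgraded_iff)
      ultimately show "plookup (plookup (fconst w) (b, i)) e = plookup (plookup (\<Sum>j<m' c. fscale (l j) (fgen c j)) (b, i)) e"
        by (auto simp: lookup_const_part l_def)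
    qed
    \<comment> \<open>Split w into its constant part and multiples of variables. Applying d
      expresses a combination of the minimal generators by multiples of variables, so the constants
      vanish.\<close>
    have "w = (\<Sum>j<m' c. fscale (l j) (fgen c j)) + (\<Sum>v\<in>UNIV. fmult v (fdiv key v w))"
      using tot[of w] unfolding rw .
    then have "d w = (\<Sum>j<m' c. fscale (l j) (g c j)) + (\<Sum>v\<in>UNIV. fmult v (d (fdiv key v w)))"
      by (metis (no_types, lifting) d.add d.sum dgen dx sum.cong)
    then have "(\<Sum>j<m' c. fscale (l j) (g c j)) = - (\<Sum>v\<in>UNIV. fmult v (d (fdiv key v w)))"
      using w(2) by (simp add: eq_neg_iff_add_eq_0)
    also have "\<dots> = (\<Sum>v\<in>UNIV. fmult v (- d (fdiv key v w)))"
      by (simp add: sum_negf additive.minus[OF additive_free_ops(1)])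
    finally have "(\<Sum>j<m' c. fscale (l j) (g c j)) = (\<Sum>v\<in>UNIV. fmult v (- d (fdiv key v w)))" .
    then have l0: "l j = 0" if "j < m' c" for j
      by (rule ind[rotated, OF _ that]) (intro graded_modD(5)[OF gM] dM fdiv_fgraded w(1))
    have "l j = 0"
    proof (cases "j < m' c")
      case False
      then show ?thesis using w(1) by (auto simp: l_def fgraded_iff)
    qed (rule l0)
    then have "plookup (plookup u (c, j)) 0 = 0" by (simp add: l_def w_def lookup_lookup_fhom_part)
    then show "plookup (plookup (fconst u) (c, j)) e = plookup (plookup 0 (c, j)) e" by (simp add: lookup_const_part)
  qed
  have pos: "0 \<le> b" if "0 < m' b" for b
  proof (rule ccontr)
    assume "\<not> 0 \<le> b"
    then have g0: "g b j = 0" if "j < m' b" for j using Mpos gM'[OF that] by blast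
    have z: "fmult v 0 = (0 :: ('n, 'v, 'k) free_elem)" "fscale r 0 = (0 :: ('n, 'v, 'k) free_elem)" for v r
      by (rule additive.zero, rule additive_free_ops)+
    \<comment> \<open>In such a degree all generators are zero, so the coefficients constantly 1
      satisfy a relation and independence would give 1 = 0.\<close>
    have "(\<lambda>_. 1 :: 'k) 0 = 0"
      by (rule ind[of "\<lambda>_. 0" b "\<lambda>_. 1" 0]) (use that graded_modD(1)[OF gM] in \<open>auto simp: g0 z\<close>)
    then show False by simp
  qed
  have "\<exists>n. khomology fscale key a fmult (fgraded a m') (\<lambda>c. ?K \<inter> fgraded a m' c) p c n" for p c
  proof -
    have eq: "(\<lambda>c. ?K \<inter> fgraded a m' c) = (\<lambda>c. {u \<in> fgraded a m' c. d u = 0})" by (auto simp: fgraded_def)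
    have "khomology fscale key a fmult (fgraded a m) M (Suc p) c n \<longleftrightarrow>
      khomology fscale key a fmult (fgraded a m') (\<lambda>c. {u \<in> fgraded a m' c. d u = 0}) p c n" for n
      by (rule tor_step[OF inj gM MF Mr d dM onto])
    then show ?thesis using fin[of "Suc p" c] unfolding eq by blast
  qed
  then have "syz_invar a key m' ?K"
    unfolding syz_invar_def using submod_kernel[OF d] Kfc Kr pos by blast
  then show ?thesis using d ddeg im by blast
qed

lemma mdeg_eq_0:
  assumes a: "\<And>v. 0 \<le> a v" "\<And>v. a v \<noteq> 0" and e: "mdeg a e = 0" shows "e = 0"
proof (rule poly_mapping_eqI)
  fix v
  have "coord_sum (mdeg a e) = (\<Sum>v\<in>UNIV. int (plookup e v) * coord_sum (a v))"
    unfolding coord_sum_def mdeg_def by (simp add: sum_distrib_left) (rule sum.swap)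
  then have "(\<Sum>v\<in>UNIV. int (plookup e v) * coord_sum (a v)) = 0" using e by (simp add: coord_sum_def)
  moreover have pos: "0 < coord_sum (a v)" for v by (rule coord_sum_pos[OF a])
  ultimately have "int (plookup e v) * coord_sum (a v) = 0"
    by (subst (asm) sum_nonneg_eq_0_iff) (auto simp: less_imp_le)
  then show "plookup e v = plookup 0 v" using pos[of v] by simp
qed

text \<open>Start with F_0 = S, one generator in degree 0, and the toric ideal as first syzygy
  module; \<open>tor_simplicial\<close> supplies the finiteness part of the invariant there. The
  rest is iteration of \<open>resolution_step\<close> by dependent choice.\<close>

lemma minimal_free_resolution_exists:
  fixes a :: "'v::finite \<Rightarrow> int ^ 'n"
  assumes a: "\<And>v. 0 \<le> a v" "\<And>v. a v \<noteq> 0" and inj: "inj key"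
    and fin: "\<And>c p. \<exists>n. shomology TYPE('k) key {T. c - sum a T \<in> range (mdeg a)} p n"
  shows "\<exists>\<beta> \<epsilon> d. minimal_free_resolution a (toric_ideal a :: ('v, 'k::field) mpoly set) \<beta> \<epsilon> d"
proof -
  let ?I = "toric_ideal a :: ('v, 'k) mpoly set"
  define m0 :: "int ^ 'n \<Rightarrow> nat" where "m0 b = (if b = 0 then 1 else 0)" for b
  define \<epsilon> :: "('n, 'v, 'k) free_elem \<Rightarrow> ('v, 'k) mpoly" where "\<epsilon> u = plookup u (0, 0)" for u
  define N0 where "N0 = {u \<in> free_module m0. \<epsilon> u \<in> ?I}"
  have e: "module_hom pm_scale (*) \<epsilon>"
    unfolding module_hom_iff
    by (intro conjI module_pm_scale) (unfold_locales, auto simp: \<epsilon>_def lookup_add algebra_simps)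
  have ehc: "\<epsilon> (fhom_part a c u) = hom_part a c (\<epsilon> u)" for c u by (simp add: \<epsilon>_def lookup_fhom_part)
  have edeg: "mhomogeneous a c (\<epsilon> u)" if "u \<in> fgraded a m0 c" for c u
    using that ehc[of c u] by (simp add: fgraded_iff_fhom_part mhomogeneous_iff)
  have esurj: "\<exists>u\<in>free_module m0. \<epsilon> u = f" for f
    by (intro bexI[of _ "Poly_Mapping.single (0, 0) f"])
      (auto simp: \<epsilon>_def free_module_iff m0_def lookup_single when_def split: if_splits)
  have sub0: "submod N0" unfolding N0_def by (rule submod_ideal[OF a(1) e])
  have N0fc: "fhom_part a c u \<in> N0" if "u \<in> N0" for c u
  proof -
    have "hom_part a c (\<epsilon> u) \<in> ?I"
      using that additive.zero[OF additive_coeff_sum]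
      by (auto simp: N0_def toric_ideal_iff[OF a(1)] grading.pc_pc[OF grading_hom_part])
    then show ?thesis using that fhom_part_free_module[of u m0 a c] by (simp add: N0_def ehc)
  qed
  have N0r: "fconst u = 0" if "u \<in> N0" for u
  proof (rule free_elem_eqI')
    fix b j and e' :: "'v \<Rightarrow>\<^sub>0 nat"
    have "plookup (plookup u (b, j)) 0 = 0"
    proof (cases "b = 0 \<and> j = 0")
      case True
      \<comment> \<open>By \<open>mdeg_eq_0\<close> the only monomial of degree 0 is 1, so the
        coefficient sum in degree 0, which vanishes on the ideal, is the constant term.\<close>
      have "hom_part a 0 (\<epsilon> u) = Poly_Mapping.single 0 (plookup (\<epsilon> u) 0)"
        using mdeg_eq_0[of a, OF a] by (intro poly_mapping_eqI) (auto simp: lookup_hom_part lookup_single when_def)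
      then have "coeff_sum (hom_part a 0 (\<epsilon> u)) = plookup (\<epsilon> u) 0" by simp
      then show ?thesis using that True by (auto simp: N0_def toric_ideal_iff[OF a(1)] \<epsilon>_def)
    next
      case False
      then have "plookup u (b, j) = 0" using that by (auto simp: N0_def free_module_iff m0_def split: if_splits)
      then show ?thesis by simp
    qed
    then show "plookup (plookup (fconst u) (b, j)) e' = plookup (plookup 0 (b, j)) e'" by (simp add: lookup_const_part)
  qed
  have onto0: "\<exists>u\<in>free_module m0. f - \<epsilon> u \<in> ?I" for f
  proof -
    obtain u where "u \<in> free_module m0" "\<epsilon> u = f" using esurj by blast
    then show ?thesis using toric_ideal_closed(1)[of a] a(1) by (intro bexI[of _ u]) auto
  qed
  have fin0: "\<exists>n. khomology fscale key a fmult (fgraded a m0) (\<lambda>c. N0 \<inter> fgraded a m0 c) p c n" for p c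
  proof -
    have eq: "(\<lambda>c. N0 \<inter> fgraded a m0 c) = (\<lambda>c. {u \<in> fgraded a m0 c. \<epsilon> u \<in> ?I})" by (auto simp: N0_def fgraded_def)
    have "khomology fscale key a fmult (fgraded a m0) (\<lambda>c. {u \<in> fgraded a m0 c. \<epsilon> u \<in> ?I}) p c n
      \<longleftrightarrow> shomology TYPE('k) key {T. c - sum a T \<in> range (mdeg a)} (int p - 1) n" for n
      by (rule tor_simplicial[OF a(1) e edeg onto0])
    then show ?thesis unfolding eq using fin by blast
  qed
  have inv0: "syz_invar a key m0 N0"
    unfolding syz_invar_def using sub0 N0fc N0r fin0 by (auto simp: N0_def m0_def)
  define Q where "Q x y d \<longleftrightarrow> module_hom pm_scale pm_scale d \<and> (\<forall>c. \<forall>u\<in>fgraded a (fst y) c. d u \<in> fgraded a (fst x) c) \<and>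
      d ` free_module (fst y) = snd x \<and> snd y = {u \<in> free_module (fst y). d u = 0}"
    for x y :: "(int ^ 'n \<Rightarrow> nat) \<times> ('n, 'v, 'k) free_elem set" and d
  obtain F where F: "\<And>n. syz_invar a key (fst (F n)) (snd (F n)) \<and> (n = 0 \<longrightarrow> F n = (m0, N0))"
    "\<And>n. \<exists>d. Q (F n) (F (Suc n)) d"
  proof -
    have "\<exists>f. \<forall>n. (syz_invar a key (fst (f n)) (snd (f n)) \<and> (n = 0 \<longrightarrow> f n = (m0, N0))) \<and> (\<exists>d. Q (f n) (f (Suc n)) d)"
    \<comment> \<open>The clause for n = 0 pins down the starting pair; the choice principle itself
      only promises some state satisfying the invariant.\<close>
    proof (rule dependent_nat_choice[where P = "\<lambda>n x. syz_invar a key (fst x) (snd x) \<and> (n = 0 \<longrightarrow> x = (m0, N0))"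
          and Q = "\<lambda>n x y. \<exists>d. Q x y d"])
      show "\<exists>x. syz_invar a key (fst x) (snd x) \<and> (0 = (0 :: nat) \<longrightarrow> x = (m0, N0))"
        using inv0 by auto
    next
      fix x and n :: nat assume "syz_invar a key (fst x) (snd x) \<and> (n = 0 \<longrightarrow> x = (m0, N0))"
      then obtain m' d where "module_hom pm_scale pm_scale d" "\<forall>c. \<forall>u\<in>fgraded a m' c. d u \<in> fgraded a (fst x) c"
        "d ` free_module m' = snd x" "syz_invar a key m' {u \<in> free_module m'. d u = 0}"
        using resolution_step[where a = a, OF a inj] by blast
      then show "\<exists>y. (syz_invar a key (fst y) (snd y) \<and> (Suc n = 0 \<longrightarrow> y = (m0, N0))) \<and> (\<exists>d. Q x y d)"
        by (intro exI[of _ "(m', {u \<in> free_module m'. d u = 0})"]) (auto simp: Q_def)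
    qed
    then show ?thesis using that by blast
  qed
  obtain d where d: "\<And>n. Q (F n) (F (Suc n)) (d n)" using F(2) by metis
  define \<beta> where "\<beta> n = fst (F n)" for n
  have F0: "F 0 = (m0, N0)" using F(1)[of 0] by simp
  have \<beta>0: "\<beta> 0 = m0" by (simp add: \<beta>_def F0)
  have dh: "module_hom pm_scale pm_scale (d i)" and ddeg: "\<And>c u. u \<in> fgraded a (\<beta> (Suc i)) c \<Longrightarrow> d i u \<in> fgraded a (\<beta> i) c"
    and dim: "d i ` free_module (\<beta> (Suc i)) = snd (F i)"
    and ker: "snd (F (Suc i)) = {u \<in> free_module (\<beta> (Suc i)). d i u = 0}" for i
    using d[of i] unfolding Q_def \<beta>_def by blast+
  have "(\<lambda>u. ideal_rel ?I `` {\<epsilon> u}) ` free_module (\<beta> 0) = UNIV // ideal_rel ?I"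
  proof -
    have "(\<lambda>u. ideal_rel ?I `` {\<epsilon> u}) ` free_module (\<beta> 0) = (\<lambda>f. ideal_rel ?I `` {f}) ` (\<epsilon> ` free_module m0)"
      by (simp add: image_image \<beta>0)
    also have "\<epsilon> ` free_module m0 = UNIV" using esurj by (auto simp: image_iff) metis
    finally show ?thesis by (auto simp: quotient_def)
  qed
  moreover have "d 0 ` free_module (\<beta> 1) = {u \<in> free_module (\<beta> 0). \<epsilon> u \<in> ?I}"
    using dim[of 0] by (simp add: F0 N0_def \<beta>0)
  ultimately have "free_resolution a ?I \<beta> \<epsilon> d"
    unfolding free_resolution_def using e dh edeg ddeg dim ker by (auto simp: fgraded_def \<beta>0)
  moreover have "plookup (plookup (d i u) x) 0 = 0" if "u \<in> free_module (\<beta> (Suc i))" for i u x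
  proof -
    have "d i u \<in> snd (F i)" using that dim by blast
    then have "fconst (d i u) = 0" using F(1)[of i] unfolding syz_invar_def by blast
    then have "plookup (plookup (fconst (d i u)) x) 0 = 0" by simp
    then show ?thesis by (simp add: lookup_const_part)
  qed
  ultimately show ?thesis unfolding minimal_free_resolution_def by blast
qed

section \<open>Pile complexes\<close>

lemma lookup_boundary:
  fixes a :: "'v::finite \<Rightarrow> 'x::countable" and f :: "'x set \<Rightarrow>\<^sub>0 'k::field"
  assumes inj: "inj a" and f: "pkeys f \<subseteq> range (image a)"
  shows "plookup (boundary f) (a ` T) = bd (\<lambda>v. to_nat (a v)) (\<lambda>T. plookup f (a ` T)) T"
proof -
  let ?key = "\<lambda>v. to_nat (a v)"
  have ia: "inj (image a)" by (rule injI) (simp add: inj_image_eq_iff[OF inj])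
  have sgn: "(- 1) ^ card {y \<in> a ` S. to_nat y < to_nat (a v)} * r = signed (num_before ?key S v) r" for S v and r :: 'k
  proof -
    have "{y \<in> a ` S. to_nat y < to_nat (a v)} = a ` {w \<in> S. ?key w < ?key v}" by auto
    then have "card {y \<in> a ` S. to_nat y < to_nat (a v)} = num_before ?key S v"
      unfolding num_before_def by (simp add: card_image inj_on_subset[OF inj])
    then show ?thesis by (simp add: signed_def)
  qed
  define h where "h F = (\<Sum>x\<in>F. Poly_Mapping.single (F - {x}) ((-1) ^ card {y\<in>F. to_nat y < to_nat x} * plookup f F))" for F
  have "boundary f = sum h (pkeys f)" by (simp add: boundary_def h_def)
  also have "\<dots> = sum h (range (image a))"
    by (rule sum.mono_neutral_left) (use f in \<open>auto simp: h_def in_keys_iff\<close>)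
  also have "\<dots> = (\<Sum>S\<in>UNIV. h (a ` S))" by (simp add: sum.reindex[OF ia])
  also have "\<dots> = (\<Sum>S\<in>UNIV. \<Sum>v\<in>S. Poly_Mapping.single (a ` (S - {v})) (signed (num_before ?key S v) (plookup f (a ` S))))"
  proof (rule sum.cong[OF refl])
    fix S
    have "h (a ` S) = (\<Sum>v\<in>S. Poly_Mapping.single (a ` S - {a v}) ((-1) ^ card {y\<in>a ` S. to_nat y < to_nat (a v)} * plookup f (a ` S)))"
      unfolding h_def by (subst sum.reindex) (auto intro: inj_on_subset[OF inj])
    also have "\<dots> = (\<Sum>v\<in>S. Poly_Mapping.single (a ` (S - {v})) (signed (num_before ?key S v) (plookup f (a ` S))))"
      unfolding sgn by (simp add: image_set_diff[OF inj])
    finally show "h (a ` S) = \<dots>" .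
  qed
  finally have "plookup (boundary f) (a ` T)
      = (\<Sum>S\<in>UNIV. \<Sum>v\<in>S. if S - {v} = T then signed (num_before ?key S v) (plookup f (a ` S)) else 0)"
    by (simp add: lookup_sum lookup_single when_def inj_image_eq_iff[OF inj])
  also have "\<dots> = (\<Sum>(S,v)\<in>(SIGMA S:UNIV. S). if S - {v} = T then signed (num_before ?key S v) (plookup f (a ` S)) else 0)"
    by (simp add: sum.Sigma)
  also have "\<dots> = (\<Sum>(S,v)\<in>(\<lambda>v. (insert v T, v)) ` (- T). signed (num_before ?key S v) (plookup f (a ` S)))"
    by (rule sum.mono_neutral_cong_right) (auto simp: insert_absorb)
  also have "\<dots> = (\<Sum>v\<in>-T. signed (num_before ?key (insert v T) v) (plookup f (a ` insert v T)))"
    by (subst sum.reindex) (auto simp: inj_on_def)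
  also have "\<dots> = bd ?key (\<lambda>T. plookup f (a ` T)) T"
    unfolding bd_apply by (intro sum.cong) (auto simp: num_before_insert)
  finally show ?thesis .
qed

text \<open>Formal combinations of subsets of \<open>range a\<close> correspond to functions on sets
  of indices, and the orientation by \<open>to_nat\<close> becomes the key
  \<open>to_nat (a v)\<close>. The truncated difference of dimensions is then exact because
  boundaries are cycles.\<close>

lemma reduced_homology_dim_eq:
  fixes a :: "'v::finite \<Rightarrow> 'x::countable" and K :: "'x set set"
  assumes inj: "inj a" and K: "\<And>F. F \<in> K \<Longrightarrow> F \<subseteq> range a" and dK: "down_closed K"
    and n: "shomology TYPE('k::field) (\<lambda>v. to_nat (a v)) {T. a ` T \<in> K} p n"
  shows "reduced_homology_dim TYPE('k) K p = n"
proof -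
  let ?key = "\<lambda>v. to_nat (a v)" and ?K = "{T. a ` T \<in> K}"
  have ikey: "inj ?key" using inj by (simp add: inj_def)
  have dK': "down_closed ?K" 
    unfolding down_closed_def
  proof (intro ballI allI impI)
    fix T S assume "T \<in> ?K" "S \<subseteq> T"
    moreover have "a ` S \<subseteq> a ` T" using \<open>S \<subseteq> T\<close> by (rule image_mono)
    ultimately show "S \<in> ?K" using dK unfolding down_closed_def by blast
  qed
  define \<Phi> :: "('x set \<Rightarrow>\<^sub>0 'k) \<Rightarrow> 'v set \<Rightarrow> 'k" where "\<Phi> f T = plookup f (a ` T)" for f T
  interpret pm: vector_space "pm_scale :: 'k \<Rightarrow> ('x set \<Rightarrow>\<^sub>0 'k) \<Rightarrow> _" by (rule vector_space_pm_scale)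
  have keysK: "F \<in> range (image a)" if "F \<in> K" for F
    using K[OF that] by (metis rangeI subset_image_iff)
  have card_a: "card (a ` T) = card T" for T by (rule card_image) (rule inj_on_subset[OF inj subset_UNIV])
  have ch: "pkeys f \<subseteq> range (image a)" if "f \<in> chains K q" for f :: "'x set \<Rightarrow>\<^sub>0 'k" and q
    using that keysK by (auto simp: chains_def)
  have chi: "f \<in> chains K q \<longleftrightarrow> pkeys f \<subseteq> range (image a) \<and> \<Phi> f \<in> schains ?K q" for f q
  proof
    assume f: "f \<in> chains K q"
    then show "pkeys f \<subseteq> range (image a) \<and> \<Phi> f \<in> schains ?K q"
    proof (intro conjI ch[OF f], unfold schains_iff, intro allI impI)
      fix T assume "\<Phi> f T \<noteq> 0"
      then have "a ` T \<in> pkeys f" by (simp add: \<Phi>_def in_keys_iff)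
      then have "a ` T \<in> K" "int (card (a ` T)) = q + 1" using f unfolding chains_def by blast+
      then show "T \<in> ?K \<and> int (card T) = q + 1" by (simp add: card_a)
    qed
  next
    assume f: "pkeys f \<subseteq> range (image a) \<and> \<Phi> f \<in> schains ?K q"
    show "f \<in> chains K q" unfolding chains_def
    proof (intro CollectI ballI)
      fix F assume F: "F \<in> pkeys f"
      then obtain T where "F = a ` T" using f by blast
      then show "F \<in> K \<and> finite F \<and> int (card F) = q + 1"
        using F f by (auto simp: schains_iff \<Phi>_def in_keys_iff card_a)
    qed
  qed
  have eqI: "f = g" if "pkeys f \<subseteq> range (image a)" "pkeys g \<subseteq> range (image a)" "\<Phi> f = \<Phi> g" for f g
  proof (rule poly_mapping_eqI)
    fix F
    show "plookup f F = plookup g F"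
    proof (cases "F \<in> range (image a)")
      case True
      then show ?thesis using that(3) by (auto simp: \<Phi>_def fun_eq_iff)
    next
      case False
      then show ?thesis using that(1,2) by (metis in_keys_iff subsetD)
    qed
  qed
  have surj: "\<exists>f. f \<in> chains K q \<and> \<Phi> f = u" if u: "u \<in> schains ?K q" for u q
  proof -
    define f where "f = (\<Sum>T\<in>UNIV. Poly_Mapping.single (a ` T) (u T))"
    have \<Phi>: "\<Phi> f = u"
      by (auto simp: \<Phi>_def f_def fun_eq_iff lookup_sum lookup_single when_def inj_image_eq_iff[OF inj])
    have "pkeys f \<subseteq> range (image a)"
    proof
      fix F assume "F \<in> pkeys f"
      then have "(\<Sum>T\<in>UNIV. plookup (Poly_Mapping.single (a ` T) (u T)) F) \<noteq> 0"
        by (simp add: in_keys_iff f_def lookup_sum)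
      then obtain T where "plookup (Poly_Mapping.single (a ` T) (u T)) F \<noteq> 0" by (meson sum.neutral)
      then show "F \<in> range (image a)" by (auto simp: lookup_single when_def split: if_splits)
    qed
    then show ?thesis using \<Phi> u chi by blast
  qed
  have bdry: "\<Phi> (boundary f) = bd ?key (\<Phi> f)" if "f \<in> chains K q" for f q
    using lookup_boundary[OF inj ch[OF that]] by (simp add: \<Phi>_def[abs_def])
  have bkeys: "pkeys (boundary f) \<subseteq> range (image a)" if "f \<in> chains K q" for f :: "'x set \<Rightarrow>\<^sub>0 'k" and q
  proof
    fix G assume G: "G \<in> pkeys (boundary f)"
    let ?s = "\<lambda>F x. Poly_Mapping.single (F - {x}) ((-1) ^ card {y\<in>F. to_nat y < to_nat x} * plookup f F)"
    have "\<exists>F\<in>pkeys f. \<exists>x\<in>F. plookup (?s F x) G \<noteq> 0"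
    proof (rule ccontr)
      assume *: "\<not> (\<exists>F\<in>pkeys f. \<exists>x\<in>F. plookup (?s F x) G \<noteq> 0)"
      have "plookup (boundary f) G = 0"
        unfolding boundary_def lookup_sum by (intro sum.neutral ballI) (use * in blast)
      then show False using G by (simp add: in_keys_iff)
    qed
    then obtain F x where Fx: "F \<in> pkeys f" "x \<in> F" "plookup (?s F x) G \<noteq> 0" by blast
    then have "G = F - {x}" by (auto simp: lookup_single when_def split: if_splits)
    moreover have "F \<in> K" using Fx(1) that by (auto simp: chains_def)
    ultimately have "G \<in> K" using dK unfolding down_closed_def by blast
    then show "G \<in> range (image a)" by (rule keysK)
  qed
  have \<Phi>0: "\<Phi> 0 = 0" by (simp add: \<Phi>_def fun_eq_iff)
  \<comment> \<open>The condition on the support is essential: \<Phi> does not see faces outside the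
    image of a and is injective only on combinations supported there.\<close>
  define V :: "('v set \<Rightarrow> 'k) set \<Rightarrow> ('x set \<Rightarrow>\<^sub>0 'k) set" where "V U = {f. pkeys f \<subseteq> range (image a) \<and> \<Phi> f \<in> U}" for U
  have cyc: "cycles K p = V (scycles ?key ?K p)"
  proof (intro equalityI subsetI)
    fix f :: "'x set \<Rightarrow>\<^sub>0 'k" assume "f \<in> cycles K p"
    then have f: "f \<in> chains K p" "boundary f = 0" by (auto simp: cycles_def)
    then have "bd ?key (\<Phi> f) = 0" using bdry[OF f(1)] \<Phi>0 by simp
    then show "f \<in> V (scycles ?key ?K p)" using f(1) chi by (simp add: scycles_def V_def)
  next
    fix f :: "'x set \<Rightarrow>\<^sub>0 'k" assume f: "f \<in> V (scycles ?key ?K p)"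
    then have fhom_part: "f \<in> chains K p" using chi by (simp add: scycles_def V_def)
    have "\<Phi> (boundary f) = \<Phi> 0" unfolding bdry[OF fhom_part] \<Phi>0 using f by (simp add: scycles_def V_def)
    then have "boundary f = 0" by (intro eqI bkeys[OF fhom_part]) simp_all
    then show "f \<in> cycles K p" using fhom_part by (simp add: cycles_def)
  qed
  have bnd: "boundaries K p = V (sbounds ?key ?K p)"
  proof (intro equalityI subsetI)
    fix f :: "'x set \<Rightarrow>\<^sub>0 'k" assume "f \<in> boundaries K p"
    then obtain g :: "'x set \<Rightarrow>\<^sub>0 'k" where g: "g \<in> chains K (p + 1)" "f = boundary g" by (auto simp: boundaries_def)
    then show "f \<in> V (sbounds ?key ?K p)" using bkeys[OF g(1)] bdry[OF g(1)] chi by (auto simp: sbounds_def V_def)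
  next
    fix f :: "'x set \<Rightarrow>\<^sub>0 'k" assume f: "f \<in> V (sbounds ?key ?K p)"
    then obtain y where y: "y \<in> schains ?K (p + 1)" "\<Phi> f = bd ?key y" by (auto simp: V_def sbounds_def)
    then obtain g where g: "g \<in> chains K (p + 1)" "\<Phi> g = y" using surj by blast
    have "f = boundary g"
      by (rule eqI) (use f bkeys[OF g(1)] bdry[OF g(1)] g y in \<open>auto simp: V_def\<close>)
    then show "f \<in> boundaries K p" using g(1) by (auto simp: boundaries_def)
  qed
  have \<Phi>d: "\<Phi> (f - g) = \<Phi> f - \<Phi> g" and \<Phi>a: "\<Phi> (f + g) = \<Phi> f + \<Phi> g"
    and \<Phi>s: "\<Phi> (pm_scale r f) = fun_scale (*) r (\<Phi> f)" for f g r
    by (simp_all add: \<Phi>_def fun_eq_iff lookup_minus lookup_add)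
  have kd: "pkeys (f - g) \<subseteq> range (image a)" and ka: "pkeys (f + g) \<subseteq> range (image a)"
    if "pkeys f \<subseteq> range (image a)" "pkeys g \<subseteq> range (image a)" for f g :: "'x set \<Rightarrow>\<^sub>0 'k"
    using that by (auto simp: subset_iff in_keys_iff lookup_minus lookup_add) (metis add.right_neutral diff_0_right)+
  have ks: "pkeys (pm_scale r f) \<subseteq> range (image a)"
    if "pkeys f \<subseteq> range (image a)" for f :: "'x set \<Rightarrow>\<^sub>0 'k" and r
    using that by (auto simp: subset_iff in_keys_iff)
  have subsp: "pm.subspace (V U)" if "fvs.subspace U" for U
    unfolding pm.subspace_def V_def
    by (intro conjI ballI allI CollectI)
      (simp_all add: \<Phi>0 \<Phi>a \<Phi>s ka ks fvs.subspace_0[OF that] fvs.subspace_add[OF that] fvs.subspace_scale[OF that])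
  have fin: "V (scycles ?key ?K p) \<subseteq> pm.span ((\<lambda>T. Poly_Mapping.single (a ` T) 1) ` UNIV)"
  proof
    fix f assume "f \<in> V (scycles ?key ?K p)"
    then have k: "pkeys f \<subseteq> range (image a)" by (simp add: V_def)
    have "f = (\<Sum>F\<in>pkeys f. pm_scale (plookup f F) (Poly_Mapping.single F 1))"
      by (subst (1) poly_mapping_expand) (intro sum.cong refl poly_mapping_eqI, simp add: lookup_single when_def)
    also have "\<dots> \<in> pm.span ((\<lambda>T. Poly_Mapping.single (a ` T) 1) ` UNIV)"
      using k by (intro pm.span_sum pm.span_scale pm.span_base) auto
    finally show "f \<in> pm.span ((\<lambda>T. Poly_Mapping.single (a ` T) 1) ` UNIV)" .
  qed
  have "quot_dim pm_scale (cycles K p) (boundaries K p :: ('x set \<Rightarrow>\<^sub>0 'k) set) n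
      \<longleftrightarrow> quot_dim (fun_scale (*)) (scycles ?key ?K p :: ('v set \<Rightarrow> 'k) set) (sbounds ?key ?K p) n"
    unfolding cyc bnd
  proof (rule quot_dim_transfer[where R = "\<lambda>f u. f \<in> V (scycles ?key ?K p) \<and> u = \<Phi> f"])
    show "0 \<in> V (scycles ?key ?K p) \<and> 0 = \<Phi> 0"
      using fvs.subspace_0[OF subspace_scycles] by (simp add: V_def \<Phi>0)
    show "\<exists>f. f \<in> V (scycles ?key ?K p) \<and> u = \<Phi> f" if u: "u \<in> scycles ?key ?K p" for u
    proof -
      have "u \<in> schains ?K p" using u by (simp add: scycles_def)
      then obtain f where "f \<in> chains K p" "\<Phi> f = u" using surj by blast
      then show ?thesis using u chi by (auto simp: V_def)
    qed
  qed (simp_all add: V_def \<Phi>d \<Phi>s kd ks fvs.subspace_diff[OF subspace_scycles] fvs.subspace_scale[OF subspace_scycles])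
  then have "quot_dim pm_scale (cycles K p) (boundaries K p :: ('x set \<Rightarrow>\<^sub>0 'k) set) n"
    using n by (simp add: shomology_def)
  moreover have "quot_dim pm_scale (V (scycles ?key ?K p)) (V (sbounds ?key ?K p)) n
      \<longleftrightarrow> pm.dim (V (scycles ?key ?K p)) = pm.dim (V (sbounds ?key ?K p)) + n"
  proof (rule pm.quot_dim_iff_dim[OF subsp[OF subspace_scycles] subsp[OF subspace_sbounds] _ _ fin])
    show "V (sbounds ?key ?K p) \<subseteq> V (scycles ?key ?K p)"
      unfolding V_def using subsetD[OF sbounds_subset_scycles[OF ikey dK']] by blast
  qed simp
  ultimately have "pm.dim (cycles K p) = pm.dim (boundaries K p) + n" unfolding cyc bnd by blast
  then show ?thesis by (simp add: reduced_homology_dim_def)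
qed

section \<open>From Betti numbers to the homology of pile complexes\<close>

lemma nat_span_range:
  fixes a :: "'v::finite \<Rightarrow> int ^ 'n"
  assumes "inj a"
  shows "nat_span (range a) = range (mdeg a)"
proof (intro equalityI subsetI)
  fix x assume "x \<in> nat_span (range a)"
  then obtain k where "x = (\<Sum>y\<in>range a. of_nat (k y) *s y)" by (auto simp: nat_span_def)
  then have "x = mdeg a (Abs_poly_mapping (\<lambda>v. k (a v)))"
    by (simp add: mdeg_def sum.reindex[OF assms])
  then show "x \<in> range (mdeg a)" by blast
next
  fix x assume "x \<in> range (mdeg a)"
  then obtain e where "x = mdeg a e" by blast
  then have "x = (\<Sum>y\<in>range a. of_nat (plookup e (inv a y)) *s y)"
    by (simp add: mdeg_def sum.reindex[OF assms] inv_f_f[OF assms])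
  then show "x \<in> nat_span (range a)"
    unfolding nat_span_def by (intro CollectI exI[of _ "\<lambda>y. plookup e (inv a y)"]) simp
qed

lemma group_closure_sum_mem:
  assumes "finite T" "\<And>v. v \<in> T \<Longrightarrow> f v \<in> group_closure A" shows "sum f T \<in> group_closure A"
  using assms by (induction T) (auto intro: group_closure_add)

lemma mdeg_sum: "mdeg a (sum f I) = (\<Sum>i\<in>I. mdeg a (f i))"
  by (induction I rule: infinite_finite_induct) (simp_all add: mdeg_add)

text \<open>The definite description is proper: a minimal resolution exists, and any two have the
  same multiplicities because both equal the dimension of one homology space that mentions no
  resolution.\<close>

lemma betti_shomology:
  fixes a :: "'v::finite \<Rightarrow> int ^ 'n"
  assumes a: "\<And>v. 0 \<le> a v" "\<And>v. a v \<noteq> 0" and inj: "inj key"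
  shows "shomology TYPE('k::field) key {T. c - sum a T \<in> range (mdeg a)} (int i - 1)
    (betti a (toric_ideal a :: ('v, 'k) mpoly set) i c)"
proof -
  have down_closed: "down_closed {T. c - sum a T \<in> range (mdeg a)}" for c
    unfolding down_closed_def
  proof (intro ballI allI impI)
    fix T S assume T: "T \<in> {T. c - sum a T \<in> range (mdeg a)}" and S: "S \<subseteq> T"
    then obtain e where e: "c - sum a T = mdeg a e" by blast
    have "c - sum a S = mdeg a (e + (\<Sum>v\<in>T - S. var v))"
      using sum.subset_diff[OF S, of a] by (simp add: mdeg_add mdeg_sum e[symmetric])
    then show "S \<in> {T. c - sum a T \<in> range (mdeg a)}" by blast
  qed
  let ?I = "toric_ideal a :: ('v, 'k) mpoly set"
  have shomology: "shomology TYPE('k) key {T. c - sum a T \<in> range (mdeg a)} (int i - 1) (\<beta> i c)"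
    if "minimal_free_resolution a ?I \<beta> \<epsilon> d" for \<beta> \<epsilon> d
    by (rule minimal_free_resolution_shomology[OF a(1) inj that])
  obtain \<beta> \<epsilon> d where res: "minimal_free_resolution a ?I \<beta> \<epsilon> d"
    using minimal_free_resolution_exists[where a = a, OF a inj shomology_exists[OF inj down_closed]] by blast
  have "betti a ?I i c = \<beta> i c"
    unfolding betti_def
  proof (rule the_equality)
    show "\<exists>\<beta>' \<epsilon> d. minimal_free_resolution a ?I \<beta>' \<epsilon> d \<and> \<beta>' i c = \<beta> i c" using res by blast
    show "b = \<beta> i c" if "\<exists>\<beta>' \<epsilon> d. minimal_free_resolution a ?I \<beta>' \<epsilon> d \<and> \<beta>' i c = b" for b
      using that shomology_unique[OF inj down_closed shomology shomology[OF res]] by blast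
  qed
  then show ?thesis using shomology[OF res] by simp
qed

text \<open>Bookkeeping of degrees: the divisor complex contributes in degree i - 1, Alexander
  duality on N + 1 vertices sends this to N - i - 1, and passing from the union over n + 1
  coordinates to the intersection lowers it by n.\<close>

lemma betti_eq_pile_homology:
  fixes a :: "'v::finite \<Rightarrow> int ^ 'n" and n N :: nat
  assumes n: "CARD('n) = n + 1" and N: "CARD('v) = N + 1" and inj: "inj a"
    and a: "\<And>v. 0 \<le> a v" "\<And>v. a v \<noteq> 0"
    and axis: "\<And>i. \<exists>v. \<forall>j. j \<noteq> i \<longrightarrow> a v $ j = 0"
    and c1: "condition1 (range a)" and c: "c \<in> int_span (range a)"
  shows "betti a (toric_ideal a :: ('v, 'k::field) mpoly set) i c =
    reduced_homology_dim TYPE('k) (pile_complex (range a) (\<Sum>(range a) - c - 1)) (int N - int n - int i - 1)"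
proof (rule reduced_homology_dim_eq[OF inj, symmetric])
  define key where "key v = to_nat (a v)" for v
  have ikey: "inj key" using inj by (simp add: inj_def key_def)
  define t where "t = \<Sum>(range a)"
  have t: "t = sum a UNIV" unfolding t_def by (simp add: sum.reindex[OF inj])
  have mono: "sum a S $ j \<le> sum a T $ j" if "S \<subseteq> T" for S T j
    unfolding sum_component by (rule sum_mono2) (use that a(1) in \<open>auto simp: less_eq_vec_def\<close>)
  have S_im: "\<Sum>(a ` T) = sum a T" for T by (simp add: sum.reindex[OF inj_on_subset[OF inj subset_UNIV]])
  show "down_closed (pile_complex (range a) (\<Sum>(range a) - c - 1))"
    unfolding down_closed_def
  proof (intro ballI allI impI)
    fix F G assume F: "F \<in> pile_complex (range a) (\<Sum>(range a) - c - 1)" and "G \<subseteq> F"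
    then obtain T where T: "F = a ` T" by (auto simp: pile_complex_def subset_image_iff)
    then obtain S where S: "G = a ` S" "S \<subseteq> T" using \<open>G \<subseteq> F\<close> by (auto simp: subset_image_iff)
    have "\<Sum>G \<le> \<Sum>F" unfolding T S(1) S_im using mono[OF S(2)] by (simp add: less_eq_vec_def)
    then show "G \<in> pile_complex (range a) (\<Sum>(range a) - c - 1)"
      using F \<open>G \<subseteq> F\<close> unfolding pile_complex_def by (blast intro: order_trans)
  qed
  \<comment> \<open>The pile condition at t - c - 1 imposed in coordinate j alone; the intersection
    over all j is the pile complex.\<close>
  define X where "X j = {T. sum a T $ j \<le> (t - c - 1) $ j}" for j
  define \<Gamma> where "\<Gamma> = {T. sum a T \<le> c}"
  let ?b = "betti a (toric_ideal a :: ('v, 'k) mpoly set) i c"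
  have "c - sum a T \<in> range (mdeg a) \<longleftrightarrow> sum a T \<le> c" for T
  proof -
    have "sum a T \<in> int_span (range a)"
      by (rule group_closure_sum_mem) (auto intro: group_closure.base)
    then have "c - sum a T \<in> int_span (range a)" using c by (rule group_closure.diff[rotated])
    moreover have "0 \<le> c - sum a T \<longleftrightarrow> sum a T \<le> c" by (simp add: less_eq_vec_def)
    ultimately show ?thesis
      using c1 unfolding condition1_def nat_span_range[OF inj] by auto
  qed
  then have "shomology TYPE('k) key \<Gamma> (int i - 1) ?b"
    using betti_shomology[where a = a and c = c and i = i, OF a ikey] by (simp add: \<Gamma>_def)
  moreover have "down_closed \<Gamma>"
    unfolding down_closed_def \<Gamma>_def less_eq_vec_def using mono by (blast intro: order_trans)
  ultimately have "shomology TYPE('k) key {T. - T \<notin> \<Gamma>} (int N - int i - 1) ?b"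
    using alexander[OF ikey, where ?'k = 'k and G = \<Gamma> and j = "int i - 1" and n = ?b] by (simp add: N algebra_simps)
  also have "{T. - T \<notin> \<Gamma>} = (\<Union>j\<in>UNIV. X j)"
  proof (intro set_eqI)
    fix T
    have "sum a (- T) = t - sum a T"
      using sum.subset_diff[of T UNIV a] by (simp add: t Compl_eq_Diff_UNIV)
    then have "sum a (- T) $ j = t $ j - sum a T $ j" for j by (simp only: vector_minus_component)
    then have "- T \<notin> \<Gamma> \<longleftrightarrow> (\<exists>j. \<not> t $ j - sum a T $ j \<le> c $ j)"
      by (simp only: \<Gamma>_def less_eq_vec_def mem_Collect_eq not_all)
    also have "\<dots> \<longleftrightarrow> (\<exists>j. sum a T $ j \<le> t $ j - c $ j - 1)" by (rule iff_exI) auto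
    finally show "T \<in> {T. - T \<notin> \<Gamma>} \<longleftrightarrow> T \<in> (\<Union>j\<in>UNIV. X j)" by (simp add: X_def)
  qed
  finally have union: "shomology TYPE('k) key (\<Union>j\<in>UNIV. X j) ((int N - int n - int i - 1) + int CARD('n) - 1) ?b"
    by (simp add: n algebra_simps)
  have "shomology TYPE('k) key (\<Union>j\<in>UNIV. X j) ((int N - int n - int i - 1) + int CARD('n) - 1) ?b
      \<longleftrightarrow> shomology TYPE('k) key (\<Inter>j\<in>UNIV. X j) (int N - int n - int i - 1) ?b"
  proof (rule nerve[OF ikey])
    show "down_closed (X j)" for j
      unfolding down_closed_def X_def using mono by (blast intro: order_trans)
    show "acyclic_cx TYPE('k) key (\<Inter>j\<in>I. X j)" if I: "I \<subset> UNIV" for I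
    proof -
      obtain k where k: "k \<notin> I" using I by blast
      \<comment> \<open>This v lies on axis k, and k is not in I, so adding v disturbs none of the
        constraints in I: it is the apex of a cone.\<close>
      obtain v where v: "\<And>j. j \<noteq> k \<Longrightarrow> a v $ j = 0" using axis by blast
      show ?thesis
      proof (rule acyclic_cx_cone[OF ikey])
        fix T assume T: "T \<in> (\<Inter>j\<in>I. X j)"
        have "sum a (insert v T) $ j = sum a T $ j" if "j \<in> I" for j
          using v[of j] k that by (cases "v \<in> T") (auto simp: insert_absorb)
        then show "insert v T \<in> (\<Inter>j\<in>I. X j)" using T by (auto simp: X_def)
      qed
    qed
  qed auto
  then have "shomology TYPE('k) key (\<Inter>j\<in>UNIV. X j) (int N - int n - int i - 1) ?b" using union by blast
  also have "(\<Inter>j\<in>UNIV. X j) = {T. a ` T \<in> pile_complex (range a) (\<Sum>(range a) - c - 1)}"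
  proof -
    have "a ` T \<in> pile_complex (range a) (\<Sum>(range a) - c - 1) \<longleftrightarrow> sum a T \<le> t - c - 1" for T
      unfolding pile_complex_def mem_Collect_eq S_im t_def by blast
    then show ?thesis by (simp only: X_def less_eq_vec_def) blast
  qed
  finally show "shomology TYPE('k) (\<lambda>v. to_nat (a v)) {T. a ` T \<in> pile_complex (range a) (\<Sum>(range a) - c - 1)}
     (int N - int n - int i - 1) ?b" by (simp add: key_def[abs_def])
qed (auto simp: pile_complex_def)

section \<open>Vertices of the weighted simplex and the final theorem\<close>

definition axis_vertex :: "nat \<Rightarrow> nat ^ 'n \<Rightarrow> 'n \<Rightarrow> int ^ 'n" where
  "axis_vertex d q i = (\<chi> j. if j = i then int (d * Lcm (range (($) q)) div q $ i) else 0)"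

text \<open>The integer division in \<open>axis_vertex\<close> is exact because each weight divides
  the least common multiple.\<close>

lemma axis_vertex_mem:
  fixes q :: "nat ^ 'n"
  shows "rvec (axis_vertex d q i) \<in> weighted_simplex d q"
proof -
  let ?r = "Lcm (range (($) q))"
  have "q $ i dvd d * ?r" by (intro dvd_mult dvd_Lcm) simp
  then have "real (q $ i) * real (d * ?r div q $ i) = real (d * ?r)"
    by (metis dvd_mult_div_cancel of_nat_mult)
  then have "(\<Sum>j\<in>UNIV. real (q $ j) * rvec (axis_vertex d q i) $ j) = real (d * ?r)"
    by (simp add: rvec_def axis_vertex_def if_distrib[of real_of_int] if_distrib[of "\<lambda>x. _ * x"] cong: if_cong)
  then show ?thesis by (simp add: weighted_simplex_def) (simp add: rvec_def axis_vertex_def)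
qed

lemma axis_vertex_extreme:
  fixes q :: "nat ^ 'n"
  assumes q: "weights_vector q"
  shows "rvec (axis_vertex d q i) extreme_point_of weighted_simplex d q"
  unfolding extreme_point_of_def
proof (intro conjI ballI axis_vertex_mem)
  fix x y assume x: "x \<in> weighted_simplex d q" and y: "y \<in> weighted_simplex d q"
  let ?w = "rvec (axis_vertex d q i)"
  show "?w \<notin> open_segment x y"
  proof
    assume "?w \<in> open_segment x y"
    then obtain u where u: "x \<noteq> y" "0 < u" "u < 1" "?w = (1 - u) *\<^sub>R x + u *\<^sub>R y"
      by (auto simp: in_segment)
    \<comment> \<open>A combination of nonnegative numbers with positive weights vanishes only if
      both numbers do; afterwards the equation of the simplex determines the remaining
      coordinate.\<close>
    have z: "x $ j = 0 \<and> y $ j = 0" if "j \<noteq> i" for j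
    proof -
      have "0 = (1 - u) * x $ j + u * y $ j"
        using arg_cong[OF u(4), of "\<lambda>z. z $ j"] that by (simp add: rvec_def axis_vertex_def)
      moreover have "0 \<le> (1 - u) * x $ j" "0 \<le> u * y $ j"
        using x y u by (auto simp: weighted_simplex_def)
      ultimately have "(1 - u) * x $ j = 0" "u * y $ j = 0" by linarith+
      then show ?thesis using u by simp
    qed
    have "real (q $ i) * z $ i = real (d * Lcm (range (($) q)))"
      if "z \<in> weighted_simplex d q" "\<And>j. j \<noteq> i \<Longrightarrow> z $ j = 0" for z
    proof -
      have "(\<Sum>j\<in>UNIV. real (q $ j) * z $ j) = (\<Sum>j\<in>UNIV. if j = i then real (q $ i) * z $ i else 0)"
        by (intro sum.cong) (auto simp: that(2))
      then show ?thesis using that(1) by (simp add: weighted_simplex_def)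
    qed
    then have "real (q $ i) * x $ i = real (q $ i) * y $ i" using x y z by simp
    moreover have "0 < q $ i" using q unfolding weights_vector_def by blast
    ultimately have "x $ i = y $ i" by simp
    then have "x = y" using z by (auto simp: vec_eq_iff) metis
    then show False using u(1) by simp
  qed
qed

theorem theorem7:
  fixes A :: "(int ^ 'n) set"
    and a :: "'v::finite \<Rightarrow> int ^ 'n"
    and n N :: nat
  assumes "CARD('n) = n + 1"
    and "CARD('v) = N + 1"
    and "inj a"
    and "A = range a"
  shows
    "((\<forall>x\<in>A. 0 \<le> x) \<and> homogeneous A \<and> span (rvec ` A) = UNIV \<and>
        condition1 A \<and> condition2 A \<and> condition3 A \<and> condition4 A \<longrightarrow>
      (\<forall>c\<in>int_span A. \<forall>i.
         betti a (toric_ideal a :: ('v, 'k::field) mpoly set) i c =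
         reduced_homology_dim TYPE('k) (pile_complex A (\<Sum>A - c - 1))
           (int N - int n - int i - 1)))
     \<and>
     (\<forall>d q. 1 \<le> d \<and> weights_vector q \<and> A = {x. rvec x \<in> weighted_simplex d q} \<and> condition1 A \<longrightarrow>
      (\<forall>c\<in>int_span A. \<forall>i.
         betti a (toric_ideal a :: ('v, 'k::field) mpoly set) i c =
         reduced_homology_dim TYPE('k) (pile_complex A (\<Sum>A - c - 1))
           (int N - int n - int i - 1)))"
proof -
  \<comment> \<open>Both halves reduce to this: nonnegative, nonzero elements make the grading
    positive, and an element on each axis provides the cone apices.\<close>
  have core: "\<forall>c\<in>int_span A. \<forall>i. betti a (toric_ideal a :: ('v, 'k) mpoly set) i c =
         reduced_homology_dim TYPE('k) (pile_complex A (\<Sum>A - c - 1)) (int N - int n - int i - 1)"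
    if nonneg: "\<forall>x\<in>A. 0 \<le> x" and nz: "0 \<notin> A" and c1: "condition1 A"
      and axis: "\<And>i. \<exists>x\<in>A. \<forall>j. j \<noteq> i \<longrightarrow> x $ j = 0"
  proof (intro ballI allI)
    fix c i assume c: "c \<in> int_span A"
    have "0 \<le> a v" for v using nonneg unfolding assms(4) by blast
    moreover have "a v \<noteq> 0" for v using nz unfolding assms(4) by (metis rangeI)
    moreover have "\<exists>v. \<forall>j. j \<noteq> i \<longrightarrow> a v $ j = 0" for i using axis[of i] unfolding assms(4) by blast
    ultimately show "betti a (toric_ideal a :: ('v, 'k) mpoly set) i c =
         reduced_homology_dim TYPE('k) (pile_complex A (\<Sum>A - c - 1)) (int N - int n - int i - 1)"
      using c1 c unfolding assms(4) by (intro betti_eq_pile_homology[OF assms(1-3)])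
  qed
  show ?thesis
  proof (intro conjI impI allI)
    assume h: "(\<forall>x\<in>A. 0 \<le> x) \<and> homogeneous A \<and> span (rvec ` A) = UNIV \<and>
        condition1 A \<and> condition2 A \<and> condition3 A \<and> condition4 A"
    \<comment> \<open>The functional \<omega> takes the value 0 at the zero vector, but 1 on
      A.\<close>
    have "0 \<notin> A" using h by (auto simp: homogeneous_def)
    moreover have "\<exists>x\<in>A. \<forall>j. j \<noteq> i \<longrightarrow> x $ j = 0" for i
    proof -
      obtain d q L where L: "weights_vector q" "{v. v extreme_point_of weighted_simplex d q} \<subseteq> rvec ` L"
        "A = {x \<in> L. rvec x \<in> weighted_simplex d q}"
        using h unfolding condition3_def by blast
      \<comment> \<open>The lattice in condition (3) contains all extreme points of the dilated
        simplex, hence its vertex on axis i.\<close>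
      have "rvec (axis_vertex d q i) \<in> rvec ` L" using axis_vertex_extreme[OF L(1)] L(2) by blast
      then obtain x where x: "x \<in> L" "rvec x = rvec (axis_vertex d q i)" by auto
      then have "x = axis_vertex d q i" by (simp add: rvec_def vec_eq_iff)
      then show ?thesis using x axis_vertex_mem[of d q i] unfolding L(3)
        by (intro bexI[of _ x]) (auto simp: axis_vertex_def)
    qed
    ultimately show "\<forall>c\<in>int_span A. \<forall>i. betti a (toric_ideal a :: ('v, 'k) mpoly set) i c =
         reduced_homology_dim TYPE('k) (pile_complex A (\<Sum>A - c - 1)) (int N - int n - int i - 1)"
      using h by (intro core) auto
  next
    fix d q
    assume h: "1 \<le> d \<and> weights_vector q \<and> A = {x. rvec x \<in> weighted_simplex d q} \<and> condition1 A"
    have "\<forall>x\<in>A. 0 \<le> x" using h by (auto simp: weighted_simplex_def rvec_def less_eq_vec_def)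
    moreover have "0 \<notin> A"
    proof
      assume "0 \<in> A"
      \<comment> \<open>At the zero vector the equation of the simplex would read 0 = d r, with d
        and r both positive.\<close>
      then have "d * Lcm (range (($) q)) = 0" using h by (auto simp: weighted_simplex_def rvec_def)
      moreover have "Lcm (range (($) q)) \<noteq> 0"
      proof -
        have "0 < q $ j" for j using h unfolding weights_vector_def by blast
        then have "0 \<notin> range (($) q)" by (metis less_irrefl rangeE)
        then show ?thesis by (simp add: Lcm_0_iff)
      qed
      ultimately show False using h by simp
    qed
    moreover have "\<exists>x\<in>A. \<forall>j. j \<noteq> i \<longrightarrow> x $ j = 0" for i
      using h axis_vertex_mem[of d q i] by (intro bexI[of _ "axis_vertex d q i"]) (auto simp: axis_vertex_def)
    ultimately show "\<forall>c\<in>int_span A. \<forall>i. betti a (toric_ideal a :: ('v, 'k) mpoly set) i c =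
         reduced_homology_dim TYPE('k) (pile_complex A (\<Sum>A - c - 1)) (int N - int n - int i - 1)"
      using h by (intro core) auto
  qed
qed

end
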